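(* Let $n\in\mathbb{N}$, $n\ge 1$. For any $t_0\in[0,1]$, any $\varepsilon>0$ and any $\Delta>0$, there exists a uniquely ergodic volume-preserving (i.e. $\lambda$-preserving) diffeomorphism $f\in C^\omega_\Delta(\mathbb{S}^{2n-1})$ (with holomorphic extensions of $f$ and $f^{-1}$) such that $$|f-\varphi^{t_0}|_\Delta<\varepsilon .$$ Furthermore, $f$ is obtained as a limit in the $C^\omega_\Delta$ norm of entire maps of the form $F_m=H_m\circ\varphi^{t_m}\circ H_m^{-1}$ with $H_m\in \mathrm{Ent}(\mathbb{S}^{2n-1},\lambda)$ and $t_m\in\mathbb{R}$, $m\geq 1$; that is, there are such sequences $(H_m)$, $(t_m)$ with $|F_m-f|_\Delta\to 0$ as $m\to\infty$.
   Context: $\mathbb{S}^{2n-1}\subset\mathbb{R}^{2n}\subset\mathbb{C}^{2n}$ is the standard unit sphere with the standard complexification of $\mathbb{R}^{2n}$, and $\lambda$ is Lebesgue (volume) measure on $\mathbb{S}^{2n-1}$. For $t\in\mathbb{R}$, $\varphi^t$ is the linear map acting on each pair of coordinates $(x_{2j-1},x_{2j})$, $1\le j\le n$, by $$(x_{2j-1},x_{2j})\mapsto(\cos(2\pi t)x_{2j-1}+\sin(2\pi t)x_{2j},\ -\sin(2\pi t)x_{2j-1}+\cos(2\pi t)x_{2j}).$$ It defines an action of the circle on $\mathbb{S}^{2n-1}$ ($\varphi^1=\mathrm{Id}$), and the same notation is used for its linear extension to $\mathbb{C}^{2n}$. For $\Delta>0$ let $B_\Delta=\{z\in\mathbb{C}^{2n}:|z|\le\Delta\}$.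 A function on $\mathbb{S}^{2n-1}$ is $C^\omega_\Delta$ if it extends to a function holomorphic on a neighbourhood of $\mathbb{S}^{2n-1}\cup B_\Delta$ in $\mathbb{C}^{2n}$, and entire if it extends to a holomorphic function on $\mathbb{C}^{2n}$. A map $\mathbb{S}^{2n-1}\to\mathbb{S}^{2n-1}$ is $C^\omega_\Delta$ (resp. entire) if its coordinate functions are. A diffeomorphism $f$ of $\mathbb{S}^{2n-1}$ is $C^\omega_\Delta$ (resp. entire) if both $f$ and $f^{-1}$ are; $C^\omega_\Delta(\mathbb{S}^{2n-1})$ denotes the set of $C^\omega_\Delta$ diffeomorphisms. $\mathrm{Ent}(\mathbb{S}^{2n-1},\lambda)$ is the group of entire diffeomorphisms of $\mathbb{S}^{2n-1}$ preserving $\lambda$. For diffeomorphisms $f,g\in C^\omega_\Delta(\mathbb{S}^{2n-1})$ (with holomorphic extensions of $f,g,f^{-1},g^{-1}$, denoted by the same letters), $$|f-g|_\Delta=\max\Big\{\max_{z\in B_\Delta}|f(z)-g(z)|,\ \max_{z\in B_\Delta}|f^{-1}(z)-g^{-1}(z)|\Big\}.$$ For $\varphi^{t}$ the linear extension is used, and for $F_m=H_m\circ\varphi^{t_m}\circ H_m^{-1}$ and $F_m^{-1}=H_m\circ\varphi^{-t_m}\circ H_m^{-1}$ the compositions of the entire extensions of $H_m$, $\varphi^{\pm t_m}$, $H_m^{-1}$ are used. A homeomorphism of a compact metric space is uniquely ergodic if it has only one invariant Borel probability measure. *)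

theory Defs
  imports "HOL-Probability.Probability"
begin

text \<open>
  The dimension \<open>n \<ge> 1\<close> is the cardinality of the index type \<open>'n\<close>. The spaces \<open>R\<^sup>2\<^sup>n\<close> and
  \<open>C\<^sup>2\<^sup>n\<close> are \<open>real^('n \<times> 2)\<close> and \<open>complex^('n \<times> 2)\<close>: the components at \<open>(j, 1)\<close> and \<open>(j, 2)\<close>
  are the coordinates number \<open>2j - 1\<close> and \<open>2j\<close>. Maps of the sphere are total functions of which
  only the values on \<open>sphere 0 1\<close> matter, and the inverse of such a map \<open>f\<close> is
  \<open>inv_into (sphere 0 1) f\<close>.
\<close>

text \<open>The coefficients act by real scalar multiplication, so that one formula gives both the
  circle action on the real space and its linear extension to the complex one.\<close>

definition rot :: "real \<Rightarrow> 'a::real_vector^('n::finite \<times> 2) \<Rightarrow> 'a^('n \<times> 2)" where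
  "rot t x = vec_lambda (\<lambda>(j, k).
     if k = 1 then cos (2 * pi * t) *\<^sub>R x $ (j, 1) + sin (2 * pi * t) *\<^sub>R x $ (j, 2)
     else - sin (2 * pi * t) *\<^sub>R x $ (j, 1) + cos (2 * pi * t) *\<^sub>R x $ (j, 2))"

definition cvec :: "real^'m \<Rightarrow> complex^'m" where
  "cvec x = (\<chi> i. complex_of_real (x $ i))"

text \<open>Holomorphy in several variables: the Frechet derivative exists and is complex linear. It is
  used for open sets only.\<close>

definition holomorphic_cn_on :: "(complex^'m::finite \<Rightarrow> complex) \<Rightarrow> (complex^'m) set \<Rightarrow> bool" where
  "holomorphic_cn_on f U \<longleftrightarrow>
     (\<forall>z\<in>U. \<exists>D. (f has_derivative D) (at z) \<and> (\<forall>c v. D (c *s v) = c * D v))"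


subsection \<open>Analytic and entire maps of the sphere\<close>

text \<open>
  A holomorphic extension of a function on the sphere is not unique (consider multiples of
  \<open>(\<Sum>i. z\<^sub>i\<^sup>2) - 1\<close>), and the norms below depend on it. Hence there are predicates relating a
  function to a given extension.
\<close>

definition analytic_ext :: "real \<Rightarrow> (real^'m::finite \<Rightarrow> real) \<Rightarrow> (complex^'m \<Rightarrow> complex) \<Rightarrow> bool" where
  "analytic_ext \<Delta> g G \<longleftrightarrow>
     (\<exists>U. open U \<and> cvec ` sphere 0 1 \<union> cball 0 \<Delta> \<subseteq> U \<and> holomorphic_cn_on G U) \<and>
     (\<forall>x\<in>sphere 0 1. G (cvec x) = complex_of_real (g x))"

definition entire_ext :: "(real^'m::finite \<Rightarrow> real) \<Rightarrow> (complex^'m \<Rightarrow> complex) \<Rightarrow> bool" where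
  "entire_ext g G \<longleftrightarrow>
     holomorphic_cn_on G UNIV \<and> (\<forall>x\<in>sphere 0 1. G (cvec x) = complex_of_real (g x))"

definition analytic_map_ext ::
    "real \<Rightarrow> (real^'m::finite \<Rightarrow> real^'m) \<Rightarrow> (complex^'m \<Rightarrow> complex^'m) \<Rightarrow> bool" where
  "analytic_map_ext \<Delta> f F \<longleftrightarrow>
     f \<in> sphere 0 1 \<rightarrow> sphere 0 1 \<and> (\<forall>i. analytic_ext \<Delta> (\<lambda>x. f x $ i) (\<lambda>z. F z $ i))"

definition entire_map_ext ::
    "(real^'m::finite \<Rightarrow> real^'m) \<Rightarrow> (complex^'m \<Rightarrow> complex^'m) \<Rightarrow> bool" where
  "entire_map_ext f F \<longleftrightarrow>
     f \<in> sphere 0 1 \<rightarrow> sphere 0 1 \<and> (\<forall>i. entire_ext (\<lambda>x. f x $ i) (\<lambda>z. F z $ i))"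

text \<open>Smoothness of a map and of its inverse is contained in the existence of extensions that are
  holomorphic near the sphere, so bijectivity is all that has to be added to obtain
  diffeomorphisms.\<close>

definition analytic_diffeos :: "real \<Rightarrow> (real^'m::finite \<Rightarrow> real^'m) set" where
  "analytic_diffeos \<Delta> = {f. bij_betw f (sphere 0 1) (sphere 0 1) \<and>
     (\<exists>F. analytic_map_ext \<Delta> f F) \<and> (\<exists>F'. analytic_map_ext \<Delta> (inv_into (sphere 0 1) f) F')}"

definition entire_diffeos :: "(real^'m::finite \<Rightarrow> real^'m) set" where
  "entire_diffeos = {f. bij_betw f (sphere 0 1) (sphere 0 1) \<and>
     (\<exists>F. entire_map_ext f F) \<and> (\<exists>F'. entire_map_ext (inv_into (sphere 0 1) f) F')}"

text \<open>A diffeomorphism is represented here by the pair of the chosen extensions of the map and of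
  its inverse. The suprema are maxima, as the extensions are continuous on the closed ball.\<close>

definition analytic_dist :: "real \<Rightarrow>
    (complex^'m::finite \<Rightarrow> complex^'m) \<times> (complex^'m \<Rightarrow> complex^'m) \<Rightarrow>
    (complex^'m \<Rightarrow> complex^'m) \<times> (complex^'m \<Rightarrow> complex^'m) \<Rightarrow> real" where
  "analytic_dist \<Delta> = (\<lambda>(F, F') (G, G').
     max (SUP z\<in>cball 0 \<Delta>. norm (F z - G z)) (SUP z\<in>cball 0 \<Delta>. norm (F' z - G' z)))"


subsection \<open>Volume and invariant measures\<close>

text \<open>The volume of a Borel subset of the unit sphere is the dimension of the ambient space times
  the Lebesgue measure of the cone over the set, see \<open>emeasure_sphere_volume\<close>.\<close>

definition sphere_volume :: "'a::euclidean_space measure" where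
  "sphere_volume = scale_measure (of_nat DIM('a))
     (distr (restrict_space lborel (cball 0 1 - {0})) (restrict_space borel (sphere 0 1)) sgn)"

definition invariant_measure :: "'a measure \<Rightarrow> ('a \<Rightarrow> 'a) \<Rightarrow> bool" where
  "invariant_measure M f \<longleftrightarrow> f \<in> measurable M M \<and> distr M M f = M"

definition uniquely_ergodic_on :: "'a::metric_space set \<Rightarrow> ('a \<Rightarrow> 'a) \<Rightarrow> bool" where
  "uniquely_ergodic_on X f \<longleftrightarrow> compact X \<and> (\<exists>g. homeomorphism X X f g) \<and>
     (\<exists>!M. sets M = sets (restrict_space borel X) \<and> prob_space M \<and> invariant_measure M f)"

definition entire_volume_diffeos :: "(real^'m::finite \<Rightarrow> real^'m) set" where
  "entire_volume_diffeos = {f \<in> entire_diffeos. invariant_measure sphere_volume f}"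

lemma sets_sphere_volume:
  "sets (sphere_volume :: 'a::euclidean_space measure) = sets (restrict_space borel (sphere 0 1))"
  by (simp add: sphere_volume_def)

lemma emeasure_sphere_volume:
  fixes A :: "'a::euclidean_space set"
  assumes "A \<in> sets borel" "A \<subseteq> sphere 0 1"
  shows "emeasure sphere_volume A =
    of_nat DIM('a) * emeasure lborel {r *\<^sub>R x | r x. 0 < r \<and> r \<le> 1 \<and> x \<in> A}"
proof -
  let ?B = "cball (0::'a) 1 - {0}"
  have B: "?B \<in> sets borel" by auto
  have sgn_borel: "sgn \<in> borel_measurable (borel :: 'a measure)"
    unfolding sgn_div_norm by measurable
  have sgn: "sgn \<in> measurable (restrict_space lborel ?B) (restrict_space borel (sphere 0 1))"
    by (rule measurable_restrict_space3) (use sgn_borel in \<open>auto simp: norm_sgn\<close>)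
  have A: "A \<in> sets (restrict_space borel (sphere 0 1))"
    using assms by (auto simp: sets_restrict_space)
  have "sgn -` A \<inter> ?B = {r *\<^sub>R x | r x. 0 < r \<and> r \<le> 1 \<and> x \<in> A}"
  proof (intro equalityI subsetI)
    fix y assume y: "y \<in> sgn -` A \<inter> ?B"
    then have "y = norm y *\<^sub>R sgn y" by (simp add: sgn_div_norm)
    with y show "y \<in> {r *\<^sub>R x | r x. 0 < r \<and> r \<le> 1 \<and> x \<in> A}"
      by (auto intro!: exI[of _ "norm y"] exI[of _ "sgn y"])
  next
    fix y assume "y \<in> {r *\<^sub>R x | r x. 0 < r \<and> r \<le> 1 \<and> x \<in> A}"
    then obtain r x where y: "y = r *\<^sub>R x" "0 < r" "r \<le> 1" "x \<in> A" by blast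
    then have "norm x = 1" using assms(2) by auto
    with y show "y \<in> sgn -` A \<inter> ?B" by (auto simp: sgn_div_norm)
  qed
  moreover have "emeasure (restrict_space lborel ?B) (sgn -` A \<inter> ?B) =
      emeasure lborel (sgn -` A \<inter> ?B)"
    by (rule emeasure_restrict_space) auto
  ultimately show ?thesis
    using sgn A by (simp add: sphere_volume_def emeasure_distr space_restrict_space)
qed

end

theory Submission
  imports Defs "HOL-Complex_Analysis.Complex_Analysis"
begin

text \<open>
  The map \<open>f\<close> is a limit of conjugates \<open>h\<^sub>n \<circ> rot t\<^sub>n \<circ> h\<^sub>n\<inverse>\<close> (the method of Anosov and Katok), where
  \<open>h\<^sub>n\<^sub>+\<^sub>1 = h\<^sub>n \<circ> k\<close> with an entire volume-preserving \<open>k\<close> that commutes with the rational rotation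
  \<open>rot t\<^sub>n\<close>. Passing from \<open>h\<^sub>n\<close> to \<open>h\<^sub>n\<^sub>+\<^sub>1\<close> does not change the conjugate of \<open>rot t\<^sub>n\<close>, so \<open>t\<^sub>n\<^sub>+\<^sub>1\<close>
  can be taken so close to \<open>t\<^sub>n\<close> that the maps converge. The map \<open>k\<close> is chosen such that \<open>h\<^sub>n\<^sub>+\<^sub>1\<close>
  makes the average of a given function over all circles \<open>{rot s x}\<close> nearly the same.

  To obtain \<open>k\<close>, let \<open>circ u s\<close> rotate the complex line of the unit vector \<open>u\<close> and fix its complement,
  and let \<open>p\<close> be a coordinate of the projection to that complement. The twist
  \<open>x \<mapsto> circ u (A Re (p(x)\<^sup>Q)) x\<close> is entire, and it preserves volume because \<open>p\<close> is constant on the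
  orbits of \<open>circ u\<close>. For large \<open>Q\<close> and then large \<open>A\<close> its effect on averages over the circles of \<open>rot\<close>
  is the averaging over \<open>circ u\<close>. Repeated averages of this kind, for suitable \<open>u\<close>, make every
  continuous function nearly constant, as one \<open>circ u\<close> carries any point of the sphere to any other.
\<close>

subsection \<open>Rotations of a complex line\<close>

text \<open>Holomorphic extensions to a large ball exclude conjugacies glued from bump functions,
  and the inverse of an entire map is rarely entire. A rotation whose angle is a polynomial constant
  along the orbits of \<open>circ u\<close> avoids both obstacles: reversing the sign of the angle
  inverts it. The power \<open>Q\<close> has two tasks. Divisible by the denominator of the current
  rotation number, it makes the angle invariant under that rotation; large, it makes the angle
  oscillate fast along the orbits of \<open>rot\<close>, so that an average over such an orbit sees
  all phases.

  The price is that a twist hardly acts where its coordinate is small. All coordinates are therefore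
  used in turn, and near the complex line of \<open>u\<close>, where all of them fail,
  \<open>circ u\<close> almost agrees with \<open>rot\<close>.

  Unique ergodicity is controlled through finite Birkhoff averages of countably many test functions.
  That one such average is nearly constant on the whole sphere is stable under uniformly small
  changes of the map, so a tolerance fixed at each step lets the limit inherit it.\<close>

definition dot :: "'a::comm_ring_1^'m::finite \<Rightarrow> 'a^'m \<Rightarrow> 'a" where
  "dot x y = (\<Sum>i\<in>UNIV. x $ i * y $ i)"

text \<open>Reading a pair of coordinates as x1 + i x2, this is multiplication by -i, so
  \<open>rot t\<close> is multiplication by exp(-2 pi i t). Over the complex numbers
  \<open>J\<close> commutes with all scalars and \<open>dot\<close> is bilinear without conjugation;
  this keeps the maps built from them holomorphic.\<close>

definition J :: "'a::comm_ring_1^('n::finite \<times> 2) \<Rightarrow> 'a^('n \<times> 2)" where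
  "J x = (\<chi> p. if snd p = 1 then x $ (fst p, 2) else - x $ (fst p, 1))"

text \<open>For \<open>c\<^sup>2 + s\<^sup>2 = 1\<close> and a unit vector \<open>u\<close> this is the rotation of the plane of \<open>u\<close> and \<open>J u\<close> that
  fixes the orthogonal complement; over the complex numbers it is the holomorphic extension.\<close>

definition plane_rot ::
    "'a::comm_ring_1^('n::finite \<times> 2) \<Rightarrow> 'a \<Rightarrow> 'a \<Rightarrow> 'a^('n \<times> 2) \<Rightarrow> 'a^('n \<times> 2)" where
  "plane_rot u c s x = x + ((c - 1) * dot x u - s * dot x (J u)) *s u
     + ((c - 1) * dot x (J u) + s * dot x u) *s J u"

definition perp :: "'a::comm_ring_1^('n::finite \<times> 2) \<Rightarrow> 'a^('n \<times> 2) \<Rightarrow> 'a^('n \<times> 2)" where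
  "perp u x = x - dot x u *s u - dot x (J u) *s J u"

lemma dot_commute: "dot x y = dot y x"
  by (simp add: dot_def mult.commute)

lemma dot_simps:
  "dot (x + y) z = dot x z + dot y z" "dot (x - y) z = dot x z - dot y z"
  "dot (c *s x) z = c * dot x z" "dot (- x) z = - dot x z"
  "dot z (x + y) = dot z x + dot z y" "dot z (x - y) = dot z x - dot z y"
  "dot z (c *s x) = c * dot z x" "dot z (- x) = - dot z x"
  by (simp_all add: dot_def algebra_simps sum.distrib sum_subtractf sum_distrib_left sum_negf)

lemma J_nth: "J x $ (j, 1) = x $ (j, 2)" "J x $ (j, 2) = - x $ (j, 1)"
  by (simp_all add: J_def)

lemma vec2_eq_iff:
  "x = y \<longleftrightarrow> (\<forall>j. x $ (j, 1 :: 2) = y $ (j, 1) \<and> x $ (j, 2) = y $ (j, 2))"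
  by (auto simp: vec_eq_iff forall_2)

lemma J_simps: "J (x + y) = J x + J y" "J (x - y) = J x - J y" "J (c *s x) = c *s J x"
  "J (- x) = - J x" "J (J x) = - x"
  by (simp_all add: vec2_eq_iff J_nth)

lemma dot_pairs: "dot x y = (\<Sum>j\<in>UNIV. x $ (j, 1 :: 2) * y $ (j, 1) + x $ (j, 2) * y $ (j, 2))"
proof -
  have "dot x y = (\<Sum>j\<in>UNIV. \<Sum>k\<in>UNIV. x $ (j, k) * y $ (j, k))"
    by (simp add: dot_def sum.cartesian_product)
  then show ?thesis by (simp add: sum_2)
qed

lemma dot_J: "dot (J x) y = - dot x (J y)"
  by (auto simp: dot_pairs J_nth algebra_simps simp flip: sum_negf intro!: sum.cong)

lemma dot_J_J: "dot (J x) (J y) = dot x y"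
  by (simp add: dot_J J_simps dot_simps)

lemma dot_J_self:
  fixes x :: "'a::comm_ring_1^('n::finite \<times> 2)"
  shows "dot x (J x) = 0"
  by (simp add: dot_pairs J_nth algebra_simps)

lemma dot_J_self': "dot (J x) x = 0"
  by (simp add: dot_J dot_J_self)

lemmas J_dot_simps = dot_simps J_simps dot_J_J dot_J_self dot_J_self'

lemma plane_rot_one [simp]: "plane_rot u 1 0 x = x"
  by (simp add: plane_rot_def)

lemma dot_plane_rot:
  assumes "dot u u = 1"
  shows "dot (plane_rot u c s x) u = c * dot x u - s * dot x (J u)"
    "dot (plane_rot u c s x) (J u) = c * dot x (J u) + s * dot x u"
  by (simp_all add: plane_rot_def J_dot_simps assms algebra_simps)

lemma plane_rot_compose:
  assumes "dot u u = 1"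
  shows "plane_rot u c s (plane_rot u c' s' x) = plane_rot u (c * c' - s * s') (s * c' + c * s') x"
  unfolding plane_rot_def[of u c s "plane_rot u c' s' x"] dot_plane_rot[OF assms]
  by (simp add: plane_rot_def vec_eq_iff algebra_simps)

text \<open>The span of \<open>u\<close> and \<open>J u\<close> is invariant under \<open>J\<close>,
  which acts on it as a quarter turn. Since \<open>rot t\<close> is a combination of the identity
  and \<open>J\<close>, both circle actions commute.\<close>

lemma plane_rot_J: "plane_rot u c s (J x) = J (plane_rot u c s x)"
  by (simp add: plane_rot_def J_dot_simps dot_J vec_eq_iff algebra_simps)

lemma plane_rot_linear:
  "plane_rot u c s (x + y) = plane_rot u c s x + plane_rot u c s y"
  "plane_rot u c s (x - y) = plane_rot u c s x - plane_rot u c s y"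
  "plane_rot u c s (a *s x) = a *s plane_rot u c s x"
  by (simp_all add: plane_rot_def J_dot_simps vec_eq_iff algebra_simps)

lemma dot_plane_rot_self:
  assumes "dot u u = 1" "c * c + s * s = 1"
  shows "dot (plane_rot u c s x) (plane_rot u c s x) = dot x x"
proof -
  have "dot (plane_rot u c s x) (plane_rot u c s x) = dot x x +
      (c * c + s * s - 1) * (dot x u * dot x u + dot x (J u) * dot x (J u))"
    by (simp add: plane_rot_def J_dot_simps assms(1) dot_commute[of u x] dot_commute[of "J u" x] algebra_simps)
  with assms(2) show ?thesis by simp
qed

lemma perp_linear:
  "perp u (x + y) = perp u x + perp u y" "perp u (a *s x) = a *s perp u x"
  by (simp_all add: perp_def J_dot_simps vec_eq_iff algebra_simps)

lemma perp_J: "perp u (J x) = J (perp u x)"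
  by (simp add: perp_def J_dot_simps dot_J vec_eq_iff algebra_simps)

lemma perp_plane_rot:
  assumes "dot u u = 1"
  shows "perp u (plane_rot u c s x) = perp u x"
  unfolding perp_def dot_plane_rot[OF assms]
  by (simp add: plane_rot_def vec_eq_iff algebra_simps)

subsection \<open>The circle action\<close>

lemma rot_nth:
  "rot t x $ (j, 1) = cos (2 * pi * t) *\<^sub>R x $ (j, 1) + sin (2 * pi * t) *\<^sub>R x $ (j, 2)"
  "rot t x $ (j, 2) = - sin (2 * pi * t) *\<^sub>R x $ (j, 1) + cos (2 * pi * t) *\<^sub>R x $ (j, 2)"
  by (simp_all add: rot_def)

lemma rot_eq_J:
  fixes x :: "'a::{comm_ring_1, real_algebra_1}^('n::finite \<times> 2)"
  shows "rot t x = of_real (cos (2 * pi * t)) *s x + of_real (sin (2 * pi * t)) *s J x"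
  by (simp add: vec2_eq_iff rot_nth J_nth scaleR_conv_of_real)

lemma rot_0 [simp]: "rot 0 x = x"
  by (simp add: vec2_eq_iff rot_nth)

lemma rot_add: "rot (s + t) x = rot s (rot t x)"
  by (simp add: vec2_eq_iff rot_nth ring_distribs cos_add sin_add scaleR_add_left scaleR_diff_left
      scaleR_add_right) (simp add: algebra_simps)

lemma rot_plus_1 [simp]: "rot (t + 1) x = rot t x"
  by (simp add: vec2_eq_iff rot_nth ring_distribs)

lemma rot_minus_cancel [simp]: "rot (- t) (rot t x) = x" "rot t (rot (- t) x) = x"
  by (simp_all flip: rot_add)

lemma rot_of_nat [simp]: "rot (real n) x = x"
  by (induction n) (simp_all add: add.commute[of 1])

lemma rot_power: "(rot t ^^ n) x = rot (real n * t) x"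
  by (induction n) (simp_all add: ring_distribs rot_add)

lemma plane_rot_rot:
  fixes x :: "'a::{comm_ring_1, real_algebra_1}^('n::finite \<times> 2)"
  shows "plane_rot u c s (rot t x) = rot t (plane_rot u c s x)"
  by (simp add: rot_eq_J plane_rot_linear plane_rot_J)

lemma perp_rot:
  fixes x :: "'a::{comm_ring_1, real_algebra_1}^('n::finite \<times> 2)"
  shows "perp u (rot t x) = rot t (perp u x)"
  by (simp add: rot_eq_J perp_linear perp_J)

lemma dot_rot_self:
  fixes x :: "'a::{comm_ring_1, real_algebra_1}^('n::finite \<times> 2)"
  shows "dot (rot t x) (rot t x) = dot x x"
proof -
  let ?c = "of_real (cos (2 * pi * t)) :: 'a" and ?s = "of_real (sin (2 * pi * t)) :: 'a"
  have "?c * ?c + ?s * ?s = of_real ((cos (2 * pi * t))\<^sup>2 + (sin (2 * pi * t))\<^sup>2)"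
    by (simp only: power2_eq_square of_real_add of_real_mult)
  then have cs: "?c * ?c + ?s * ?s = 1" by simp
  have "dot (rot t x) (rot t x) = (?c * ?c + ?s * ?s) * dot x x"
    by (simp add: rot_eq_J J_dot_simps algebra_simps)
  with cs show ?thesis by simp
qed

lemma dot_real: "dot x y = (x :: real^'m::finite) \<bullet> y"
  by (simp add: dot_def inner_vec_def)

lemma norm_eq_dot: "norm (x :: real^'m::finite) = sqrt (dot x x)"
  by (simp add: dot_real norm_eq_sqrt_inner)

lemma norm_rot [simp]:
  fixes x :: "real^('n::finite \<times> 2)"
  shows "norm (rot t x) = norm x"
  by (simp add: norm_eq_dot dot_rot_self)

lemma norm_J [simp]:
  fixes x :: "real^('n::finite \<times> 2)"
  shows "norm (J x) = norm x"
  by (simp add: norm_eq_dot dot_J_J)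

lemma rot_diff: "rot t (x - y) = rot t x - rot t y"
  by (simp add: vec2_eq_iff rot_nth algebra_simps)

lemma abs_sin_diff_le: "\<bar>sin a - sin b\<bar> \<le> \<bar>a - b\<bar>" for a b :: real
proof -
  have "norm (sin a - sin b) \<le> 1 * norm (a - b)"
    by (rule field_differentiable_bound[where S = UNIV and f' = cos])
      (auto intro!: derivative_eq_intros)
  then show ?thesis by simp
qed

lemma abs_cos_diff_le: "\<bar>cos a - cos b\<bar> \<le> \<bar>a - b\<bar>" for a b :: real
proof -
  have "norm (cos a - cos b) \<le> 1 * norm (a - b)"
    by (rule field_differentiable_bound[where S = UNIV and f' = "\<lambda>x. - sin x"])
      (auto intro!: derivative_eq_intros)
  then show ?thesis by simp
qed

lemma norm_rot_diff_le:
  fixes x :: "real^('n::finite \<times> 2)"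
  shows "norm (rot s x - rot t x) \<le> 4 * pi * \<bar>s - t\<bar> * norm x"
proof -
  have "rot s x - rot t x = (cos (2 * pi * s) - cos (2 * pi * t)) *\<^sub>R x
      + (sin (2 * pi * s) - sin (2 * pi * t)) *\<^sub>R J x"
    by (simp add: rot_eq_J vec_eq_iff algebra_simps)
  then have "norm (rot s x - rot t x) \<le> \<bar>cos (2 * pi * s) - cos (2 * pi * t)\<bar> * norm x
      + \<bar>sin (2 * pi * s) - sin (2 * pi * t)\<bar> * norm x"
    by (metis norm_J norm_scaleR norm_triangle_ineq)
  also have "\<dots> \<le> \<bar>2 * pi * s - 2 * pi * t\<bar> * norm x + \<bar>2 * pi * s - 2 * pi * t\<bar> * norm x"
    by (intro add_mono mult_right_mono abs_sin_diff_le abs_cos_diff_le) auto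
  also have "\<bar>2 * pi * s - 2 * pi * t\<bar> = 2 * pi * \<bar>s - t\<bar>"
    by (simp add: abs_mult flip: right_diff_distrib)
  finally show ?thesis by (simp add: mult_ac)
qed

section \<open>The real space inside the complex one\<close>

lemma cvec_nth [simp]: "cvec x $ i = of_real (x $ i)"
  by (simp add: cvec_def)

lemma cvec_inject [simp]: "cvec x = cvec y \<longleftrightarrow> x = y"
  by (simp add: vec_eq_iff)

lemma cvec_simps: "cvec (x + y) = cvec x + cvec y" "cvec (x - y) = cvec x - cvec y"
  "cvec (a *s x) = of_real a *s cvec x" "cvec (J z) = J (cvec z)"
  by (simp_all add: vec_eq_iff J_def)

lemma dot_cvec: "dot (cvec x) (cvec y) = of_real (dot x y)"
  by (simp add: dot_def)

lemma cvec_rot: "cvec (rot t x) = rot t (cvec x)"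
  by (simp add: rot_eq_J cvec_simps)

lemma cvec_plane_rot: "cvec (plane_rot u c s x) = plane_rot (cvec u) (of_real c) (of_real s) (cvec x)"
  by (simp add: plane_rot_def cvec_simps dot_cvec flip: cvec_simps(4))

lemma cvec_perp: "cvec (perp u x) = perp (cvec u) (cvec x)"
  by (simp add: perp_def cvec_simps dot_cvec flip: cvec_simps(4))

lemma norm_cvec [simp]: "norm (cvec x) = norm x"
  by (simp add: norm_vec_def)

lemma bounded_linear_cvec: "bounded_linear cvec"
  by (rule bounded_linear_intro[where K = 1])
    (auto simp: vec_eq_iff, simp_all add: norm_vec_def scaleR_conv_of_real)

lemma norm_cvec_diff: "norm (cvec x - cvec y) = norm (x - y)"
  by (simp flip: cvec_simps)

subsection \<open>Integrals of periodic functions\<close>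

text \<open>An antiderivative on the whole line turns shifts, dilations and Riemann sums of a
  periodic function into statements about increments.\<close>

lemma continuous_has_antiderivative:
  fixes g :: "real \<Rightarrow> real"
  assumes "continuous_on UNIV g"
  obtains \<Gamma> where "\<And>x. (\<Gamma> has_real_derivative g x) (at x)"
proof -
  have "\<exists>F. \<forall>x::real. -\<infinity> < ereal x \<longrightarrow> ereal x < \<infinity> \<longrightarrow> (F has_vector_derivative g x) (at x)"
    by (rule einterval_antiderivative) (use assms in \<open>auto simp: continuous_on_eq_continuous_at\<close>)
  then show ?thesis
    using that by (auto simp: has_real_derivative_iff_has_vector_derivative)
qed

lemma integral_antiderivative:
  fixes \<Gamma> :: "real \<Rightarrow> real"
  assumes "\<And>x. (\<Gamma> has_real_derivative g x) (at x)" "a \<le> b"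
  shows "(g has_integral (\<Gamma> b - \<Gamma> a)) {a..b}"
  using assms
  by (intro fundamental_theorem_of_calculus)
    (auto simp flip: has_real_derivative_iff_has_vector_derivative intro: has_field_derivative_at_within)

lemma periodic_of_nat:
  fixes g :: "real \<Rightarrow> 'a"
  assumes "\<And>x. g (x + 1) = g x"
  shows "g (x + real n) = g x"
proof (induction n)
  case (Suc n)
  then show ?case using assms[of "x + real n"] by (simp add: add_ac)
qed simp

lemma periodic_frac:
  fixes g :: "real \<Rightarrow> 'a"
  assumes per: "\<And>x. g (x + 1) = g x"
  shows "g (frac x) = g x"
proof (cases "0 \<le> \<lfloor>x\<rfloor>")
  case True
  then have "frac x + real (nat \<lfloor>x\<rfloor>) = x" by (simp add: frac_def)
  then show ?thesis using periodic_of_nat[of g "frac x" "nat \<lfloor>x\<rfloor>", OF per] by simp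
next
  case False
  then have "x + real (nat (- \<lfloor>x\<rfloor>)) = frac x" by (simp add: frac_def)
  then show ?thesis using periodic_of_nat[of g x "nat (- \<lfloor>x\<rfloor>)", OF per] by simp
qed

text \<open>The increment over one period has derivative \<open>g (x + 1) - g x = 0\<close>,
  although \<open>\<Gamma>\<close> itself is periodic only if the mean vanishes.\<close>

lemma antiderivative_periodic:
  fixes \<Gamma> :: "real \<Rightarrow> real"
  assumes \<Gamma>: "\<And>x. (\<Gamma> has_real_derivative g x) (at x)" and per: "\<And>x. g (x + 1) = g x"
  shows "\<Gamma> (c + 1) - \<Gamma> c = \<Gamma> 1 - \<Gamma> 0"
proof -
  have "((\<lambda>x. \<Gamma> (x + 1) - \<Gamma> x) has_real_derivative 0) (at x)" for x
    using \<Gamma>[of "x + 1"] \<Gamma>[of x] per[of x]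
    by (auto intro!: derivative_eq_intros DERIV_chain2[where f = \<Gamma>])
  then show ?thesis
    using DERIV_isconst_all[of "\<lambda>x. \<Gamma> (x + 1) - \<Gamma> x" c 0] by simp
qed

lemma has_integral_periodic_shift:
  fixes g :: "real \<Rightarrow> real"
  assumes cont: "continuous_on UNIV g" and per: "\<And>x. g (x + 1) = g x"
  shows "((\<lambda>t. g (t + c)) has_integral (integral {0..1} g)) {0..1}"
proof -
  obtain \<Gamma> where \<Gamma>: "\<And>x. (\<Gamma> has_real_derivative g x) (at x)"
    using continuous_has_antiderivative[OF cont] by blast
  have "((\<lambda>x. \<Gamma> (x + c)) has_real_derivative g (x + c)) (at x)" for x
    using \<Gamma>[of "x + c"] by (simp add: DERIV_shift)
  from integral_antiderivative[OF this, of 0 1]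
  have "((\<lambda>t. g (t + c)) has_integral (\<Gamma> (c + 1) - \<Gamma> c)) {0..1}"
    by (simp add: add.commute)
  moreover have "integral {0..1} g = \<Gamma> 1 - \<Gamma> 0"
    using integral_antiderivative[OF \<Gamma>, of 0 1] by (simp add: integral_unique)
  ultimately show ?thesis using antiderivative_periodic[OF \<Gamma> per] by simp
qed

lemma integral_periodic_shift:
  fixes g :: "real \<Rightarrow> real"
  assumes "continuous_on UNIV g" "\<And>x. g (x + 1) = g x"
  shows "integral {0..1} (\<lambda>t. g (t + c)) = integral {0..1} g"
  using has_integral_periodic_shift[OF assms] by (rule integral_unique)

lemma integral_periodic_scale:
  fixes g :: "real \<Rightarrow> real"
  assumes cont: "continuous_on UNIV g" and per: "\<And>x. g (x + 1) = g x" and "Q \<ge> 1"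
  shows "integral {0..1} (\<lambda>t. g (real Q * t)) = integral {0..1} g"
proof -
  obtain \<Gamma> where \<Gamma>: "\<And>x. (\<Gamma> has_real_derivative g x) (at x)"
    using continuous_has_antiderivative[OF cont] by blast
  have "((\<lambda>x. \<Gamma> (real Q * x) / real Q) has_real_derivative g (real Q * x)) (at x)" for x
    using \<Gamma>[of "real Q * x"] \<open>Q \<ge> 1\<close>
    by (auto intro!: derivative_eq_intros DERIV_chain2[where f = \<Gamma>])
  from integral_antiderivative[OF this, of 0 1]
  have "integral {0..1} (\<lambda>t. g (real Q * t)) = (\<Gamma> (real Q) - \<Gamma> 0) / real Q"
    by (simp add: integral_unique diff_divide_distrib)
  moreover have "\<Gamma> (real n) - \<Gamma> 0 = real n * (\<Gamma> 1 - \<Gamma> 0)" for n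
  proof (induction n)
    case (Suc n)
    then show ?case using antiderivative_periodic[OF \<Gamma> per, of "real n"]
      by (simp add: algebra_simps)
  qed simp
  moreover have "integral {0..1} g = \<Gamma> 1 - \<Gamma> 0"
    using integral_antiderivative[OF \<Gamma>, of 0 1] by (simp add: integral_unique)
  ultimately show ?thesis using \<open>Q \<ge> 1\<close> by simp
qed

lemma integral_le_bound:
  fixes f :: "real \<Rightarrow> real"
  assumes "continuous_on {0..1} f" "\<And>t. t \<in> {0..1} \<Longrightarrow> \<bar>f t\<bar> \<le> B"
  shows "\<bar>integral {0..1} f\<bar> \<le> B"
  using integral_bound[of 0 1 f B] assms by simp

lemma integral_diff_le:
  fixes f g :: "real \<Rightarrow> real"
  assumes "continuous_on {0..1} f" "continuous_on {0..1} g"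
    and "\<And>t. t \<in> {0..1} \<Longrightarrow> \<bar>f t - g t\<bar> \<le> B"
  shows "\<bar>integral {0..1} f - integral {0..1} g\<bar> \<le> B"
proof -
  have "integral {0..1} f - integral {0..1} g = integral {0..1} (\<lambda>t. f t - g t)"
    using assms by (simp add: integral_diff integrable_continuous_real)
  then show ?thesis
    using integral_le_bound[of "\<lambda>t. f t - g t" B] assms by (simp add: continuous_on_diff)
qed

text \<open>Averaged over all shifts by at most one mesh width, the Riemann sum is exactly the
  integral, because the increments of an antiderivative telescope over a period. A single sum
  differs from each shifted one by at most \<open>\<epsilon>\<close>.\<close>

lemma riemann_sum_periodic:
  fixes g :: "real \<Rightarrow> real"
  assumes cont: "continuous_on UNIV g" and per: "\<And>x. g (x + 1) = g x" and "M \<ge> 1"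
    and close: "\<And>x y. \<bar>x - y\<bar> \<le> 1 / real M \<Longrightarrow> \<bar>g x - g y\<bar> \<le> \<epsilon>"
  shows "\<bar>(\<Sum>b<M. g (c + real b / real M)) / real M - integral {0..1} g\<bar> \<le> \<epsilon>"
proof -
  have "integral {0..1} (\<lambda>t. \<Sum>b<M. g (t / real M + (c + real b / real M)) / real M)
      = integral {0..1} g"
  proof -
    obtain \<Gamma> where \<Gamma>: "\<And>x. (\<Gamma> has_real_derivative g x) (at x)"
      using continuous_has_antiderivative[OF cont] by blast
    let ?F = "\<lambda>t. \<Sum>b<M. \<Gamma> (t / real M + (c + real b / real M))"
    have "(?F has_real_derivative (\<Sum>b<M. g (x / real M + (c + real b / real M)) / real M)) (at x)" for x
      using \<open>M \<ge> 1\<close>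
      by (auto intro!: derivative_eq_intros DERIV_chain2[where f = \<Gamma>] \<Gamma> sum.cong)
    from integral_antiderivative[OF this, of 0 1]
    have "integral {0..1} (\<lambda>t. \<Sum>b<M. g (t / real M + (c + real b / real M)) / real M)
       = ?F 1 - ?F 0"
      by (simp add: integral_unique)
    also have "\<dots> = (\<Sum>b<M. \<Gamma> (c + real (Suc b) / real M) - \<Gamma> (c + real b / real M))"
      by (simp add: sum_subtractf add_divide_distrib add_ac)
    also have "\<dots> = \<Gamma> (c + 1) - \<Gamma> c"
      using \<open>M \<ge> 1\<close> by (subst sum_lessThan_telescope) simp
    also have "\<dots> = integral {0..1} g"
      using integral_antiderivative[OF \<Gamma>, of 0 1] antiderivative_periodic[OF \<Gamma> per]
      by (simp add: integral_unique)
    finally show ?thesis .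
  qed
  moreover have "\<bar>integral {0..1} (\<lambda>t::real. (\<Sum>b<M. g (c + real b / real M)) / real M) -
      integral {0..1} (\<lambda>t. \<Sum>b<M. g (t / real M + (c + real b / real M)) / real M)\<bar> \<le> \<epsilon>"
  proof (rule integral_diff_le)
    show "continuous_on {0..1} (\<lambda>t. \<Sum>b<M. g (t / real M + (c + real b / real M)) / real M)"
      using \<open>M \<ge> 1\<close> by (intro continuous_intros continuous_on_compose2[OF cont]) auto
    fix t :: real assume t: "t \<in> {0..1}"
    have "\<bar>(\<Sum>b<M. g (c + real b / real M)) / real M -
        (\<Sum>b<M. g (t / real M + (c + real b / real M)) / real M)\<bar>
      = \<bar>\<Sum>b<M. (g (c + real b / real M) - g (t / real M + (c + real b / real M))) / real M\<bar>"
      by (simp add: sum_divide_distrib sum_subtractf diff_divide_distrib)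
    also have "\<dots> \<le> (\<Sum>b<M. \<epsilon> / real M)"
    proof (rule order_trans[OF sum_abs sum_mono])
      fix b
      have "\<bar>g (c + real b / real M) - g (t / real M + (c + real b / real M))\<bar> \<le> \<epsilon>"
        using t \<open>M \<ge> 1\<close> by (intro close) (auto simp: divide_right_mono)
      then show "\<bar>(g (c + real b / real M) - g (t / real M + (c + real b / real M))) / real M\<bar>
          \<le> \<epsilon> / real M"
        using \<open>M \<ge> 1\<close> by (simp add: abs_divide divide_right_mono)
    qed
    also have "\<dots> = \<epsilon>" using \<open>M \<ge> 1\<close> by simp
    finally show "\<bar>(\<Sum>b<M. g (c + real b / real M)) / real M -
        (\<Sum>b<M. g (t / real M + (c + real b / real M)) / real M)\<bar> \<le> \<epsilon>" .
  qed auto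
  ultimately show ?thesis by simp
qed

text \<open>The integrand is at most 1 and tends to 0 with \<open>\<eta>\<close> except at the
  finitely many zeros of the sine, so dominated convergence applies along \<eta> = 1 / (n + 1). It
  measures what the weight in the next lemma loses.\<close>

lemma integral_reciprocal_small:
  assumes "\<epsilon> > 0"
  obtains \<eta> :: real where "\<eta> > 0"
    "integral {0..1} (\<lambda>t. \<eta> / ((sin (2 * pi * t))\<^sup>2 + \<eta>)) \<le> \<epsilon>"
proof -
  define f where "f n t = inverse (real (Suc n)) / ((sin (2 * pi * t))\<^sup>2 + inverse (real (Suc n)))"
    for n t
  \<comment> \<open>At the zeros of the sine the integrand is constantly 1, so the pointwise limit
    is 1 there.\<close>
  define l where "l t = (if sin (2 * pi * t) = 0 then 1 else 0 :: real)" for t :: real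
  have pos: "(sin (2 * pi * t))\<^sup>2 + inverse (real (Suc n)) > 0" for t n
    by (simp add: add_nonneg_pos)
  have fin: "finite {t \<in> {0..1}. sin (2 * pi * t) = 0}"
  proof (rule finite_subset)
    show "{t \<in> {0..1}. sin (2 * pi * t) = 0} \<subseteq> (\<lambda>k. of_int k / 2) ` {0..2}"
    proof
      fix t :: real assume t: "t \<in> {t \<in> {0..1}. sin (2 * pi * t) = 0}"
      then obtain k :: int where "2 * pi * t = of_int k * pi" by (auto simp: sin_zero_iff_int2)
      then have k: "t = of_int k / 2" by simp
      with t have "k \<in> {0..2}" by auto
      with k show "t \<in> (\<lambda>k. of_int k / 2) ` {0..2}" by blast
    qed
  qed simp
  have "(\<lambda>n. integral {0..1} (f n)) \<longlonglongrightarrow> integral {0..1} l"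
  proof (rule dominated_convergence(2)[where h = "\<lambda>_. 1"])
    show "f n integrable_on {0..1}" for n
      unfolding f_def using pos
      by (intro integrable_continuous_real continuous_intros) (auto simp: less_imp_neq[symmetric])
    show "norm (f n t) \<le> 1" for n t
      using pos[of t n] by (simp add: f_def field_simps)
    show "(\<lambda>n. f n t) \<longlonglongrightarrow> l t" for t
    proof (cases "sin (2 * pi * t) = 0")
      case False
      have "(\<lambda>n. inverse (real (Suc n)) / ((sin (2 * pi * t))\<^sup>2 + inverse (real (Suc n))))
          \<longlonglongrightarrow> 0 / ((sin (2 * pi * t))\<^sup>2 + 0)"
        using False by (intro tendsto_intros LIMSEQ_inverse_real_of_nat) auto
      with False show ?thesis by (simp add: f_def l_def)
    qed (simp add: f_def l_def)
  qed auto
  moreover have "(l has_integral 0) {0..1}"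
    by (rule has_integral_spike_finite[OF fin _ has_integral_0]) (auto simp: l_def)
  ultimately have "(\<lambda>n. integral {0..1} (f n)) \<longlonglongrightarrow> 0" by (simp add: integral_unique)
  then have "\<forall>\<^sub>F n in sequentially. integral {0..1} (f n) < \<epsilon>"
    using assms by (rule order_tendstoD)
  then obtain n where "integral {0..1} (f n) < \<epsilon>"
    by (auto simp: eventually_sequentially)
  then show thesis
    by (intro that[of "inverse (real (Suc n))"]) (auto simp: f_def[abs_def] simp del: of_nat_Suc)
qed

text \<open>Integration by parts with the weight \<open>sin\<^sup>2 / (sin\<^sup>2 + \<eta>)\<close>, which removes the critical points of
  the cosine and is close to \<open>1\<close> in the mean.\<close>

lemma integral_cos_mean_zero_le:
  fixes g :: "real \<Rightarrow> real"
  assumes cont: "continuous_on UNIV g" and per: "\<And>x. g (x + 1) = g x"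
    and bound: "\<And>x. \<bar>g x\<bar> \<le> B" and mean: "integral {0..1} g = 0"
    and "\<eta> > 0" "R > 0"
  shows "\<bar>integral {0..1} (\<lambda>t. g (R * cos (2 * pi * t)))\<bar>
     \<le> B * ((\<eta> + 1) / \<eta>\<^sup>2) / R + B * integral {0..1} (\<lambda>t. \<eta> / ((sin (2 * pi * t))\<^sup>2 + \<eta>))"
proof -
  obtain \<Gamma>0 where \<Gamma>0: "\<And>x. (\<Gamma>0 has_real_derivative g x) (at x)"
    using continuous_has_antiderivative[OF cont] by blast
  \<comment> \<open>With \<open>\<Gamma> 0 = 0\<close> and mean zero, \<open>\<Gamma>\<close> is
    periodic, so the bound on one period, \<open>B\<close> times its length, holds
    everywhere.\<close>
  define \<Gamma> where "\<Gamma> x = \<Gamma>0 x - \<Gamma>0 0" for x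
  have \<Gamma>: "(\<Gamma> has_real_derivative g x) (at x)" for x
    using \<Gamma>0[of x] unfolding \<Gamma>_def by (auto intro!: derivative_eq_intros)
  have "\<Gamma> 1 - \<Gamma> 0 = 0"
    using integral_antiderivative[OF \<Gamma>, of 0 1] mean by (simp add: integral_unique)
  then have \<Gamma>_per: "\<Gamma> (x + 1) = \<Gamma> x" for x
    using antiderivative_periodic[OF \<Gamma> per, of x] by simp
  have \<Gamma>_bound: "\<bar>\<Gamma> x\<bar> \<le> B" for x
  proof -
    have "\<bar>\<Gamma> (frac x) - \<Gamma> 0\<bar> \<le> B * \<bar>frac x - 0\<bar>"
      using field_differentiable_bound[where S = UNIV and f = \<Gamma> and f' = g and B = B and x = 0 and y = "frac x"] \<Gamma> bound
      by (simp add: has_field_derivative_at_within)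
    also have "\<dots> \<le> B * 1"
      using bound[of 0] by (intro mult_left_mono) (auto simp: frac_lt_1 less_imp_le)
    finally show ?thesis using periodic_frac[of \<Gamma> x] \<Gamma>_per by (simp add: \<Gamma>_def)
  qed
  have "continuous_on UNIV \<Gamma>"
    using \<Gamma> by (auto intro!: DERIV_isCont continuous_at_imp_continuous_on)
  note [continuous_intros] = continuous_on_compose2[OF cont] continuous_on_compose2[OF this]
  define s where "s t = sin (2 * pi * t)" for t :: real
  define d where "d t = (s t)\<^sup>2 + \<eta>" for t
  have d: "d t \<ge> \<eta>" "d t > 0" "d t \<noteq> 0" for t
    using \<open>\<eta> > 0\<close> by (auto simp: d_def add_nonneg_pos less_imp_neq[symmetric])
  have [continuous_intros]: "continuous_on A s" "continuous_on A d" for A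
    unfolding d_def s_def by (intro continuous_intros)+
  let ?g = "\<lambda>t. g (R * cos (2 * pi * t))"
  let ?p = "\<lambda>t. \<Gamma> (R * cos (2 * pi * t)) * (cos (2 * pi * t) * (\<eta> - (s t)\<^sup>2) / (d t)\<^sup>2) / R"
  \<comment> \<open>The chain rule brings down \<open>- (2 * pi * R) * s t\<close>; the quotient by
    \<open>2 * pi * R\<close> and the factor \<open>s t\<close> turn it into the weight
    \<open>(s t)\<^sup>2 / d t\<close>. The product vanishes at 0 and 1 together with the sine, so
    there are no boundary terms.\<close>
  have "((\<lambda>t. \<Gamma> (R * cos (2 * pi * t)) * (s t / d t) / (2 * pi * R)) has_real_derivative
      ?p t - ?g t * ((s t)\<^sup>2 / d t)) (at t)" for t
  proof -
    have g': "((\<lambda>t. \<Gamma> (R * cos (2 * pi * t))) has_real_derivative ?g t * (- (2 * pi * R) * s t)) (at t)"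
      by (rule DERIV_chain2[OF \<Gamma>]) (auto intro!: derivative_eq_intros simp: s_def)
    have s': "(s has_real_derivative 2 * pi * cos (2 * pi * t)) (at t)"
      unfolding s_def by (auto intro!: derivative_eq_intros)
    have d': "(d has_real_derivative 2 * s t * (2 * pi * cos (2 * pi * t))) (at t)"
      unfolding d_def by (auto intro!: derivative_eq_intros s')
    have q: "(2 * pi * cos (2 * pi * t) * d t - s t * (2 * s t * (2 * pi * cos (2 * pi * t)))) / (d t * d t)
        = 2 * pi * (cos (2 * pi * t) * (\<eta> - (s t)\<^sup>2) / (d t)\<^sup>2)"
      by (simp add: power2_eq_square d_def[of t] algebra_simps)
    note DERIV_cdivide[OF DERIV_mult[OF g' DERIV_divide[OF s' d' d(3)], unfolded q], of "2 * pi * R"]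
    moreover have "(?g t * (- (2 * pi * R) * s t) * (s t / d t)
        + 2 * pi * (cos (2 * pi * t) * (\<eta> - (s t)\<^sup>2) / (d t)\<^sup>2) * \<Gamma> (R * cos (2 * pi * t))) / (2 * pi * R)
        = ?p t - ?g t * ((s t)\<^sup>2 / d t)"
      using \<open>R > 0\<close> d(3)[of t] by (simp add: divide_simps power2_eq_square) (simp add: algebra_simps)
    ultimately show ?thesis by simp
  qed
  from integral_antiderivative[OF this, of 0 1]
  have zero: "integral {0..1} (\<lambda>t. ?p t - ?g t * ((s t)\<^sup>2 / d t)) = 0"
    by (simp add: integral_unique s_def)
  \<comment> \<open>The weights \<open>(s t)\<^sup>2 / d t\<close> and \<open>\<eta> / d t\<close>
    add up to 1. The first leaves only a term of order \<open>1 / R\<close>, the second is small in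
    the mean.\<close>
  have "integral {0..1} ?g
      = integral {0..1} (\<lambda>t. ?p t - (?p t - ?g t * ((s t)\<^sup>2 / d t)) + ?g t * (\<eta> / d t))"
  proof (rule integral_cong)
    fix t
    have "(s t)\<^sup>2 / d t + \<eta> / d t = 1" using d(3)[of t] by (simp add: d_def flip: add_divide_distrib)
    then have "?g t * ((s t)\<^sup>2 / d t) + ?g t * (\<eta> / d t) = ?g t"
      by (simp only: mult_1_right flip: distrib_left)
    then show "?g t = ?p t - (?p t - ?g t * ((s t)\<^sup>2 / d t)) + ?g t * (\<eta> / d t)"
      by (simp only: diff_diff_eq2 add_diff_cancel_left')
  qed
  also have "\<dots> = integral {0..1} ?p + integral {0..1} (\<lambda>t. ?g t * (\<eta> / d t))"
  proof -
    have 1: "?p integrable_on {0..1}" 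
      using d(3) \<open>R > 0\<close> by (intro integrable_continuous_real continuous_intros) auto
    have 2: "(\<lambda>t. ?p t - ?g t * ((s t)\<^sup>2 / d t)) integrable_on {0..1}"
      using d(3) \<open>R > 0\<close> by (intro integrable_continuous_real continuous_intros) auto
    have 3: "(\<lambda>t. ?g t * (\<eta> / d t)) integrable_on {0..1}"
      using d(3) by (intro integrable_continuous_real continuous_intros) auto
    show ?thesis
      unfolding integral_add[OF integrable_diff[OF 1 2] 3] integral_diff[OF 1 2] zero by simp
  qed
  finally have eq: "integral {0..1} ?g = integral {0..1} ?p + integral {0..1} (\<lambda>t. ?g t * (\<eta> / d t))" .
  have "\<bar>integral {0..1} ?p\<bar> \<le> B * ((\<eta> + 1) / \<eta>\<^sup>2) / R"
  proof (rule integral_le_bound)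
    show "continuous_on {0..1} ?p" using d(3) \<open>R > 0\<close> by (intro continuous_intros) auto
    fix t :: real
    have "\<bar>cos (2 * pi * t)\<bar> * \<bar>\<eta> - (s t)\<^sup>2\<bar> \<le> 1 * (\<eta> + 1)"
    proof (rule mult_mono)
      have "(s t)\<^sup>2 \<le> 1" by (simp add: s_def abs_square_le_1)
      then show "\<bar>\<eta> - (s t)\<^sup>2\<bar> \<le> \<eta> + 1" using \<open>\<eta> > 0\<close> zero_le_power2[of "s t"] by linarith
    qed auto
    moreover have "\<eta>\<^sup>2 \<le> (d t)\<^sup>2" using d(1)[of t] \<open>\<eta> > 0\<close> by (intro power_mono) auto
    ultimately have "\<bar>cos (2 * pi * t) * (\<eta> - (s t)\<^sup>2) / (d t)\<^sup>2\<bar> \<le> (\<eta> + 1) / \<eta>\<^sup>2"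
      using \<open>\<eta> > 0\<close> unfolding abs_divide abs_mult by (intro frac_le) auto
    then have "\<bar>\<Gamma> (R * cos (2 * pi * t)) * (cos (2 * pi * t) * (\<eta> - (s t)\<^sup>2) / (d t)\<^sup>2)\<bar>
        \<le> B * ((\<eta> + 1) / \<eta>\<^sup>2)"
      using \<Gamma>_bound[of 0] unfolding abs_mult[of "\<Gamma> _"] by (intro mult_mono \<Gamma>_bound) auto
    from divide_right_mono[OF this, of R]
    show "\<bar>?p t\<bar> \<le> B * ((\<eta> + 1) / \<eta>\<^sup>2) / R"
      using \<open>R > 0\<close> by (simp only: abs_divide abs_of_pos less_imp_le)
  qed
  moreover have "\<bar>integral {0..1} (\<lambda>t. ?g t * (\<eta> / d t))\<bar> \<le> integral {0..1} (\<lambda>t. B * (\<eta> / d t))"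
  proof -
    have "norm (integral {0..1} (\<lambda>t. ?g t * (\<eta> / d t))) \<le> integral {0..1} (\<lambda>t. B * (\<eta> / d t))"
    proof (rule integral_norm_bound_integral)
      show "(\<lambda>t. ?g t * (\<eta> / d t)) integrable_on {0..1}"
        using d(3) by (intro integrable_continuous_real continuous_intros) auto
      show "(\<lambda>t. B * (\<eta> / d t)) integrable_on {0..1}"
        using d(3) by (intro integrable_continuous_real continuous_intros) auto
      show "norm (?g t * (\<eta> / d t)) \<le> B * (\<eta> / d t)" for t
        using bound d(2)[of t] \<open>\<eta> > 0\<close> by (simp add: abs_mult divide_right_mono mult_right_mono)
    qed
    then show ?thesis by simp
  qed
  moreover have "integral {0..1} (\<lambda>t. B * (\<eta> / d t)) = B * integral {0..1} (\<lambda>t. \<eta> / d t)"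
    by (rule integral_mult_right)
  ultimately have "\<bar>integral {0..1} ?g\<bar> \<le> B * ((\<eta> + 1) / \<eta>\<^sup>2) / R + B * integral {0..1} (\<lambda>t. \<eta> / d t)"
    unfolding eq by (intro order_trans[OF abs_triangle_ineq add_mono]) simp_all
  then show ?thesis unfolding d_def s_def .
qed

text \<open>\<open>R\<^sub>0\<close> depends on \<open>\<epsilon>\<close> and the bound
  \<open>B\<close> but not on \<open>g\<close> or the phase \<open>c\<close>: it has to serve all
  functions \<open>\<lambda>s. L (circ u s x)\<close>, with \<open>x\<close> on the sphere, at
  once.\<close>

lemma integral_cos_equidistributed:
  assumes "\<epsilon> > 0" "B \<ge> 0"
  obtains R\<^sub>0 where "R\<^sub>0 > 0" "\<And>(g :: real \<Rightarrow> real) R c. \<lbrakk>continuous_on UNIV g; \<And>x. g (x + 1) = g x;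
    \<And>x. \<bar>g x\<bar> \<le> B; R \<ge> R\<^sub>0\<rbrakk> \<Longrightarrow>
    \<bar>integral {0..1} (\<lambda>t. g (R * cos (2 * pi * (t + c)))) - integral {0..1} g\<bar> \<le> \<epsilon>"
proof -
  \<comment> \<open>Subtracting the mean doubles the bound to \<open>2 * B\<close>; the additional 1
    keeps the quotient meaningful for \<open>B = 0\<close>.\<close>
  obtain \<eta> where \<eta>: "\<eta> > 0"
    "integral {0..1} (\<lambda>t. \<eta> / ((sin (2 * pi * t))\<^sup>2 + \<eta>)) \<le> \<epsilon> / 2 / (2 * B + 1)"
    using integral_reciprocal_small[of "\<epsilon> / 2 / (2 * B + 1)"] assms by auto
  define C where "C = 2 * B * ((\<eta> + 1) / \<eta>\<^sup>2)"
  have C: "C \<ge> 0" using assms \<eta> by (simp add: C_def)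
  show thesis
  \<comment> \<open>The first summand makes \<open>C / R\<close> at most
    \<open>\<epsilon> / 2\<close>, the second keeps the threshold positive.\<close>
  proof (rule that[of "2 * C / \<epsilon> + 1"])
    show "2 * C / \<epsilon> + 1 > 0" using C assms by (simp add: add_nonneg_pos)
    fix g :: "real \<Rightarrow> real" and R c :: real
    assume g: "continuous_on UNIV g" "\<And>x. g (x + 1) = g x" "\<And>x. \<bar>g x\<bar> \<le> B"
      and R: "R \<ge> 2 * C / \<epsilon> + 1"
    have "R > 0" using R C assms by (smt (verit) divide_nonneg_nonneg)
    define m where "m = integral {0..1} g"
    have m: "\<bar>m\<bar> \<le> B"
      unfolding m_def by (intro integral_le_bound) (auto intro: continuous_on_subset[OF g(1)] g(3))
    have ig: "g integrable_on {0..1}"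
      by (intro integrable_continuous_real continuous_on_subset[OF g(1)]) auto
    have cont: "continuous_on UNIV (\<lambda>t. g (R * cos (2 * pi * t)))"
      by (intro continuous_on_compose2[OF g(1)] continuous_intros) auto
    then have icos: "(\<lambda>t. g (R * cos (2 * pi * t))) integrable_on {0..1}"
      by (intro integrable_continuous_real) (auto intro: continuous_on_subset)
    have "\<bar>integral {0..1} (\<lambda>t. g (R * cos (2 * pi * t)) - m)\<bar>
       \<le> 2 * B * ((\<eta> + 1) / \<eta>\<^sup>2) / R + 2 * B * integral {0..1} (\<lambda>t. \<eta> / ((sin (2 * pi * t))\<^sup>2 + \<eta>))"
    proof (rule integral_cos_mean_zero_le)
      show "\<bar>g x - m\<bar> \<le> 2 * B" for x using g(3)[of x] m by linarith
      show "integral {0..1} (\<lambda>x. g x - m) = 0" using integral_diff[OF ig integrable_const_ivl[of m 0 1]] by (simp add: m_def)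
    qed (use g \<open>R > 0\<close> \<eta> in \<open>auto intro: continuous_intros\<close>)
    also have "2 * B * ((\<eta> + 1) / \<eta>\<^sup>2) / R \<le> \<epsilon> / 2"
    proof -
      have "2 * C \<le> R * \<epsilon>"
        using R assms by (simp add: field_simps)
      then show ?thesis using \<open>R > 0\<close> unfolding C_def[symmetric] by (simp add: field_simps)
    qed
    also have "2 * B * integral {0..1} (\<lambda>t. \<eta> / ((sin (2 * pi * t))\<^sup>2 + \<eta>))
        \<le> (2 * B + 1) * (\<epsilon> / 2 / (2 * B + 1))"
      using \<eta> assms
      by (intro mult_mono \<eta>(2) integral_nonneg integrable_continuous_real continuous_intros)
        (auto simp: add_nonneg_pos less_imp_neq[symmetric])
    also have "\<dots> = \<epsilon> / 2" using assms by (auto simp: field_simps add_nonneg_eq_0_iff)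
    finally have "\<bar>integral {0..1} (\<lambda>t. g (R * cos (2 * pi * t))) - m\<bar> \<le> \<epsilon>"
      using integral_diff[OF icos integrable_const_ivl[of m 0 1]] by simp
    moreover have "integral {0..1} (\<lambda>t. g (R * cos (2 * pi * (t + c))))
        = integral {0..1} (\<lambda>t. g (R * cos (2 * pi * t)))"
      by (rule integral_periodic_shift[OF cont]) (simp add: ring_distribs)
    ultimately show "\<bar>integral {0..1} (\<lambda>t. g (R * cos (2 * pi * (t + c)))) - integral {0..1} g\<bar> \<le> \<epsilon>"
      by (simp add: m_def)
  qed
qed

subsection \<open>Holomorphic maps of several variables\<close>

lemma holomorphic_cn_const: "holomorphic_cn_on (\<lambda>_. a) U"
  unfolding holomorphic_cn_on_def by (intro ballI exI[of _ "\<lambda>_. 0"]) auto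

lemma holomorphic_cn_nth: "holomorphic_cn_on (\<lambda>z. z $ i) U"
  unfolding holomorphic_cn_on_def
  by (intro ballI exI[of _ "\<lambda>z. z $ i"])
    (auto intro!: bounded_linear_imp_has_derivative bounded_linear_vec_nth)

lemma holomorphic_cn_add:
  assumes "holomorphic_cn_on f U" "holomorphic_cn_on g U"
  shows "holomorphic_cn_on (\<lambda>z. f z + g z) U"
  unfolding holomorphic_cn_on_def
proof
  fix z assume "z \<in> U"
  with assms obtain D E where "(f has_derivative D) (at z)" "\<forall>c v. D (c *s v) = c * D v"
      "(g has_derivative E) (at z)" "\<forall>c v. E (c *s v) = c * E v"
    unfolding holomorphic_cn_on_def by blast
  then show "\<exists>D. ((\<lambda>z. f z + g z) has_derivative D) (at z) \<and> (\<forall>c v. D (c *s v) = c * D v)"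
    by (intro exI[of _ "\<lambda>v. D v + E v"]) (auto intro!: has_derivative_add simp: algebra_simps)
qed

lemma holomorphic_cn_mult:
  assumes "holomorphic_cn_on f U" "holomorphic_cn_on g U"
  shows "holomorphic_cn_on (\<lambda>z. f z * g z) U"
  unfolding holomorphic_cn_on_def
proof
  fix z assume "z \<in> U"
  with assms obtain D E where "(f has_derivative D) (at z)" "\<forall>c v. D (c *s v) = c * D v"
      "(g has_derivative E) (at z)" "\<forall>c v. E (c *s v) = c * E v"
    unfolding holomorphic_cn_on_def by blast
  then show "\<exists>D. ((\<lambda>z. f z * g z) has_derivative D) (at z) \<and> (\<forall>c v. D (c *s v) = c * D v)"
    by (intro exI[of _ "\<lambda>v. f z * E v + D v * g z"] conjI has_derivative_mult)
      (auto simp: algebra_simps)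
qed

lemma holomorphic_cn_diff:
  assumes "holomorphic_cn_on f U" "holomorphic_cn_on g U"
  shows "holomorphic_cn_on (\<lambda>z. f z - g z) U"
  using holomorphic_cn_add[OF assms(1) holomorphic_cn_mult[OF holomorphic_cn_const[of "-1"] assms(2)]]
  by simp

lemma holomorphic_cn_power:
  assumes "holomorphic_cn_on f U"
  shows "holomorphic_cn_on (\<lambda>z. f z ^ n) U"
  by (induction n) (auto intro: holomorphic_cn_const holomorphic_cn_mult assms)

lemma holomorphic_cn_sum:
  assumes "\<And>i. i \<in> I \<Longrightarrow> holomorphic_cn_on (f i) U"
  shows "holomorphic_cn_on (\<lambda>z. \<Sum>i\<in>I. f i z) U"
  using assms
  by (induction I rule: infinite_finite_induct) (auto intro: holomorphic_cn_const holomorphic_cn_add)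

lemma holomorphic_cn_compose_field:
  assumes "holomorphic_cn_on f U" "\<And>w. (g has_field_derivative g' w) (at w)"
  shows "holomorphic_cn_on (\<lambda>z. g (f z)) U"
  unfolding holomorphic_cn_on_def
proof
  fix z assume "z \<in> U"
  with assms(1) obtain D where D: "(f has_derivative D) (at z)" "\<forall>c v. D (c *s v) = c * D v"
    unfolding holomorphic_cn_on_def by blast
  have "(g has_derivative (*) (g' (f z))) (at (f z))"
    using assms(2) by (simp add: has_field_derivative_def)
  from diff_chain_at[OF D(1) this] D(2)
  show "\<exists>D. ((\<lambda>z. g (f z)) has_derivative D) (at z) \<and> (\<forall>c v. D (c *s v) = c * D v)"
    by (intro exI[of _ "(*) (g' (f z)) \<circ> D"]) (auto simp: o_def algebra_simps)
qed

definition entire_vec :: "(complex^'m::finite \<Rightarrow> complex^'k::finite) \<Rightarrow> bool" where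
  "entire_vec F \<longleftrightarrow> (\<forall>i. holomorphic_cn_on (\<lambda>z. F z $ i) UNIV)"

lemma has_derivative_vec_components:
  fixes F :: "'a::real_normed_vector \<Rightarrow> complex^'k::finite"
  assumes "\<And>i. ((\<lambda>z. F z $ i) has_derivative D i) (at z)"
  shows "(F has_derivative (\<lambda>v. \<chi> i. D i v)) (at z)"
  unfolding has_derivative_componentwise_within[of F]
proof
  fix b :: "complex^'k" assume "b \<in> Basis"
  then obtain i u where "b = axis i u" by (auto simp: Basis_vec_def)
  with has_derivative_inner_left[OF assms[of i]]
  show "((\<lambda>x. F x \<bullet> b) has_derivative (\<lambda>x. (\<chi> i. D i x) \<bullet> b)) (at z)"
    by (simp add: inner_axis)
qed

lemma entire_vec_has_derivative:
  assumes "entire_vec F"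
  obtains D where "(F has_derivative D) (at z)" "\<And>c v. D (c *s v) = c *s D v"
proof -
  from assms have "\<forall>i. \<exists>D. ((\<lambda>z. F z $ i) has_derivative D) (at z) \<and> (\<forall>c v. D (c *s v) = c * D v)"
    by (auto simp: entire_vec_def holomorphic_cn_on_def)
  then obtain D where "\<And>i. ((\<lambda>z. F z $ i) has_derivative D i) (at z)"
      "\<And>i c v. D i (c *s v) = c * D i v"
    by metis
  then show thesis
    by (intro that[of "\<lambda>v. \<chi> i. D i v"] has_derivative_vec_components) (auto simp: vec_eq_iff)
qed

lemma entire_vec_continuous: "entire_vec F \<Longrightarrow> continuous_on A F"
  by (meson entire_vec_has_derivative has_derivative_continuous continuous_at_imp_continuous_on)

lemma holomorphic_cn_compose:
  assumes "holomorphic_cn_on f UNIV" "entire_vec F"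
  shows "holomorphic_cn_on (\<lambda>z. f (F z)) UNIV"
  unfolding holomorphic_cn_on_def
proof
  fix z
  obtain D where D: "(F has_derivative D) (at z)" "\<And>c v. D (c *s v) = c *s D v"
    using entire_vec_has_derivative[OF assms(2)] by blast
  obtain E where E: "(f has_derivative E) (at (F z))" "\<forall>c v. E (c *s v) = c * E v"
    using assms(1) unfolding holomorphic_cn_on_def by blast
  from diff_chain_at[OF D(1) E(1)] D(2) E(2)
  show "\<exists>D. ((\<lambda>z. f (F z)) has_derivative D) (at z) \<and> (\<forall>c v. D (c *s v) = c * D v)"
    by (intro exI[of _ "E \<circ> D"]) (auto simp: o_def)
qed

lemma entire_vec_compose: "entire_vec F \<Longrightarrow> entire_vec G \<Longrightarrow> entire_vec (F \<circ> G)"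
  by (auto simp: entire_vec_def intro!: holomorphic_cn_compose[where F = G])

lemma norm_vector_smult: "norm (c *s z) = cmod c * norm (z :: complex^'m::finite)"
  by (simp add: norm_vec_def norm_mult L2_set_right_distrib)

lemma has_derivative_smult_line:
  fixes z h :: "complex^'m::finite"
  shows "((\<lambda>c. z + c *s h) has_derivative (\<lambda>c. c *s h)) (at (w::complex))"
proof -
  have "bounded_linear (\<lambda>c. c *s h)"
    by (rule bounded_linear_intro[where K = "norm h"])
      (auto simp: vec_eq_iff algebra_simps norm_vector_smult)
  then have "((\<lambda>c. c *s h) has_derivative (\<lambda>c. c *s h)) (at w)"
    by (rule bounded_linear_imp_has_derivative)
  then show ?thesis
    by (auto intro!: derivative_eq_intros)
qed

text \<open>Cauchy's inequality along complex lines turns uniform convergence into uniform convergence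
  of the derivatives.\<close>

lemma holomorphic_cn_derivative_bound:
  assumes hol: "\<And>z. (f has_derivative D z) (at z)" "\<And>z c v. D z (c *s v) = c * D z v"
    and bound: "\<And>w. w \<in> cball z 1 \<Longrightarrow> cmod (f w) \<le> B"
  shows "cmod (D z v) \<le> B * norm v"
proof (cases "v = 0")
  case True
  then show ?thesis using hol(2)[of z 0 0] by simp
next
  case False
  \<comment> \<open>Along the unit vector \<open>h\<close> the disc of radius 1 stays in the ball
    where the bound holds; the factor \<open>norm v\<close> returns at the end by linearity.\<close>
  define h where "h = of_real (inverse (norm v)) *s v"
  have h: "norm h = 1" using False by (simp add: h_def norm_vector_smult norm_inverse)
  have der: "((\<lambda>c. f (z + c *s h)) has_field_derivative D (z + c *s h) h) (at c)" for c
  proof -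
    have "((\<lambda>c. f (z + c *s h)) has_derivative D (z + c *s h) \<circ> (\<lambda>c. c *s h)) (at c)"
      using diff_chain_at[OF has_derivative_smult_line hol(1)] by (simp add: o_def)
    then show ?thesis
      by (simp add: has_field_derivative_def o_def hol(2) mult.commute[of _ "D _ h"])
  qed
  have "norm ((deriv ^^ 1) (\<lambda>c. f (z + c *s h)) 0) \<le> fact 1 * B / 1 ^ 1"
  proof (rule Cauchy_inequality)
    show "(\<lambda>c. f (z + c *s h)) holomorphic_on ball 0 1"
      using der by (auto simp: holomorphic_on_def field_differentiable_def
          intro: has_field_derivative_at_within)
    show "continuous_on (cball 0 1) (\<lambda>c. f (z + c *s h))"
      using der by (auto intro!: continuous_at_imp_continuous_on DERIV_isCont)
    show "norm (f (z + c *s h)) \<le> B" if "norm (0 - c) = 1" for c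
      using that h by (intro bound) (auto simp: dist_norm norm_vector_smult)
  qed auto
  then have "cmod (D z h) \<le> B" using DERIV_imp_deriv[OF der[of 0]] by simp
  moreover have "D z v = of_real (norm v) * D z h"
    using False by (simp add: h_def hol(2))
  ultimately show ?thesis by (simp add: norm_mult mult.commute[of "norm v"] mult_right_mono)
qed

text \<open>The discs in Cauchy's inequality have radius 1, so control of \<open>F n\<close> on the
  ball of radius \<open>R + 1\<close> makes the derivatives uniformly Cauchy on that of radius
  \<open>R\<close>. Complex linearity of the limit derivative is inherited pointwise.\<close>

lemma holomorphic_cn_uniform_limit:
  fixes F :: "nat \<Rightarrow> complex^'m::finite \<Rightarrow> complex"
  assumes hol: "\<And>n. holomorphic_cn_on (F n) UNIV"
    and lim: "\<And>e. e > 0 \<Longrightarrow> \<exists>N. \<forall>n\<ge>N. \<forall>z\<in>cball 0 (R + 1). cmod (F n z - f z) \<le> e"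
  shows "holomorphic_cn_on f (ball 0 R)"
proof -
  from hol have "\<forall>n z. \<exists>D. (F n has_derivative D) (at z) \<and> (\<forall>c v. D (c *s v) = c * D v)"
    by (auto simp: holomorphic_cn_on_def)
  then obtain D where D: "\<And>n z. (F n has_derivative D n z) (at z)"
      "\<And>n z c v. D n z (c *s v) = c * D n z v"
    by metis
  have lim': "\<exists>N. \<forall>n\<ge>N. \<forall>m\<ge>N. \<forall>z\<in>ball 0 R. \<forall>v. cmod (D n z v - D m z v) \<le> e * norm v"
    if "e > 0" for e
  proof -
    obtain N where N: "\<And>n z. n \<ge> N \<Longrightarrow> z \<in> cball 0 (R + 1) \<Longrightarrow> cmod (F n z - f z) \<le> e / 2"
      using lim[of "e / 2"] \<open>e > 0\<close> half_gt_zero by blast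
    show ?thesis
    proof (intro exI[of _ N] allI impI ballI)
      fix n m and z v :: "complex^'m" assume nm: "N \<le> n" "N \<le> m" and z: "z \<in> ball 0 R"
      show "cmod (D n z v - D m z v) \<le> e * norm v"
      proof (rule holomorphic_cn_derivative_bound[where f = "\<lambda>z. F n z - F m z"])
        show "((\<lambda>z. F n z - F m z) has_derivative (\<lambda>v. D n z v - D m z v)) (at z)" for z
          by (intro has_derivative_diff D)
        fix w assume "w \<in> cball z 1"
        then have w: "w \<in> cball 0 (R + 1)"
          using z norm_triangle_ineq2[of w z] by (auto simp: dist_norm norm_minus_commute)
        show "cmod (F n w - F m w) \<le> e"
          using norm_triangle_ineq4[of "F n w - f w" "F m w - f w"] N[OF nm(1) w] N[OF nm(2) w] by simp
      qed (simp add: D(2) algebra_simps)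
    qed
  qed
  have conv: "convergent (\<lambda>n. D n z v)" if z: "z \<in> ball 0 R" for z v :: "complex^'m"
  proof -
    have "Cauchy (\<lambda>n. D n z v)"
    proof (rule metric_CauchyI)
      fix e :: real assume "e > 0"
      then have "e / (2 * (norm v + 1)) > 0" by (simp add: add_nonneg_pos)
      then obtain N where N: "\<And>n m. n \<ge> N \<Longrightarrow> m \<ge> N \<Longrightarrow>
          cmod (D n z v - D m z v) \<le> e / (2 * (norm v + 1)) * norm v"
        using lim'[of "e / (2 * (norm v + 1))"] z by blast
      have "e * norm v < e * (2 * (norm v + 1))"
        using \<open>e > 0\<close> by (simp add: algebra_simps add_nonneg_pos)
      moreover have "2 * (norm v + 1) > 0" by (simp add: add_nonneg_pos)
      ultimately have "e / (2 * (norm v + 1)) * norm v < e"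
        by (simp only: times_divide_eq_left pos_divide_less_eq)
      with N show "\<exists>M. \<forall>m\<ge>M. \<forall>n\<ge>M. dist (D m z v) (D n z v) < e"
        unfolding dist_norm by (meson le_less_trans)
    qed
    then show ?thesis by (simp add: Cauchy_convergent_iff)
  qed
  define D' where "D' z v = lim (\<lambda>n. D n z v)" for z v :: "complex^'m"
  have D': "(\<lambda>n. D n z v) \<longlonglongrightarrow> D' z v" if "z \<in> ball 0 R" for z v :: "complex^'m"
    using conv[OF that] by (simp add: D'_def convergent_LIMSEQ_iff)
  have f_lim: "(\<lambda>n. F n z) \<longlonglongrightarrow> f z" if "z \<in> ball 0 R" for z
  proof (rule LIMSEQ_I)
    fix e :: real assume "e > 0"
    then obtain N where N: "\<And>n w. n \<ge> N \<Longrightarrow> w \<in> cball 0 (R + 1) \<Longrightarrow> cmod (F n w - f w) \<le> e / 2"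
      using lim[of "e / 2"] half_gt_zero by blast
    have "z \<in> cball 0 (R + 1)" using that by simp
    with N \<open>e > 0\<close> show "\<exists>N. \<forall>n\<ge>N. cmod (F n z - f z) < e"
      by (intro exI[of _ N]) (auto intro: le_less_trans[of _ "e / 2"])
  qed
  show ?thesis
  proof (cases "R > 0")
    case False
    then have "ball (0 :: complex^'m) R = {}" by simp
    then show ?thesis unfolding holomorphic_cn_on_def by blast
  next
    case True
    have "\<exists>g. \<forall>x\<in>ball 0 R. (\<lambda>n. F n x) \<longlonglongrightarrow> g x \<and> (g has_derivative D' x) (at x within ball 0 R)"
    proof (rule has_derivative_sequence)
      show "(F n has_derivative D n x) (at x within ball 0 R)" for n x
        using D(1) by (rule has_derivative_at_withinI)
      show "0 \<in> ball (0 :: complex^'m) R" using True by simp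
      then show "(\<lambda>n. F n 0) \<longlonglongrightarrow> f 0" by (rule f_lim)
      fix e :: real assume "e > 0"
      then obtain N where N: "\<And>n m z v. n \<ge> N \<Longrightarrow> m \<ge> N \<Longrightarrow> z \<in> ball 0 R \<Longrightarrow>
          cmod (D n z v - D m z v) \<le> e * norm v"
        using lim'[of e] by blast
      have "cmod (D n z v - D' z v) \<le> e * norm v" if "n \<ge> N" "z \<in> ball 0 R" for n z v
      proof (rule Lim_bounded)
        show "(\<lambda>m. cmod (D n z v - D m z v)) \<longlonglongrightarrow> cmod (D n z v - D' z v)"
          by (intro tendsto_intros D' that)
        show "\<forall>m\<ge>N. cmod (D n z v - D m z v) \<le> e * norm v"
          using N that by blast
      qed
      then show "\<forall>\<^sub>F n in sequentially. \<forall>x\<in>ball 0 R. \<forall>h. cmod (D n x h - D' x h) \<le> e * norm h"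
        unfolding eventually_sequentially by blast
    qed auto
    then obtain g where g: "\<And>x. x \<in> ball 0 R \<Longrightarrow> (\<lambda>n. F n x) \<longlonglongrightarrow> g x"
        "\<And>x. x \<in> ball 0 R \<Longrightarrow> (g has_derivative D' x) (at x within ball 0 R)"
      by blast
    have fg: "f x = g x" if "x \<in> ball 0 R" for x
      using f_lim[OF that] g(1)[OF that] by (rule LIMSEQ_unique)
    show ?thesis unfolding holomorphic_cn_on_def
    proof (intro ballI exI conjI allI)
      fix z assume z: "z \<in> ball (0 :: complex^'m) R"
      have "(g has_derivative D' z) (at z)"
        using g(2)[OF z] at_within_open[OF z open_ball] by simp
      then show "(f has_derivative D' z) (at z)"
        by (rule has_derivative_transform_within_open[OF _ open_ball z]) (simp add: fg)
      show "D' z (c *s v) = c * D' z v" for c v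
      proof (rule LIMSEQ_unique)
        show "(\<lambda>n. D n z (c *s v)) \<longlonglongrightarrow> D' z (c *s v)" by (rule D'[OF z])
        show "(\<lambda>n. D n z (c *s v)) \<longlonglongrightarrow> c * D' z v"
          unfolding D(2) by (intro tendsto_intros D'[OF z])
      qed
    qed
  qed
qed

subsection \<open>Measures on the sphere\<close>

lemma orthogonal_transformation_vimage_ball:
  fixes f :: "'a::euclidean_space \<Rightarrow> 'a"
  assumes "orthogonal_transformation f"
  shows "f -` ball a r = ball (inv f a) r"
proof -
  have bij: "bij f" and f: "linear f" "\<And>x. norm (f x) = norm x"
    using assms orthogonal_transformation_bij[OF assms] by (auto simp: orthogonal_transformation)
  have "dist (inv f a) x = dist a (f x)" for x
  proof -
    have "dist a (f x) = norm (f (inv f a) - f x)"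
      using bij by (simp add: dist_norm surj_f_inv_f bij_is_surj)
    also have "\<dots> = norm (inv f a - x)" by (simp add: f(2) flip: linear_diff[OF f(1)])
    finally show ?thesis by (simp add: dist_norm)
  qed
  then show ?thesis by auto
qed

text \<open>By Vitali's theorem an open set is, up to a null set, a disjoint union of balls, and the
  measure of a ball is invariant.\<close>

lemma emeasure_lborel_orthogonal_le:
  fixes f :: "'a::euclidean_space \<Rightarrow> 'a"
  assumes f: "orthogonal_transformation f" and "open U"
  shows "emeasure lborel U \<le> emeasure lborel (f -` U)"
proof -
  let ?K = "{(a, r). 0 < r \<and> ball a r \<subseteq> U}"
  obtain C where C: "countable C" "C \<subseteq> ?K"
      "pairwise (\<lambda>i j. disjnt (ball (fst i) (snd i)) (ball (fst j) (snd j))) C"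
      "negligible (U - (\<Union>i\<in>C. ball (fst i) (snd i)))"
  proof (rule Vitali_covering_theorem_balls[of U ?K fst snd])
    fix x and d :: real assume x: "x \<in> U" "0 < d"
    obtain e where e: "e > 0" "ball x e \<subseteq> U" using \<open>open U\<close> x by (meson openE)
    have "ball x (min e (d / 2)) \<subseteq> ball x e" by auto
    with e x show "\<exists>i. i \<in> ?K \<and> x \<in> ball (fst i) (snd i) \<and> snd i < d"
      by (intro exI[of _ "(x, min e (d / 2))"]) auto
  qed blast
  let ?B = "\<lambda>i. ball (fst i) (snd i)" and ?B' = "\<lambda>i. ball (inv f (fst i)) (snd i)"
  have [measurable]: "(\<Union>i\<in>C. ?B i) \<in> sets borel" "U \<in> sets borel" "(\<Union>i\<in>C. ?B' i) \<in> sets borel"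
    using \<open>open U\<close> by (auto intro!: borel_open open_UN)
  have vim: "f -` ?B i = ?B' i" for i :: "'a \<times> real"
    by (rule orthogonal_transformation_vimage_ball[OF f])
  have disj: "disjoint_family_on ?B C"
    using C(3) by (auto simp: disjoint_family_on_def pairwise_def disjnt_def)
  then have disj': "disjoint_family_on ?B' C"
    unfolding disjoint_family_on_def vim[symmetric] by (auto simp flip: vimage_Int)
  have "emeasure lborel U \<le> emeasure lborel ((\<Union>i\<in>C. ?B i) \<union> (U - (\<Union>i\<in>C. ?B i)))"
    by (intro emeasure_mono) auto
  also have "\<dots> \<le> emeasure lborel (\<Union>i\<in>C. ?B i) + emeasure lborel (U - (\<Union>i\<in>C. ?B i))"
    by (intro emeasure_subadditive) auto
  also have "emeasure lborel (U - (\<Union>i\<in>C. ?B i)) = 0"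
    using C(4) by (simp add: negligible_iff_null_sets null_sets_def)
  also have "emeasure lborel (\<Union>i\<in>C. ?B i) = (\<integral>\<^sup>+i. emeasure lborel (?B i) \<partial>count_space C)"
    using C(1) disj by (intro emeasure_UN_countable) auto
  also have "\<dots> = (\<integral>\<^sup>+i. emeasure lborel (?B' i) \<partial>count_space C)"
    using C(2) by (intro nn_integral_cong) (auto simp: emeasure_ball)
  also have "\<dots> = emeasure lborel (\<Union>i\<in>C. ?B' i)"
    using C(1) disj' by (intro emeasure_UN_countable[symmetric]) auto
  also have "(\<Union>i\<in>C. ?B' i) = f -` (\<Union>i\<in>C. ?B i)"
    by (simp add: vimage_UN vim)
  also have "emeasure lborel (f -` (\<Union>i\<in>C. ?B i)) \<le> emeasure lborel (f -` U)"
  proof (rule emeasure_mono)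
    have "continuous_on UNIV f"
      using f by (simp add: linear_continuous_on linear_linear orthogonal_transformation)
    then show "f -` U \<in> sets lborel" using \<open>open U\<close> by (simp add: borel_open open_vimage)
    have "(\<Union>i\<in>C. ?B i) \<subseteq> U" using C(2) by fastforce
    then show "f -` (\<Union>i\<in>C. ?B i) \<subseteq> f -` U" by (rule vimage_mono)
  qed
  finally show ?thesis by simp
qed

text \<open>The inequality for \<open>f\<close> and the one for its inverse sandwich the measure of
  an open box, and the boxes determine Lebesgue measure.\<close>

lemma distr_lborel_orthogonal:
  fixes f :: "'a::euclidean_space \<Rightarrow> 'a"
  assumes f: "orthogonal_transformation f"
  shows "distr lborel borel f = lborel"
proof (rule lborel_eqI[symmetric])
  have bij: "bij f" and inv: "orthogonal_transformation (inv f)"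
    using f by (auto intro: orthogonal_transformation_bij orthogonal_transformation_inv)
  have cont: "continuous_on UNIV f"
    using f by (simp add: linear_continuous_on linear_linear orthogonal_transformation)
  then have [measurable]: "f \<in> borel_measurable borel" by (rule borel_measurable_continuous_onI)
  fix l u :: 'a assume lu: "\<And>b. b \<in> Basis \<Longrightarrow> l \<bullet> b \<le> u \<bullet> b"
  have "emeasure lborel (f -` box l u) \<le> emeasure lborel (inv f -` (f -` box l u))"
    by (intro emeasure_lborel_orthogonal_le inv open_vimage cont open_box)
  also have "inv f -` (f -` box l u) = box l u"
    using bij by (auto simp: surj_f_inv_f bij_is_surj)
  finally have "emeasure lborel (f -` box l u) = emeasure lborel (box l u)"
    using emeasure_lborel_orthogonal_le[OF f open_box[of l u]] by (rule antisym)
  then show "emeasure (distr lborel borel f) (box l u) = (\<Prod>b\<in>Basis. (u - l) \<bullet> b)"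
    using lu by (simp add: emeasure_distr emeasure_lborel_box)
qed simp

lemma space_sphere_volume [simp]: "space (sphere_volume :: 'a::euclidean_space measure) = sphere 0 1"
  using sets_eq_imp_space_eq[OF sets_sphere_volume] by (simp add: space_restrict_space)

lemma measurable_sphere_cont:
  fixes f :: "'a::euclidean_space \<Rightarrow> 'a"
  assumes "continuous_on (sphere 0 1) f" "f \<in> sphere 0 1 \<rightarrow> sphere 0 1"
    and "sets M = sets (restrict_space borel (sphere 0 1))"
  shows "f \<in> measurable M M"
proof -
  have "f \<in> measurable (restrict_space borel (sphere 0 1)) (restrict_space borel (sphere 0 1))"
    using assms by (intro measurable_restrict_space2)
      (auto intro: borel_measurable_continuous_on_restrict simp: space_restrict_space)
  then show ?thesis by (simp add: measurable_cong_sets[OF assms(3) assms(3)])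
qed

text \<open>The volume is defined through cones, and the preimage of a cone under a linear isometry
  is the cone over the preimage of its base.\<close>

lemma invariant_sphere_volume_orthogonal:
  fixes f :: "'a::euclidean_space \<Rightarrow> 'a"
  assumes f: "orthogonal_transformation f"
  shows "invariant_measure sphere_volume f"
  unfolding invariant_measure_def
proof
  have lin: "linear f" "\<And>x. norm (f x) = norm x"
    using f by (auto simp: orthogonal_transformation)
  have cont: "continuous_on A f" for A
    using lin by (simp add: linear_continuous_on linear_linear)
  then have fb [measurable]: "f \<in> borel_measurable borel" by (rule borel_measurable_continuous_onI)
  show fm: "f \<in> measurable sphere_volume sphere_volume"
    by (rule measurable_sphere_cont[OF cont _ sets_sphere_volume]) (auto simp: lin)
  show "distr sphere_volume sphere_volume f = sphere_volume"
  proof (rule measure_eqI)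
    fix A assume "A \<in> sets (distr sphere_volume sphere_volume f)"
    then have "A \<in> sets sphere_volume" by simp
    then have A: "A \<in> sets (borel :: 'a measure)" "A \<subseteq> sphere 0 1"
      unfolding sets_sphere_volume by (auto simp: sets_restrict_space_iff)
    let ?C = "\<lambda>A. {r *\<^sub>R x | r x. 0 < r \<and> r \<le> (1::real) \<and> x \<in> A}"
    let ?A' = "f -` A \<inter> sphere 0 1"
    have [measurable]: "?A' \<in> sets borel"
      using measurable_sets[OF fb A(1)] by auto
    have sgn_borel: "sgn \<in> borel_measurable (borel :: 'a measure)"
      unfolding sgn_div_norm by measurable
    \<comment> \<open>As a set of products \<open>r *\<^sub>R x\<close> the cone is not visibly
      Borel; as the trace of a preimage under \<open>sgn\<close> it is.\<close>
    have "sgn -` A \<inter> (cball 0 1 - {0}) \<in> sets (borel :: 'a measure)"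
      using measurable_sets[OF sgn_borel A(1)] by auto
    also have "sgn -` A \<inter> (cball 0 1 - {0}) = ?C A"
    proof (intro equalityI subsetI)
      fix y assume y: "y \<in> sgn -` A \<inter> (cball 0 1 - {0})"
      then have "y = norm y *\<^sub>R sgn y" by (simp add: sgn_div_norm)
      with y show "y \<in> ?C A"
        by (auto intro!: exI[of _ "norm y"] exI[of _ "sgn y"])
    next
      fix y assume "y \<in> ?C A"
      then obtain r x where y: "y = r *\<^sub>R x" "0 < r" "r \<le> 1" "x \<in> A" by blast
      then have "norm x = 1" using A(2) by auto
      with y show "y \<in> sgn -` A \<inter> (cball 0 1 - {0})" by (auto simp: sgn_div_norm)
    qed
    finally have C: "?C A \<in> sets borel" .
    have "f -` ?C A = ?C ?A'"
    proof (intro equalityI subsetI)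
      fix y assume "y \<in> f -` ?C A"
      then obtain r x where y: "f y = r *\<^sub>R x" "0 < r" "r \<le> 1" "x \<in> A" by blast
      then have "f (inverse r *\<^sub>R y) = x" using lin by (simp add: linear_cmul)
      moreover have "norm x = 1" using A y by auto
      ultimately show "y \<in> ?C ?A'"
        using y lin(2)[of "inverse r *\<^sub>R y"] by (auto intro!: exI[of _ r] exI[of _ "inverse r *\<^sub>R y"])
    next
      fix y assume "y \<in> ?C ?A'"
      then obtain r x where "y = r *\<^sub>R x" "0 < r" "r \<le> 1" "f x \<in> A" by blast
      then show "y \<in> f -` ?C A"
        using lin(1) by (intro vimageI2 CollectI exI[of _ r] exI[of _ "f x"]) (simp add: linear_cmul)
    qed
    then have "emeasure lborel (?C ?A') = emeasure (distr lborel borel f) (?C A)"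
      using C by (simp add: emeasure_distr)
    also have "\<dots> = emeasure lborel (?C A)" by (simp add: distr_lborel_orthogonal[OF f])
    finally show "emeasure (distr sphere_volume sphere_volume f) A = emeasure sphere_volume A"
      using fm \<open>A \<in> sets sphere_volume\<close> A
      by (simp add: emeasure_distr emeasure_sphere_volume)
  qed simp
qed

text \<open>The cone over the whole sphere is the punctured ball. Both facts serve to normalise the
  volume to an invariant probability measure.\<close>

lemma finite_sphere_volume: "finite_measure (sphere_volume :: 'a::euclidean_space measure)"
  and sphere_volume_pos: "emeasure sphere_volume (sphere (0 :: 'a) 1) > 0"
proof -
  have eq: "{r *\<^sub>R x | r x. 0 < r \<and> r \<le> (1::real) \<and> x \<in> sphere (0::'a) 1} = cball 0 1 - {0}"
  proof (intro equalityI subsetI)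
    fix y :: 'a assume "y \<in> cball 0 1 - {0}"
    then show "y \<in> {r *\<^sub>R x | r x. 0 < r \<and> r \<le> (1::real) \<and> x \<in> sphere (0::'a) 1}"
      by (auto intro!: exI[of _ "norm y"] exI[of _ "inverse (norm y) *\<^sub>R y"])
  qed auto
  have *: "emeasure sphere_volume (sphere (0::'a) 1) = of_nat DIM('a) * emeasure lborel (cball (0::'a) 1)"
    using emeasure_sphere_volume[of "sphere (0::'a) 1"] emeasure_Diff_null_set[of "{0::'a}" lborel "cball 0 1"]
    unfolding eq by (simp add: null_sets_def)
  show "finite_measure (sphere_volume :: 'a measure)"
    by (rule finite_measureI) (simp add: * emeasure_cball ennreal_of_nat_eq_real_of_nat flip: ennreal_mult')
  show "emeasure sphere_volume (sphere (0 :: 'a) 1) > 0"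
    by (simp add: * emeasure_cball ennreal_zero_less_mult_iff unit_ball_vol_pos of_nat_0_less_iff)
qed

definition sphere_measure :: "'a::euclidean_space measure \<Rightarrow> bool" where
  "sphere_measure M \<longleftrightarrow> sets M = sets (restrict_space borel (sphere 0 1)) \<and> finite_measure M"

text \<open>Truncated linear functions of the distance decrease to the indicator of a closed set, so
  the measure of \<open>C\<close> is determined by integrals of continuous functions.\<close>

lemma lim_integral_infdist:
  fixes M :: "'a::euclidean_space measure"
  assumes M: "sets M = sets borel" "finite_measure M" and C: "closed C" "C \<noteq> {}"
  shows "(\<lambda>k. \<integral>x. max 0 (1 - real k * infdist x C) \<partial>M) \<longlonglongrightarrow> measure M C"
proof -
  interpret finite_measure M by (rule M)
  have "(\<lambda>k. \<integral>x. max 0 (1 - real k * infdist x C) \<partial>M) \<longlonglongrightarrow> (\<integral>x. indicator C x \<partial>M)"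
  proof (rule integral_dominated_convergence[where w = "\<lambda>_. 1"])
    show "AE x in M. (\<lambda>k. max 0 (1 - real k * infdist x C)) \<longlonglongrightarrow> indicator C x"
    proof (rule AE_I2)
      fix x
      show "(\<lambda>k. max 0 (1 - real k * infdist x C)) \<longlonglongrightarrow> indicator C x"
      proof (cases "x \<in> C")
        case False
        then have pos: "infdist x C > 0"
          using C in_closed_iff_infdist_zero[OF C(1) C(2), of x] infdist_nonneg[of x C] by linarith
        have "\<forall>\<^sub>F k in sequentially. real k > 1 / infdist x C"
          by real_asymp
        then have "\<forall>\<^sub>F k in sequentially. max 0 (1 - real k * infdist x C) = 0"
          by eventually_elim (use pos in \<open>simp add: field_simps\<close>)
        then show ?thesis using False by (simp add: tendsto_eventually)
      qed simp
    qed
    show "AE x in M. norm (max 0 (1 - real k * infdist x C)) \<le> 1" for k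
      by (simp add: infdist_nonneg)
  qed (use C M in \<open>auto simp: measurable_cong_sets[OF M(1) refl] intro!: borel_measurable_continuous_onI
      continuous_intros\<close>)
  also have "(\<integral>x. indicator C x \<partial>M) = measure M C"
    using C M by (simp add: sets_eq_imp_space_eq[OF M(1)])
  finally show ?thesis .
qed

text \<open>Countability allows one sequence of steps to treat all test functions. They are the
  approximations above for a countable family of closed sets that is stable under intersections and
  generates the Borel sets.\<close>

lemma determining_functions:
  obtains e :: "nat \<Rightarrow> 'a::euclidean_space \<Rightarrow> real"
  where "\<And>j. continuous_on UNIV (e j)"
    "\<And>M N. \<lbrakk>sphere_measure M; sphere_measure N; \<And>j. (\<integral>x. e j x \<partial>M) = (\<integral>x. e j x \<partial>N)\<rbrakk> \<Longrightarrow> M = N"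
proof -
  obtain B :: "'a set set" where B: "countable B" "topological_basis B"
    using ex_countable_basis by blast
  \<comment> \<open>Removing finite unions, rather than single basic sets, gives stability under
    intersections; the empty union contributes the whole space.\<close>
  define E where "E = (\<lambda>F. UNIV - \<Union>F) ` {F. finite F \<and> F \<subseteq> B}"
  have "countable E"
    unfolding E_def by (intro countable_image countable_Collect_finite_subset B)
  have UE: "UNIV \<in> E" unfolding E_def by (rule image_eqI[of _ _ "{}"]) auto
  have E: "closed C" if "C \<in> E" for C
    using that B(2) by (auto simp: E_def intro!: open_Union dest: topological_basis_open)
  have "Int_stable E"
  proof (rule Int_stableI)
    fix a b assume "a \<in> E" "b \<in> E"
    then obtain F G where "a = UNIV - \<Union>F" "b = UNIV - \<Union>G" "finite F" "finite G" "F \<subseteq> B" "G \<subseteq> B"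
      by (auto simp: E_def)
    then show "a \<inter> b \<in> E"
      unfolding E_def by (intro image_eqI[of _ _ "F \<union> G"]) auto
  qed
  have borel_E: "sets borel = sigma_sets UNIV E"
  proof -
    have "sets borel = sigma_sets UNIV B"
      by (subst borel_eq_countable_basis[OF B]) simp
    also have "sigma_sets UNIV B = sigma_sets UNIV E"
    proof (rule sigma_sets_eqI)
      fix b assume b: "b \<in> B"
      then have "UNIV - b \<in> E" unfolding E_def by (intro image_eqI[of _ _ "{b}"]) auto
      then have "UNIV - (UNIV - b) \<in> sigma_sets UNIV E"
        by (intro sigma_sets.Compl sigma_sets.Basic)
      then show "b \<in> sigma_sets UNIV E" by (simp add: double_diff)
    next
      fix c assume "c \<in> E"
      then have "c \<in> sets borel" by (intro borel_closed E)
      then show "c \<in> sigma_sets UNIV B" using \<open>sets borel = sigma_sets UNIV B\<close> by simp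
    qed
    finally show ?thesis .
  qed
  \<comment> \<open>The index codes a pair of a closed set and a slope.\<close>
  define e where "e j x = max 0 (1 - real (snd (prod_decode j)) *
     infdist x (from_nat_into E (fst (prod_decode j))))" for j and x :: 'a
  have e_cont: "continuous_on UNIV (e j)" for j
    unfolding e_def by (intro continuous_intros)
  have borel_case: "M = N"
    if M: "sets M = sets borel" "finite_measure M" and N: "sets N = sets borel" "finite_measure N"
      and eq: "\<And>j. (\<integral>x. e j x \<partial>M) = (\<integral>x. e j x \<partial>N)" for M N
  proof (rule measure_eqI_generator_eq[OF \<open>Int_stable E\<close>, where \<Omega> = UNIV and A = "\<lambda>_. UNIV"])
    show "sets M = sigma_sets UNIV E" "sets N = sigma_sets UNIV E"
      using M N borel_E by auto
    show "range (\<lambda>_. UNIV) \<subseteq> E" using UE by auto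
    show "emeasure M UNIV \<noteq> \<infinity>" using finite_measure.emeasure_finite[OF M(2)] by simp
    fix C assume C: "C \<in> E"
    show "emeasure M C = emeasure N C"
    proof (cases "C = {}")
      case False
      obtain c where c: "from_nat_into E c = C"
        using from_nat_into_surj[OF \<open>countable E\<close> C] by auto
      have "(\<integral>x. max 0 (1 - real k * infdist x C) \<partial>M) = (\<integral>x. max 0 (1 - real k * infdist x C) \<partial>N)" for k
        using eq[of "prod_encode (c, k)"] by (simp add: e_def[abs_def] c)
      then have "measure M C = measure N C"
        using lim_integral_infdist[OF M E[OF C] False] lim_integral_infdist[OF N E[OF C] False]
        by (auto intro: LIMSEQ_unique)
      then show ?thesis using M N by (simp add: finite_measure.emeasure_eq_measure)
    qed simp
  qed auto
  show thesis
  proof (rule that[of e])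
    show "continuous_on UNIV (e j)" for j by (rule e_cont)
    fix M N :: "'a measure"
    assume "sphere_measure M" "sphere_measure N" and eq: "\<And>j. (\<integral>x. e j x \<partial>M) = (\<integral>x. e j x \<partial>N)"
    then have M: "sets M = sets (restrict_space borel (sphere 0 1))" "finite_measure M"
      and N: "sets N = sets (restrict_space borel (sphere 0 1))" "finite_measure N"
      by (auto simp: sphere_measure_def)
    \<comment> \<open>The identity pushes a measure on the sphere forward to one on the whole space,
      where the preceding argument applies.\<close>
    have meas: "(\<lambda>x. x) \<in> measurable P borel" if "sets P = sets (restrict_space borel (sphere 0 1))" for P :: "'a measure"
      by (subst measurable_cong_sets[OF that refl]) (rule measurable_restrict_space1, simp)
    have "distr M borel (\<lambda>x. x) = distr N borel (\<lambda>x. x)"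
    proof (rule borel_case)
      show "(\<integral>x. e j x \<partial>distr M borel (\<lambda>x. x)) = (\<integral>x. e j x \<partial>distr N borel (\<lambda>x. x))" for j
        using eq[of j] meas[OF M(1)] meas[OF N(1)] e_cont
        by (simp add: integral_distr borel_measurable_continuous_onI)
    qed (auto intro!: finite_measure.finite_measure_distr M N meas)
    moreover have "emeasure P A = emeasure (distr P borel (\<lambda>x. x)) A"
      if "sets P = sets (restrict_space borel (sphere 0 1))" "A \<in> sets (restrict_space borel (sphere 0 1))" for P and A :: "'a set"
    proof -
      have "A \<in> sets borel" "A \<subseteq> sphere 0 1" using that by (auto simp: sets_restrict_space_iff)
      then show ?thesis
        using meas[OF that(1)] sets_eq_imp_space_eq[OF that(1)]
        by (simp add: emeasure_distr space_restrict_space Int_absorb2)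
    qed
    ultimately show "M = N"
      using M(1) N(1) by (intro measure_eqI) auto
  qed
qed

section \<open>The circle actions on the real sphere, and moduli of continuity\<close>

definition circ :: "real^('n::finite \<times> 2) \<Rightarrow> real \<Rightarrow> real^('n \<times> 2) \<Rightarrow> real^('n \<times> 2)" where
  "circ u s = plane_rot u (cos (2 * pi * s)) (sin (2 * pi * s))"

lemma dot_unit: "norm (u :: real^'m::finite) = 1 \<Longrightarrow> dot u u = 1"
  by (simp add: norm_eq_dot)

lemma circ_0 [simp]: "circ u 0 x = x"
  by (simp add: circ_def)

lemma circ_add: "norm u = 1 \<Longrightarrow> circ u (s + t) x = circ u s (circ u t x)"
  by (simp add: circ_def plane_rot_compose dot_unit ring_distribs cos_add sin_add)

lemma circ_plus_1 [simp]: "circ u (s + 1) x = circ u s x"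
  by (simp add: circ_def ring_distribs)

lemma norm_circ [simp]: "norm u = 1 \<Longrightarrow> norm (circ u s x) = norm x"
  unfolding circ_def norm_eq_dot[of "plane_rot _ _ _ _"] norm_eq_dot[of x]
  by (subst dot_plane_rot_self) (simp_all add: dot_unit flip: power2_eq_square)

lemma circ_rot: "circ u s (rot t x) = rot t (circ u s x)"
  by (simp add: circ_def plane_rot_rot)

lemma perp_circ: "norm u = 1 \<Longrightarrow> perp u (circ u s x) = perp u x"
  by (simp add: circ_def perp_plane_rot dot_unit)

text \<open>In the complex line of \<open>u\<close> the two circle actions agree. Hence estimates
  for \<open>rot\<close> pass to \<open>circ u\<close>, and the two are close wherever
  \<open>perp u x\<close> is small.\<close>

lemma circ_eq_perp: "circ u s x = perp u x + rot s (x - perp u x)"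
  by (simp add: circ_def perp_def plane_rot_def rot_eq_J J_simps vec_eq_iff algebra_simps)

lemma orthogonal_transformation_circ:
  fixes u :: "real^('n::finite \<times> 2)"
  assumes "norm u = 1"
  shows "orthogonal_transformation (circ u s)"
proof -
  have "r *\<^sub>R x = r *s x" for r :: real and x :: "real^('n \<times> 2)"
    by (simp add: vec_eq_iff)
  then have "linear (circ u s)"
    unfolding circ_def by (intro linearI) (simp_all add: plane_rot_linear)
  then show ?thesis using assms by (simp add: orthogonal_transformation)
qed

lemma norm_diff_perp_le:
  fixes u :: "real^('n::finite \<times> 2)"
  assumes "norm u = 1"
  shows "norm (x - perp u x) \<le> 2 * norm x"
proof -
  have "x - perp u x = dot x u *\<^sub>R u + dot x (J u) *\<^sub>R J u"
    by (simp add: perp_def vec_eq_iff)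
  then have "norm (x - perp u x) \<le> \<bar>dot x u\<bar> * norm u + \<bar>dot x (J u)\<bar> * norm (J u)"
    by (metis norm_scaleR norm_triangle_ineq)
  also have "\<dots> \<le> norm x * 1 + norm x * 1"
    using Cauchy_Schwarz_ineq2[of x u] Cauchy_Schwarz_ineq2[of x "J u"] assms
    by (simp add: dot_real)
  finally show ?thesis by simp
qed

lemma norm_circ_diff_le:
  assumes "norm u = 1"
  shows "norm (circ u s x - circ u t x) \<le> 8 * pi * \<bar>s - t\<bar> * norm x"
proof -
  have "circ u s x - circ u t x = rot s (x - perp u x) - rot t (x - perp u x)"
    by (simp add: circ_eq_perp)
  then have "norm (circ u s x - circ u t x) \<le> 4 * pi * \<bar>s - t\<bar> * norm (x - perp u x)"
    using norm_rot_diff_le[of s "x - perp u x" t] by simp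
  also have "\<dots> \<le> 4 * pi * \<bar>s - t\<bar> * (2 * norm x)"
    by (intro mult_left_mono norm_diff_perp_le assms) auto
  finally show ?thesis by simp
qed

lemma norm_circ_diff_rot_le: "norm (circ u s x - rot s x) \<le> 2 * norm (perp u x)"
proof -
  have "circ u s x - rot s x = perp u x - rot s (perp u x)"
    by (simp add: circ_eq_perp rot_diff)
  then show ?thesis using norm_triangle_ineq4[of "perp u x" "rot s (perp u x)"] by simp
qed

lemma circ_diff: "circ u s (x - y) = circ u s x - circ u s y"
  by (simp add: circ_def plane_rot_linear)

lemma continuous_on_J [continuous_intros]:
  fixes f :: "'a::t2_space \<Rightarrow> real^('n::finite \<times> 2)"
  assumes "continuous_on A f"
  shows "continuous_on A (\<lambda>y. J (f y))"
proof -
  have "continuous_on A (\<lambda>y. if snd p = 1 then f y $ (fst p, 2) else - f y $ (fst p, 1))"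
    for p :: "'n \<times> 2"
    using assms by (cases "snd p = 1") (auto intro!: continuous_intros)
  then show ?thesis unfolding J_def by (rule continuous_on_vec_lambda)
qed

lemma continuous_on_rot [continuous_intros]:
  fixes f :: "'a::t2_space \<Rightarrow> real^('n::finite \<times> 2)"
  assumes "continuous_on A s" "continuous_on A f"
  shows "continuous_on A (\<lambda>y. rot (s y) (f y))"
proof -
  have "rot t x = cos (2 * pi * t) *\<^sub>R x + sin (2 * pi * t) *\<^sub>R J x" for t and x :: "real^('n \<times> 2)"
    by (simp add: rot_eq_J vec_eq_iff)
  then show ?thesis using assms by (auto intro!: continuous_intros)
qed

lemma continuous_on_perp [continuous_intros]:
  fixes f :: "'a::t2_space \<Rightarrow> real^('n::finite \<times> 2)"
  assumes "continuous_on A f"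
  shows "continuous_on A (\<lambda>y. perp u (f y))"
proof -
  have "perp u x = x - (x \<bullet> u) *\<^sub>R u - (x \<bullet> J u) *\<^sub>R J u" for x
    by (simp add: perp_def vec_eq_iff dot_real)
  then show ?thesis using assms by (auto intro!: continuous_intros)
qed

lemma continuous_on_circ [continuous_intros]:
  fixes f :: "'a::t2_space \<Rightarrow> real^('n::finite \<times> 2)"
  assumes "continuous_on A s" "continuous_on A f"
  shows "continuous_on A (\<lambda>y. circ u (s y) (f y))"
  unfolding circ_eq_perp using assms by (intro continuous_intros)

text \<open>\<open>circ u\<close> displaces \<open>x\<close> within the complex line of
  \<open>u\<close>, so the line of the chord \<open>y - x\<close> is the natural choice. A rotation
  producing exactly this chord exists because \<open>x\<close> and \<open>y\<close> have the same
  norm.\<close>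

lemma circ_transitive:
  fixes x y :: "real^('n::finite \<times> 2)"
  assumes x: "norm x = 1" and y: "norm y = 1"
  obtains u s where "norm u = 1" "circ u s x = y"
proof (cases "x = y")
  case True
  with x show thesis by (intro that[of x 0]) auto
next
  case False
  define d where "d = norm (y - x)"
  define u where "u = inverse d *\<^sub>R (y - x)"
  have d: "d > 0" using False by (simp add: d_def)
  have u: "norm u = 1" using d by (simp add: u_def flip: d_def)
  define a where "a = x \<bullet> u"
  define b where "b = x \<bullet> J u"
  have dd: "d * d = 2 - 2 * (x \<bullet> y)"
    using x y by (simp add: d_def inner_diff power2_norm_eq_inner[symmetric] inner_commute
        flip: power2_eq_square) (simp add: norm_eq_1 inner_commute power2_norm_eq_inner inner_diff)
  have "a * d = x \<bullet> (y - x)" using d by (simp add: a_def u_def)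
  also have "\<dots> = x \<bullet> y - 1" using x by (simp add: inner_diff norm_eq_1)
  finally have "(2 * a + d) * d = 0" using dd by (simp add: algebra_simps)
  then have a: "2 * a + d = 0" using d by simp
  define n where "n = a * a + b * b"
  have "a \<noteq> 0" using a d by auto
  then have n: "n > 0" unfolding n_def by (intro add_pos_nonneg) (auto simp: zero_less_mult_iff)
  \<comment> \<open>For the complex number w = a + i b the requirement is (cis t - 1) * w = d, that
    is, cis t = 1 + k * cnj w. The right-hand side has modulus 1 because
    \<open>2 * a + d = 0\<close>.\<close>
  define k where "k = d / n"
  have k: "k * n = d" using n by (simp add: k_def)
  have "(1 + k * a)\<^sup>2 + (- k * b)\<^sup>2 = 1 + 2 * (k * a) + k * (k * n)"
    by (simp add: power2_eq_square n_def algebra_simps)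
  also have "\<dots> = 1 + k * (2 * a + d)" by (simp add: k algebra_simps)
  also have "\<dots> = 1" by (simp add: a)
  finally obtain t where t: "1 + k * a = cos t" "- k * b = sin t" by (rule sincos_total_2pi)
  have 1: "(cos t - 1) * a - sin t * b = d"
    by (simp add: t[symmetric] k[symmetric] n_def algebra_simps)
  have 2: "(cos t - 1) * b + sin t * a = 0"
    by (simp add: t[symmetric])
  have "circ u (t / (2 * pi)) x = x + d *s u"
    unfolding circ_def plane_rot_def dot_real using 1 2 by (simp add: a_def b_def)
  also have "\<dots> = y"
    using d by (simp add: u_def vec_eq_iff right_inverse flip: mult.assoc)
  finally show thesis using u by (intro that)
qed

lemma sphere_uniform:
  fixes g :: "'a::euclidean_space \<Rightarrow> real"
  assumes "continuous_on (sphere 0 1) g" "\<epsilon> > 0"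
  obtains \<delta> where "\<delta> > 0" "\<And>x y. norm x = 1 \<Longrightarrow> norm y = 1 \<Longrightarrow> norm (x - y) \<le> \<delta> \<Longrightarrow> \<bar>g x - g y\<bar> \<le> \<epsilon>"
proof -
  have "uniformly_continuous_on (sphere 0 1) g"
    using assms by (intro compact_uniformly_continuous) auto
  then obtain \<delta> where "\<delta> > 0" and \<delta>: "\<And>x y. x \<in> sphere 0 1 \<Longrightarrow> y \<in> sphere 0 1 \<Longrightarrow> dist y x < \<delta> \<Longrightarrow> dist (g y) (g x) < \<epsilon>"
    using assms(2) unfolding uniformly_continuous_on_def by metis
  show thesis
  proof (rule that[of "\<delta> / 2"])
    fix x y :: 'a assume "norm x = 1" "norm y = 1" "norm (x - y) \<le> \<delta> / 2"
    then show "\<bar>g x - g y\<bar> \<le> \<epsilon>"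
      using \<delta>[of y x] \<open>\<delta> > 0\<close> by (simp add: dist_norm)
  qed (use \<open>\<delta> > 0\<close> in auto)
qed

lemma sphere_bounded:
  fixes g :: "'a::euclidean_space \<Rightarrow> real"
  assumes "continuous_on (sphere 0 1) g"
  obtains B where "B \<ge> 0" "\<And>x. norm x = 1 \<Longrightarrow> \<bar>g x\<bar> \<le> B"
proof -
  have "bounded (g ` sphere 0 1)"
    using assms by (intro compact_imp_bounded compact_continuous_image) auto
  then obtain B where "\<forall>y\<in>g ` sphere 0 1. norm y \<le> B"
    unfolding bounded_iff by blast
  then show thesis by (intro that[of "max B 0"]) (auto simp: le_max_iff_disj)
qed

lemma rot_uniform:
  fixes g :: "real^('n::finite \<times> 2) \<Rightarrow> real"
  assumes "continuous_on (sphere 0 1) g" "\<epsilon> > 0"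
  obtains \<delta> where "\<delta> > 0" "\<And>x s t. norm x = 1 \<Longrightarrow> \<bar>s - t\<bar> \<le> \<delta> \<Longrightarrow> \<bar>g (rot s x) - g (rot t x)\<bar> \<le> \<epsilon>"
proof -
  obtain \<delta> where \<delta>: "\<delta> > 0" "\<And>x y. norm x = 1 \<Longrightarrow> norm y = 1 \<Longrightarrow> norm (x - y) \<le> \<delta> \<Longrightarrow> \<bar>g x - g y\<bar> \<le> \<epsilon>"
    using sphere_uniform[OF assms] by blast
  show thesis
  proof (rule that[of "\<delta> / (4 * pi)"])
    fix x :: "real^('n \<times> 2)" and s t :: real
    assume x: "norm x = 1" and "\<bar>s - t\<bar> \<le> \<delta> / (4 * pi)"
    then have "norm (rot s x - rot t x) \<le> \<delta>"
      using norm_rot_diff_le[of s x t] by (simp add: field_simps)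
    with x show "\<bar>g (rot s x) - g (rot t x)\<bar> \<le> \<epsilon>" by (intro \<delta>) auto
  qed (use \<delta> in auto)
qed

lemma circ_uniform:
  fixes g :: "real^('n::finite \<times> 2) \<Rightarrow> real"
  assumes "continuous_on (sphere 0 1) g" "\<epsilon> > 0" "norm u = 1"
  obtains \<delta> where "\<delta> > 0" "\<And>x s t. norm x = 1 \<Longrightarrow> \<bar>s - t\<bar> \<le> \<delta> \<Longrightarrow> \<bar>g (circ u s x) - g (circ u t x)\<bar> \<le> \<epsilon>"
proof -
  obtain \<delta> where \<delta>: "\<delta> > 0" "\<And>x y. norm x = 1 \<Longrightarrow> norm y = 1 \<Longrightarrow> norm (x - y) \<le> \<delta> \<Longrightarrow> \<bar>g x - g y\<bar> \<le> \<epsilon>"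
    using sphere_uniform[OF assms(1,2)] by blast
  show thesis
  proof (rule that[of "\<delta> / (8 * pi)"])
    fix x :: "real^('n \<times> 2)" and s t :: real
    assume x: "norm x = 1" and "\<bar>s - t\<bar> \<le> \<delta> / (8 * pi)"
    then have "norm (circ u s x - circ u t x) \<le> \<delta>"
      using norm_circ_diff_le[OF assms(3), of s x t] by (simp add: field_simps)
    with x show "\<bar>g (circ u s x) - g (circ u t x)\<bar> \<le> \<epsilon>" using assms(3) by (intro \<delta>) auto
  qed (use \<delta> in auto)
qed

subsection \<open>Averages over circles\<close>

definition avg :: "real^('n::finite \<times> 2) \<Rightarrow> (real^('n \<times> 2) \<Rightarrow> real) \<Rightarrow> real^('n \<times> 2) \<Rightarrow> real" where
  "avg u g x = integral {0..1} (\<lambda>s. g (circ u s x))"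

definition ravg :: "(real^('n::finite \<times> 2) \<Rightarrow> real) \<Rightarrow> real^('n \<times> 2) \<Rightarrow> real" where
  "ravg g x = integral {0..1} (\<lambda>s. g (rot s x))"

lemma continuous_on_circ_line:
  fixes s :: "'a::t2_space \<Rightarrow> real"
  assumes "continuous_on (sphere 0 1) g" "norm u = 1" "norm x = 1" "continuous_on A s"
  shows "continuous_on A (\<lambda>t. g (circ u (s t) x))"
  using assms by (intro continuous_on_compose2[OF assms(1)] continuous_intros) auto

lemma continuous_on_rot_line:
  fixes s :: "'a::t2_space \<Rightarrow> real" and g :: "real^('n::finite \<times> 2) \<Rightarrow> real"
  assumes "continuous_on (sphere 0 1) g" "norm x = 1" "continuous_on A s"
  shows "continuous_on A (\<lambda>t. g (rot (s t) x))"
  using assms by (intro continuous_on_compose2[OF assms(1)] continuous_intros) auto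

lemma continuous_on_avg:
  assumes g: "continuous_on (sphere 0 1) g" and u: "norm u = 1"
  shows "continuous_on (sphere 0 1) (avg u g)"
proof -
  have "continuous_on (sphere 0 1 \<times> cbox 0 1) (\<lambda>(x, s). g (circ u s x))"
    unfolding case_prod_beta
    using u by (intro continuous_on_compose2[OF g] continuous_intros) auto
  from integral_continuous_on_param[OF this] show ?thesis
    by (simp add: avg_def[abs_def])
qed

lemma continuous_on_ravg:
  assumes g: "continuous_on (sphere 0 1) g"
  shows "continuous_on (sphere 0 1) (ravg g)"
proof -
  have "continuous_on (sphere 0 1 \<times> cbox 0 1) (\<lambda>(x, s). g (rot s x))"
    unfolding case_prod_beta
    by (intro continuous_on_compose2[OF g] continuous_intros) auto
  from integral_continuous_on_param[OF this] show ?thesis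
    by (simp add: ravg_def[abs_def])
qed

lemma avg_diff_le:
  assumes "continuous_on (sphere 0 1) f" "continuous_on (sphere 0 1) g" "norm u = 1" "norm x = 1"
    and "\<And>y. norm y = 1 \<Longrightarrow> \<bar>f y - g y\<bar> \<le> \<epsilon>"
  shows "\<bar>avg u f x - avg u g x\<bar> \<le> \<epsilon>"
  unfolding avg_def
proof (rule integral_diff_le)
  show "continuous_on {0..1} (\<lambda>s. f (circ u s x))" "continuous_on {0..1} (\<lambda>s. g (circ u s x))"
    by (rule continuous_on_circ_line[OF _ assms(3,4) continuous_on_id]; fact)+
qed (use assms in auto)

lemma avg_const_diff_le:
  assumes "continuous_on (sphere 0 1) f" "norm u = 1" "norm x = 1"
    and "\<And>s. \<bar>f (circ u s x) - c\<bar> \<le> \<epsilon>"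
  shows "\<bar>avg u f x - c\<bar> \<le> \<epsilon>"
proof -
  have "\<bar>integral {0..1} (\<lambda>s. f (circ u s x)) - integral {0..1} (\<lambda>_::real. c)\<bar> \<le> \<epsilon>"
    using continuous_on_circ_line[OF assms(1-3) continuous_on_id] assms(4)
    by (intro integral_diff_le) auto
  then show ?thesis by (simp add: avg_def)
qed

lemma ravg_rot:
  assumes "continuous_on (sphere 0 1) g" "norm x = 1"
  shows "ravg g (rot t x) = ravg g x"
  unfolding ravg_def
  using integral_periodic_shift[of "\<lambda>s. g (rot s x)" t] continuous_on_rot_line[OF assms continuous_on_id]
  by (simp flip: rot_add)

lemma avg_circ:
  assumes "continuous_on (sphere 0 1) g" "norm x = 1" "norm u = 1"
  shows "avg u g (circ u t x) = avg u g x"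
  unfolding avg_def
  using integral_periodic_shift[of "\<lambda>s. g (circ u s x)" t]
    continuous_on_circ_line[OF assms(1,3,2) continuous_on_id]
  by (simp add: assms(3) flip: circ_add)

section \<open>Integrals against finite measures on the sphere\<close>

lemma sphere_measure_volume: "sphere_measure sphere_volume"
  by (simp add: sphere_measure_def sets_sphere_volume finite_sphere_volume)

lemma space_sphere_measure: "sphere_measure M \<Longrightarrow> space M = sphere 0 1"
  using sets_eq_imp_space_eq[of M] by (auto simp: sphere_measure_def space_restrict_space)

lemma sphere_measure_borel_measurable:
  fixes g :: "'a::euclidean_space \<Rightarrow> real"
  assumes "sphere_measure M" "continuous_on (sphere 0 1) g"
  shows "g \<in> borel_measurable M"
proof -
  have "sets M = sets (restrict_space borel (sphere 0 1))" using assms(1) by (simp add: sphere_measure_def)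
  with borel_measurable_continuous_on_restrict[OF assms(2)] show ?thesis
    by (metis measurable_cong_sets)
qed

lemma sphere_measure_integrable:
  fixes g :: "'a::euclidean_space \<Rightarrow> real"
  assumes "sphere_measure M" "continuous_on (sphere 0 1) g"
  shows "integrable M g"
proof -
  interpret finite_measure M using assms by (simp add: sphere_measure_def)
  obtain B where "\<And>x. norm x = 1 \<Longrightarrow> \<bar>g x\<bar> \<le> B" using sphere_bounded[OF assms(2)] by blast
  then show ?thesis
    using assms by (intro integrable_const_bound[of _ B] sphere_measure_borel_measurable AE_I2)
      (auto simp: space_sphere_measure)
qed

lemma sphere_measure_integral_diff_le:
  fixes f g :: "'a::euclidean_space \<Rightarrow> real"
  assumes M: "sphere_measure M" and cont: "continuous_on (sphere 0 1) f" "continuous_on (sphere 0 1) g"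
    and le: "\<And>x. norm x = 1 \<Longrightarrow> \<bar>f x - g x\<bar> \<le> \<epsilon>"
  shows "\<bar>(\<integral>x. f x \<partial>M) - (\<integral>x. g x \<partial>M)\<bar> \<le> \<epsilon> * measure M (space M)"
proof -
  interpret finite_measure M using M by (simp add: sphere_measure_def)
  have int: "integrable M f" "integrable M g" using M cont by (auto intro: sphere_measure_integrable)
  have "\<bar>(\<integral>x. f x \<partial>M) - (\<integral>x. g x \<partial>M)\<bar> = \<bar>\<integral>x. f x - g x \<partial>M\<bar>"
    using int by simp
  also have "\<dots> \<le> (\<integral>x. \<bar>f x - g x\<bar> \<partial>M)" by (rule integral_abs_bound)
  also have "\<dots> \<le> (\<integral>x. \<epsilon> \<partial>M)"
    using int le M by (intro integral_mono) (auto simp: space_sphere_measure)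
  finally show ?thesis by (simp add: mult.commute)
qed

lemma integral_invariant_measure:
  fixes g :: "'a::euclidean_space \<Rightarrow> real"
  assumes "sphere_measure M" "invariant_measure M f" "continuous_on (sphere 0 1) g"
  shows "(\<integral>x. g (f x) \<partial>M) = (\<integral>x. g x \<partial>M)"
proof -
  have "(\<integral>x. g x \<partial>distr M M f) = (\<integral>x. g (f x) \<partial>M)"
    using assms by (intro integral_distr sphere_measure_borel_measurable) (auto simp: invariant_measure_def)
  then show ?thesis using assms(2) by (simp add: invariant_measure_def)
qed

lemma invariant_measure_compose:
  assumes "invariant_measure M f" "invariant_measure M g"
  shows "invariant_measure M (f \<circ> g)"
  using assms unfolding invariant_measure_def
  by (auto simp flip: distr_distr[of f M M g M])

lemma sphere_measure_distr:
  assumes "sphere_measure M" "f \<in> measurable M M"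
  shows "sphere_measure (distr M M f)"
  using assms by (auto simp: sphere_measure_def intro: finite_measure.finite_measure_distr)

lemma sphere_measure_eqI:
  assumes "sphere_measure M" "sphere_measure (N :: 'a::euclidean_space measure)"
    and "\<And>g :: 'a \<Rightarrow> real. continuous_on UNIV g \<Longrightarrow> (\<integral>x. g x \<partial>M) = (\<integral>x. g x \<partial>N)"
  shows "M = N"
proof -
  obtain e :: "nat \<Rightarrow> 'a \<Rightarrow> real" where c: "\<And>j. continuous_on UNIV (e j)"
    and e: "\<And>M N. \<lbrakk>sphere_measure M; sphere_measure N; \<And>j. (\<integral>x. e j x \<partial>M) = (\<integral>x. e j x \<partial>N)\<rbrakk> \<Longrightarrow> M = N"
    using determining_functions by blast
  show ?thesis by (rule e[OF assms(1,2) assms(3)[OF c]])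
qed

lemma invariant_measureI:
  assumes M: "sphere_measure (M :: 'a::euclidean_space measure)"
    and f: "continuous_on (sphere 0 1) f" "f \<in> sphere 0 1 \<rightarrow> sphere 0 1"
    and inv: "\<And>g :: 'a \<Rightarrow> real. continuous_on UNIV g \<Longrightarrow> (\<integral>x. g (f x) \<partial>M) = (\<integral>x. g x \<partial>M)"
  shows "invariant_measure M f"
proof -
  have meas: "f \<in> measurable M M"
    using M f by (intro measurable_sphere_cont) (auto simp: sphere_measure_def)
  have "distr M M f = M"
  proof (rule sphere_measure_eqI[OF sphere_measure_distr[OF M meas] M])
    fix g :: "'a \<Rightarrow> real" assume g: "continuous_on UNIV g"
    have "(\<integral>x. g x \<partial>distr M M f) = (\<integral>x. g (f x) \<partial>M)"
      using M meas g by (intro integral_distr sphere_measure_borel_measurable)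
        (auto intro: continuous_on_subset)
    then show "(\<integral>x. g x \<partial>distr M M f) = (\<integral>x. g x \<partial>M)" using inv[OF g] by simp
  qed
  with meas show ?thesis by (simp add: invariant_measure_def)
qed

text \<open>Since the angle is constant along the orbits of \<open>circ u\<close>, averaging over rotations by
  \<open>b / N\<close> reduces the claim to Riemann sums; no Jacobian has to be computed.\<close>

lemma integral_circ_eq_avg:
  assumes M: "sphere_measure M" and u: "norm u = 1"
    and inv: "\<And>r. invariant_measure M (circ u r)"
    and s: "continuous_on (sphere 0 1) s" "\<And>r x. norm x = 1 \<Longrightarrow> s (circ u r x) = s x"
    and g: "continuous_on (sphere 0 1) g"
  shows "(\<integral>x. g (circ u (s x) x) \<partial>M) = (\<integral>x. avg u g x \<partial>M)"
proof -
  \<comment> \<open>The additional 1 allows for a measure of total mass 0.\<close>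
  define V where "V = measure M (space M) + 1"
  have V: "V > 0" unfolding V_def by (simp add: add_nonneg_pos)
  have cont: "continuous_on (sphere 0 1) (\<lambda>x. g (circ u (s x + c) x))" for c
    using s(1) u by (intro continuous_on_compose2[OF g] continuous_intros) auto
  have "\<bar>(\<integral>x. g (circ u (s x) x) \<partial>M) - (\<integral>x. avg u g x \<partial>M)\<bar> \<le> \<epsilon>" if "\<epsilon> > 0" for \<epsilon>
  proof -
    have "\<epsilon> / V > 0" using \<open>\<epsilon> > 0\<close> V by simp
    then obtain \<delta> where \<delta>: "\<delta> > 0" "\<And>x s t. norm x = 1 \<Longrightarrow> \<bar>s - t\<bar> \<le> \<delta> \<Longrightarrow>
        \<bar>g (circ u s x) - g (circ u t x)\<bar> \<le> \<epsilon> / V"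
      using circ_uniform[OF g _ u] by blast
    obtain N :: nat where N: "N \<ge> 1" "1 / real N \<le> \<delta>"
    proof -
      obtain N where "inverse (real (Suc N)) < \<delta>" using reals_Archimedean[OF \<delta>(1)] by blast
      then show thesis by (intro that[of "Suc N"]) (auto simp: inverse_eq_divide)
    qed
    \<comment> \<open>Substituting \<open>circ u (real b / real N) x\<close> for \<open>x\<close>
      preserves \<open>M\<close> and the value of \<open>s\<close>, so it only adds
      \<open>real b / real N\<close> to the angle.\<close>
    have "(\<integral>x. g (circ u (s x) x) \<partial>M) = (\<integral>x. g (circ u (s x + real b / real N) x) \<partial>M)" for b
    proof -
      have "(\<integral>x. g (circ u (s x + 0) x) \<partial>M)
          = (\<integral>x. g (circ u (s (circ u (real b / real N) x) + 0) (circ u (real b / real N) x)) \<partial>M)"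
        by (rule integral_invariant_measure[OF M inv cont, symmetric])
      also have "\<dots> = (\<integral>x. g (circ u (s x + real b / real N) x) \<partial>M)"
        using M by (intro Bochner_Integration.integral_cong refl)
          (simp add: space_sphere_measure s(2) circ_add[OF u])
      finally show ?thesis by simp
    qed
    then have "real N * (\<integral>x. g (circ u (s x) x) \<partial>M) = (\<Sum>b<N. \<integral>x. g (circ u (s x + real b / real N) x) \<partial>M)"
      by simp
    also have "\<dots> = (\<integral>x. (\<Sum>b<N. g (circ u (s x + real b / real N) x)) \<partial>M)"
      using M cont by (intro Bochner_Integration.integral_sum[symmetric] sphere_measure_integrable)
    finally have "(\<integral>x. g (circ u (s x) x) \<partial>M) = (\<integral>x. (\<Sum>b<N. g (circ u (s x + real b / real N) x)) / real N \<partial>M)"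
      using N by (simp add: field_simps)
    also have "\<bar>\<dots> - (\<integral>x. avg u g x \<partial>M)\<bar> \<le> \<epsilon> / V * measure M (space M)"
    proof (rule sphere_measure_integral_diff_le[OF M])
      show "continuous_on (sphere 0 1) (\<lambda>x. (\<Sum>b<N. g (circ u (s x + real b / real N) x)) / real N)"
        using N by (intro continuous_on_divide continuous_on_sum cont continuous_on_const) auto
      show "continuous_on (sphere 0 1) (avg u g)" by (rule continuous_on_avg[OF g u])
      fix x :: "real^('a \<times> 2)" assume x: "norm x = 1"
      show "\<bar>(\<Sum>b<N. g (circ u (s x + real b / real N) x)) / real N - avg u g x\<bar> \<le> \<epsilon> / V"
        unfolding avg_def
      proof (rule riemann_sum_periodic[where g = "\<lambda>r. g (circ u r x)"])
        show "continuous_on UNIV (\<lambda>r. g (circ u r x))"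
          by (rule continuous_on_circ_line[OF g u x continuous_on_id])
        show "\<bar>g (circ u r x) - g (circ u r' x)\<bar> \<le> \<epsilon> / V" if "\<bar>r - r'\<bar> \<le> 1 / real N" for r r'
          using that N x by (intro \<delta>) auto
      qed (use N in auto)
    qed
    also have "\<epsilon> / V * measure M (space M) \<le> \<epsilon> / V * V"
      using \<open>\<epsilon> > 0\<close> V by (intro mult_left_mono) (auto simp: V_def)
    also have "\<dots> = \<epsilon>" using V by simp
    finally show ?thesis .
  qed
  \<comment> \<open>A nonzero difference would be at most half of itself.\<close>
  from this[of "\<bar>(\<integral>x. g (circ u (s x) x) \<partial>M) - (\<integral>x. avg u g x \<partial>M)\<bar> / 2"] show ?thesis by fastforce
qed

text \<open>The integral does not depend on the angle function: \<open>s\<close> and the constant 0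
  both give the integral of \<open>avg u g\<close>.\<close>

lemma invariant_measure_circ:
  assumes M: "sphere_measure M" and u: "norm u = 1"
    and inv: "\<And>r. invariant_measure M (circ u r)"
    and s: "continuous_on (sphere 0 1) s" "\<And>r x. norm x = 1 \<Longrightarrow> s (circ u r x) = s x"
  shows "invariant_measure M (\<lambda>x. circ u (s x) x)"
proof (rule invariant_measureI[OF M])
  show "continuous_on (sphere 0 1) (\<lambda>x. circ u (s x) x)"
    using s(1) by (intro continuous_intros)
  show "(\<lambda>x. circ u (s x) x) \<in> sphere 0 1 \<rightarrow> sphere 0 1" using u by auto
  fix g :: "real^('a \<times> 2) \<Rightarrow> real" assume "continuous_on UNIV g"
  then have g: "continuous_on (sphere 0 1) g" by (rule continuous_on_subset) auto
  show "(\<integral>x. g (circ u (s x) x) \<partial>M) = (\<integral>x. g x \<partial>M)"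
    using integral_circ_eq_avg[OF M u inv s g] integral_circ_eq_avg[OF M u inv _ _ g, of "\<lambda>_. 0"]
    by simp
qed

subsection \<open>Twists\<close>

definition wave :: "real^('n::finite \<times> 2) \<Rightarrow> 'n \<Rightarrow> real^('n \<times> 2) \<Rightarrow> complex" where
  "wave u k x = Complex (perp u x $ (k, 1)) (perp u x $ (k, 2))"

text \<open>The real part of a power is not holomorphic. With \<open>\<sigma> = \<i>\<close> this
  extends \<open>wave u k\<close>, with \<open>\<sigma> = - \<i>\<close> its complex conjugate, and
  half the sum of the two \<open>Q\<close>-th powers extends
  \<open>Re (wave u k x ^ Q)\<close>.\<close>

definition cwave :: "complex \<Rightarrow> real^('n::finite \<times> 2) \<Rightarrow> 'n \<Rightarrow> complex^('n \<times> 2) \<Rightarrow> complex" where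
  "cwave \<sigma> u k z = perp (cvec u) z $ (k, 1) + \<sigma> * perp (cvec u) z $ (k, 2)"

definition cangle :: "real^('n::finite \<times> 2) \<Rightarrow> 'n \<Rightarrow> nat \<Rightarrow> complex^('n \<times> 2) \<Rightarrow> complex" where
  "cangle u k Q z = (cwave \<i> u k z ^ Q + cwave (- \<i>) u k z ^ Q) / 2"

definition twist :: "real^('n::finite \<times> 2) \<Rightarrow> 'n \<Rightarrow> nat \<Rightarrow> real \<Rightarrow> real^('n \<times> 2) \<Rightarrow> real^('n \<times> 2)" where
  "twist u k Q A x = circ u (A * Re (wave u k x ^ Q)) x"

definition ctwist :: "real^('n::finite \<times> 2) \<Rightarrow> 'n \<Rightarrow> nat \<Rightarrow> real \<Rightarrow> complex^('n \<times> 2) \<Rightarrow> complex^('n \<times> 2)" where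
  "ctwist u k Q A z = plane_rot (cvec u)
     (cos (of_real (2 * pi * A) * cangle u k Q z)) (sin (of_real (2 * pi * A) * cangle u k Q z)) z"

lemma wave_circ: "norm u = 1 \<Longrightarrow> wave u k (circ u s x) = wave u k x"
  by (simp add: wave_def perp_circ)

lemma wave_rot: "wave u k (rot t x) = cis (- 2 * pi * t) * wave u k x"
  by (simp add: wave_def perp_rot rot_nth complex_eq_iff algebra_simps)

lemma cwave_rot:
  "cwave \<i> u k (rot t z) = cis (- 2 * pi * t) * cwave \<i> u k z"
  "cwave (- \<i>) u k (rot t z) = cis (2 * pi * t) * cwave (- \<i>) u k z"
proof -
  have cis: "cis a = of_real (cos a) + \<i> * of_real (sin a)" for a by (simp add: complex_eq_iff)
  have ii: "\<i> * (\<i> * x) = - x" for x by (simp flip: mult.assoc)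
  show "cwave \<i> u k (rot t z) = cis (- 2 * pi * t) * cwave \<i> u k z"
    "cwave (- \<i>) u k (rot t z) = cis (2 * pi * t) * cwave (- \<i>) u k z"
    by (simp_all add: cwave_def perp_rot rot_nth scaleR_conv_of_real cis)
      (simp_all add: algebra_simps ii)
qed

lemma cangle_cvec: "cangle u k Q (cvec x) = of_real (Re (wave u k x ^ Q))"
proof -
  have "cwave \<i> u k (cvec x) = wave u k x" "cwave (- \<i>) u k (cvec x) = cnj (wave u k x)"
    by (auto simp: cwave_def wave_def complex_eq_iff simp flip: cvec_perp)
  then show ?thesis by (simp add: cangle_def complex_add_cnj flip: complex_cnj_power)
qed

text \<open>The two extended coordinates turn with opposite phases under \<open>rot\<close>; for the
  time \<open>1 / real q\<close> both phases are \<open>q\<close>-th roots of unity and disappear in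
  the \<open>Q\<close>-th powers. As an identity on the whole complex space it makes the extended
  twist commute with the rational rotation.\<close>

lemma cangle_rot:
  assumes "q \<ge> 1" "q dvd Q"
  shows "cangle u k Q (rot (1 / real q) z) = cangle u k Q z"
proof -
  obtain m where m: "Q = q * m" using assms by blast
  have pow: "cis a ^ Q = 1" if "real Q * a = 2 * pi * c" "c \<in> \<int>" for a c
    using Complex.DeMoivre[of a Q] cis_multiple_2pi[OF that(2)] unfolding that(1) by (rule trans)
  have "cis (2 * pi * (1 / real q)) ^ Q = 1"
    by (rule pow[of _ "real m"]) (use assms(1) in \<open>simp_all add: m\<close>)
  moreover have "cis (- 2 * pi * (1 / real q)) ^ Q = 1"
    by (rule pow[of _ "- real m"]) (use assms(1) in \<open>simp_all add: m\<close>)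
  ultimately show ?thesis by (simp only: cangle_def cwave_rot power_mult_distrib mult_1)
qed

lemma cangle_plane_rot:
  assumes "norm u = 1"
  shows "cangle u k Q (plane_rot (cvec u) c s z) = cangle u k Q z"
proof -
  have "dot (cvec u) (cvec u) = 1" using dot_unit[OF assms] by (simp add: dot_cvec)
  then show ?thesis by (simp add: cangle_def cwave_def perp_plane_rot)
qed

lemma ctwist_cvec: "ctwist u k Q A (cvec x) = cvec (twist u k Q A x)"
  by (simp add: ctwist_def twist_def circ_def cangle_cvec cvec_plane_rot cos_of_real sin_of_real mult_ac
      flip: of_real_mult)

text \<open>The first twist leaves the complex angle unchanged, so the second turns back by exactly
  the same angle. The composition rule for \<open>plane_rot\<close> is algebraic, and cos^2 + sin^2
  = 1 holds for complex arguments too.\<close>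

lemma ctwist_minus:
  assumes "norm u = 1"
  shows "ctwist u k Q (- A) (ctwist u k Q A z) = z"
proof -
  have u: "dot (cvec u) (cvec u) = 1" using dot_unit[OF assms] by (simp add: dot_cvec)
  show ?thesis
    by (simp add: ctwist_def cangle_plane_rot[OF assms] plane_rot_compose[OF u] algebra_simps
        flip: power2_eq_square)
qed

lemma ctwist_rot:
  assumes "q \<ge> 1" "q dvd Q"
  shows "ctwist u k Q A (rot (1 / real q) z) = rot (1 / real q) (ctwist u k Q A z)"
  by (simp add: ctwist_def cangle_rot[OF assms] plane_rot_rot)

lemma holomorphic_cn_dot: "holomorphic_cn_on (\<lambda>z. dot z v) U"
  unfolding dot_def
  by (rule holomorphic_cn_sum) (rule holomorphic_cn_mult[OF holomorphic_cn_nth holomorphic_cn_const])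

lemma holomorphic_cn_perp: "holomorphic_cn_on (\<lambda>z. perp v z $ i) U"
  unfolding perp_def vector_minus_component vector_smult_component
  by (intro holomorphic_cn_diff holomorphic_cn_mult holomorphic_cn_dot holomorphic_cn_nth holomorphic_cn_const)

lemma entire_plane_rot:
  assumes "holomorphic_cn_on c UNIV" "holomorphic_cn_on s UNIV"
  shows "entire_vec (\<lambda>z. plane_rot v (c z) (s z) z)"
  unfolding entire_vec_def plane_rot_def vector_add_component vector_smult_component
  by (intro allI holomorphic_cn_add holomorphic_cn_diff holomorphic_cn_mult holomorphic_cn_dot
      holomorphic_cn_nth holomorphic_cn_const assms)

lemma entire_ctwist: "entire_vec (ctwist u k Q A)"
proof -
  have wave: "holomorphic_cn_on (cwave \<sigma> u k) UNIV" for \<sigma>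
    unfolding cwave_def[abs_def]
    by (intro holomorphic_cn_add holomorphic_cn_mult holomorphic_cn_const holomorphic_cn_perp)
  have "holomorphic_cn_on (\<lambda>z. (cwave \<i> u k z ^ Q + cwave (- \<i>) u k z ^ Q) * (1 / 2)) UNIV"
    by (intro holomorphic_cn_add holomorphic_cn_mult holomorphic_cn_const holomorphic_cn_power wave)
  then have "holomorphic_cn_on (cangle u k Q) UNIV" by (simp add: cangle_def[abs_def])
  then have angle: "holomorphic_cn_on (\<lambda>z. of_real (2 * pi * A) * cangle u k Q z) UNIV"
    by (rule holomorphic_cn_mult[OF holomorphic_cn_const])
  show ?thesis
    unfolding ctwist_def[abs_def]
    by (rule entire_plane_rot[OF holomorphic_cn_compose_field[OF angle DERIV_cos]
          holomorphic_cn_compose_field[OF angle DERIV_sin]])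
qed

lemma continuous_on_wave: "continuous_on A (wave u k)"
proof -
  have "wave u k = (\<lambda>x. of_real (perp u x $ (k, 1)) + \<i> * of_real (perp u x $ (k, 2)))"
    by (auto simp: wave_def complex_eq_iff)
  then show ?thesis by (auto intro!: continuous_intros)
qed

lemma invariant_measure_twist:
  assumes u: "norm u = 1"
  shows "invariant_measure sphere_volume (twist u k Q A)"
  unfolding twist_def[abs_def]
proof (rule invariant_measure_circ[OF sphere_measure_volume u])
  show "continuous_on (sphere 0 1) (\<lambda>x. A * Re (wave u k x ^ Q))"
    by (intro continuous_intros continuous_on_wave)
qed (use u in \<open>auto simp: wave_circ intro: invariant_sphere_volume_orthogonal orthogonal_transformation_circ\<close>)

text \<open>The extensions \<open>G\<close> and \<open>G'\<close> have to be inverse to each other on the whole complex space: the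
  extension of a conjugate of \<open>rot\<close> must not change when a factor commuting with \<open>rot\<close> is added.\<close>

definition entire_symmetry :: "(real^'m::finite \<Rightarrow> real^'m) \<Rightarrow> (real^'m \<Rightarrow> real^'m) \<Rightarrow>
    (complex^'m \<Rightarrow> complex^'m) \<Rightarrow> (complex^'m \<Rightarrow> complex^'m) \<Rightarrow> bool" where
  "entire_symmetry h h' G G' \<longleftrightarrow> entire_vec G \<and> entire_vec G' \<and>
     (\<forall>z. G (G' z) = z) \<and> (\<forall>z. G' (G z) = z) \<and>
     (\<forall>x. G (cvec x) = cvec (h x)) \<and> (\<forall>x. G' (cvec x) = cvec (h' x)) \<and>
     (\<forall>x. norm (h x) = norm x) \<and> invariant_measure sphere_volume h"

lemma entire_symmetry_id: "entire_symmetry id id id id"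
proof -
  have "entire_vec (id :: complex^'a \<Rightarrow> complex^'a)"
    by (simp add: entire_vec_def holomorphic_cn_nth)
  moreover have "invariant_measure sphere_volume (id :: real^'a \<Rightarrow> real^'a)"
    by (simp add: invariant_measure_def id_def distr_id)
  ultimately show ?thesis by (simp add: entire_symmetry_def)
qed

lemma entire_symmetry_compose:
  assumes "entire_symmetry h h' G G'" "entire_symmetry k k' L L'"
  shows "entire_symmetry (h \<circ> k) (k' \<circ> h') (G \<circ> L) (L' \<circ> G')"
  using assms unfolding entire_symmetry_def
  by (simp add: entire_vec_compose invariant_measure_compose)

lemma entire_symmetry_twist:
  assumes "norm u = 1"
  shows "entire_symmetry (twist u k Q A) (twist u k Q (- A)) (ctwist u k Q A) (ctwist u k Q (- A))"
  using assms ctwist_minus[OF assms, of k Q "- A"]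
  by (simp add: entire_symmetry_def entire_ctwist ctwist_minus ctwist_cvec invariant_measure_twist)
    (simp add: twist_def)

lemma entire_symmetryD:
  assumes "entire_symmetry h h' G G'"
  shows "h (h' x) = x" "h' (h x) = x" "norm (h x) = norm x" "norm (h' x) = norm x"
    "continuous_on A h" "continuous_on A h'"
proof -
  have *: "G (cvec x) = cvec (h x)" "G' (cvec x) = cvec (h' x)" "norm (h x) = norm x" for x
    using assms unfolding entire_symmetry_def by blast+
  have "G (G' z) = z" "G' (G z) = z" for z
    using assms unfolding entire_symmetry_def by blast+
  then have "cvec (h (h' x)) = cvec x" "cvec (h' (h x)) = cvec x"
    unfolding *(1,2)[symmetric] by blast+
  then show 1: "h (h' x) = x" "h' (h x) = x" by simp_all
  show "norm (h x) = norm x" by (rule *)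
  show "norm (h' x) = norm x" using *(3)[of "h' x"] 1 by simp
  have lip: "dist (h x) (h y) = dist (G (cvec x)) (G (cvec y))" "dist (h' x) (h' y) = dist (G' (cvec x)) (G' (cvec y))" for x y
    by (simp_all add: * dist_norm norm_cvec_diff)
  have "continuous_on A (\<lambda>x. G (cvec x))" "continuous_on A (\<lambda>x. G' (cvec x))"
    by (rule continuous_on_compose2[OF entire_vec_continuous[where A = UNIV]
        linear_continuous_on[OF bounded_linear_cvec]];
        use assms in \<open>simp add: entire_symmetry_def\<close>)+
  then show "continuous_on A h" "continuous_on A h'"
    by (auto simp: continuous_on_iff lip)
qed

text \<open>An approximation of \<open>ravg (K \<circ> twist u k Q A)\<close>, with \<open>L\<close>
  in the role of \<open>ravg K\<close>: the phase of \<open>wave u k x ^ Q\<close>, which turns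
  \<open>Q\<close> times along one orbit of \<open>rot\<close>, becomes an independent variable
  \<open>\<tau>\<close>. \<open>Q\<close> remains because it determines the amplitude.\<close>

definition wavg :: "real^('n::finite \<times> 2) \<Rightarrow> 'n \<Rightarrow> nat \<Rightarrow> real \<Rightarrow> (real^('n \<times> 2) \<Rightarrow> real) \<Rightarrow> real^('n \<times> 2) \<Rightarrow> real" where
  "wavg u k Q A L x =
     integral {0..1} (\<lambda>\<tau>. L (circ u (A * Re (cis (- 2 * pi * \<tau>) * wave u k x ^ Q)) x))"

lemma continuous_on_wave_angle [continuous_intros]:
  fixes \<tau> :: "'b::t2_space \<Rightarrow> real"
  assumes "continuous_on X \<tau>" "continuous_on X f"
  shows "continuous_on X (\<lambda>y. A * Re (cis (- 2 * pi * \<tau> y) * wave u k (f y) ^ Q))"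
  unfolding cis_conv_exp
  using assms by (intro continuous_intros continuous_on_compose2[OF continuous_on_wave[of UNIV]]) auto

lemma wave_angle_periodic: "Re (cis (- 2 * pi * (\<tau> + 1)) * w) = Re (cis (- 2 * pi * \<tau>) * w)"
proof -
  have "- 2 * pi * (\<tau> + 1) = - (2 * pi * \<tau> + 2 * pi)" "- 2 * pi * \<tau> = - (2 * pi * \<tau>)"
    by (simp_all add: ring_distribs)
  then have "cis (- 2 * pi * (\<tau> + 1)) = cis (- 2 * pi * \<tau>)"
    by (simp only: complex_eq_iff cis.simps cos_minus sin_minus cos_periodic sin_periodic)
  then show ?thesis by simp
qed

lemma exists_large_nat:
  assumes "(\<delta>::real) > 0"
  obtains N :: nat where "N \<ge> 1" "\<And>M. M \<ge> N \<Longrightarrow> 1 / real M \<le> \<delta>"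
proof -
  obtain n where n: "inverse (real (Suc n)) < \<delta>" using reals_Archimedean[OF assms] by blast
  show thesis
  proof (rule that[of "Suc n"])
    fix M assume "Suc n \<le> M"
    then have "1 / real M \<le> 1 / real (Suc n)" by (intro divide_left_mono) auto
    with n show "1 / real M \<le> \<delta>" by (simp add: inverse_eq_divide)
  qed simp
qed

text \<open>The twist oscillates with frequency \<open>Q\<close> along the orbits of \<open>rot\<close>; if \<open>Q\<close> is large
  compared with the modulus of continuity of \<open>K\<close>, the two time scales separate, for every \<open>A\<close>.\<close>

lemma ravg_twist:
  fixes K :: "real^('n::finite \<times> 2) \<Rightarrow> real"
  assumes K: "continuous_on (sphere 0 1) K" and "\<epsilon> > 0"
  obtains Q\<^sub>0 where "Q\<^sub>0 \<ge> 1" "\<And>Q A u k x. \<lbrakk>Q \<ge> Q\<^sub>0; norm u = 1; norm x = 1\<rbrakk> \<Longrightarrow>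
    \<bar>ravg (K \<circ> twist u k Q A) x - wavg u k Q A (ravg K) x\<bar> \<le> \<epsilon>"
proof -
  obtain \<delta> where \<delta>: "\<delta> > 0" "\<And>x s t. norm x = 1 \<Longrightarrow> \<bar>s - t\<bar> \<le> \<delta> \<Longrightarrow> \<bar>K (rot s x) - K (rot t x)\<bar> \<le> \<epsilon>"
    using rot_uniform[OF assms] by blast
  obtain Q\<^sub>0 where Q\<^sub>0: "Q\<^sub>0 \<ge> 1" "\<And>M. M \<ge> Q\<^sub>0 \<Longrightarrow> 1 / real M \<le> \<delta>"
    using exists_large_nat[OF \<delta>(1)] by blast
  show thesis
  proof (rule that[OF Q\<^sub>0(1)])
    fix Q A k and u x :: "real^('n \<times> 2)"
    assume Q: "Q \<ge> Q\<^sub>0" and u: "norm u = 1" and x: "norm x = 1"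
    define \<sigma> where "\<sigma> \<tau> = A * Re (cis (- 2 * pi * \<tau>) * wave u k x ^ Q)" for \<tau>
    have \<sigma>_per: "\<sigma> (\<tau> + 1) = \<sigma> \<tau>" for \<tau> by (simp only: \<sigma>_def wave_angle_periodic)
    have \<sigma>_cont: "continuous_on X (\<lambda>t. \<sigma> (real Q * t + c))" for X c
      unfolding \<sigma>_def by (intro continuous_intros)
    \<comment> \<open>As \<open>circ u\<close> and \<open>rot\<close> commute, the twisted orbit is
      \<open>rot t (y t)\<close>, where \<open>y\<close> is the fast part, with period
      \<open>1 / real Q\<close>.\<close>
    define y where "y t = circ u (\<sigma> (real Q * t)) x" for t
    have y: "norm (y t) = 1" for t using u x by (simp add: y_def)
    have y_cont: "continuous_on X y" for X
      unfolding y_def using \<sigma>_cont[of X 0] by (intro continuous_intros) simp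
    have y_shift: "y (t + real l / real Q) = y t" for t l
      using Q Q\<^sub>0 periodic_of_nat[of \<sigma>, OF \<sigma>_per] by (simp add: y_def distrib_left)
    have f_cont: "continuous_on X (\<lambda>t. K (rot (t + c) (y t)))" for X c
      by (intro continuous_on_compose2[OF K] continuous_intros y_cont) (auto simp: y)
    have "(cis (- 2 * pi * t) * w) ^ Q = cis (- 2 * pi * (real Q * t)) * w ^ Q" for t w
      by (simp only: power_mult_distrib Complex.DeMoivre mult.left_commute)
    then have tw: "(K \<circ> twist u k Q A) (rot t x) = K (rot (t + 0) (y t))" for t
      by (simp only: twist_def wave_rot circ_rot y_def \<sigma>_def o_apply add_0_right)
    have "ravg (K \<circ> twist u k Q A) x = integral {0..1} (\<lambda>t. K (rot (t + 0) (y t)))"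
      unfolding ravg_def tw ..
    \<comment> \<open>A shift of time by \<open>real l / real Q\<close> does not affect
      \<open>y\<close>, so the integral may be averaged over \<open>l\<close>; the inner sum becomes
      a Riemann sum for \<open>ravg K (y t)\<close>.\<close>
    moreover have "integral {0..1} (\<lambda>t. K (rot (t + real l / real Q) (y t)))
        = integral {0..1} (\<lambda>t. K (rot (t + 0) (y t)))" for l
    proof -
      have "y (t + 1) = y t" for t using y_shift[of t Q] Q Q\<^sub>0(1) by simp
      then show ?thesis
        using integral_periodic_shift[of "\<lambda>t. K (rot (t + 0) (y t))" "real l / real Q", OF f_cont]
        by (simp add: y_shift)
    qed
    ultimately have "real Q * ravg (K \<circ> twist u k Q A) x
        = (\<Sum>l<Q. integral {0..1} (\<lambda>t. K (rot (t + real l / real Q) (y t))))"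
      by simp
    also have "\<dots> = integral {0..1} (\<lambda>t. \<Sum>l<Q. K (rot (t + real l / real Q) (y t)))"
      by (intro Henstock_Kurzweil_Integration.integral_sum[symmetric] integrable_continuous_real f_cont) simp
    also have "\<dots> = real Q * integral {0..1} (\<lambda>t. (\<Sum>l<Q. K (rot (t + real l / real Q) (y t))) / real Q)"
      using Q Q\<^sub>0(1) by simp
    finally have 1: "ravg (K \<circ> twist u k Q A) x
        = integral {0..1} (\<lambda>t. (\<Sum>l<Q. K (rot (t + real l / real Q) (y t))) / real Q)"
      using Q Q\<^sub>0(1) by (subst (asm) mult_cancel_left) simp
    \<comment> \<open>The fast phase \<open>real Q * t\<close> is exchanged for
      \<open>\<tau>\<close> by the dilation invariance of periodic integrals.\<close>
    have 2: "wavg u k Q A (ravg K) x = integral {0..1} (\<lambda>t. ravg K (y t))"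
    proof -
      have "continuous_on UNIV (\<lambda>\<tau>. ravg K (circ u (\<sigma> \<tau>) x))"
        using \<sigma>_cont[of UNIV 0] u x unfolding \<sigma>_def
        by (intro continuous_on_compose2[OF continuous_on_ravg[OF K]] continuous_intros) auto
      from integral_periodic_scale[OF this, of Q]
      show ?thesis unfolding wavg_def y_def \<sigma>_def[symmetric] using Q Q\<^sub>0(1) \<sigma>_per by simp
    qed
    show "\<bar>ravg (K \<circ> twist u k Q A) x - wavg u k Q A (ravg K) x\<bar> \<le> \<epsilon>"
      unfolding 1 2
    proof (rule integral_diff_le)
      show "continuous_on {0..1} (\<lambda>t. (\<Sum>l<Q. K (rot (t + real l / real Q) (y t))) / real Q)"
        using Q Q\<^sub>0(1) by (intro continuous_on_divide continuous_on_sum f_cont continuous_on_const) auto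
      show "continuous_on {0..1} (\<lambda>t. ravg K (y t))"
        by (intro continuous_on_compose2[OF continuous_on_ravg[OF K] y_cont]) (auto simp: y)
      fix t :: real
      show "\<bar>(\<Sum>l<Q. K (rot (t + real l / real Q) (y t))) / real Q - ravg K (y t)\<bar> \<le> \<epsilon>"
        unfolding ravg_def
      proof (rule riemann_sum_periodic[where g = "\<lambda>s. K (rot s (y t))"])
        show "continuous_on UNIV (\<lambda>s. K (rot s (y t)))"
          by (rule continuous_on_rot_line[OF K y continuous_on_id])
        show "\<bar>K (rot s (y t)) - K (rot s' (y t))\<bar> \<le> \<epsilon>" if "\<bar>s - s'\<bar> \<le> 1 / real Q" for s s'
          using that Q\<^sub>0(2)[OF Q] by (intro \<delta> y) auto
      qed (use Q Q\<^sub>0(1) in auto)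
    qed
  qed
qed

lemma continuous_on_wavg:
  assumes L: "continuous_on (sphere 0 1) L" and u: "norm u = 1"
  shows "continuous_on (sphere 0 1) (wavg u k Q A L)"
proof -
  have "continuous_on (sphere 0 1 \<times> cbox 0 1)
      (\<lambda>(x, \<tau>). L (circ u (A * Re (cis (- 2 * pi * \<tau>) * wave u k x ^ Q)) x))"
    unfolding case_prod_beta
    using u by (intro continuous_on_compose2[OF L] continuous_intros) auto
  from integral_continuous_on_param[OF this] show ?thesis
    by (simp add: wavg_def[abs_def])
qed

lemma wavg_const_diff_le:
  assumes L: "continuous_on (sphere 0 1) L" and u: "norm u = 1" and x: "norm x = 1"
    and le: "\<And>s. \<bar>L (circ u s x) - c\<bar> \<le> \<epsilon>"
  shows "\<bar>wavg u k Q A L x - c\<bar> \<le> \<epsilon>"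
proof -
  have "continuous_on {0..1} (\<lambda>\<tau>. L (circ u (A * Re (cis (- 2 * pi * \<tau>) * wave u k x ^ Q)) x))"
    by (rule continuous_on_circ_line[OF L u x]) (intro continuous_intros)
  then have "\<bar>wavg u k Q A L x - integral {0..1} (\<lambda>_::real. c)\<bar> \<le> \<epsilon>"
    unfolding wavg_def using le by (intro integral_diff_le) auto
  then show ?thesis by simp
qed

text \<open>All angles occurring in \<open>wavg\<close> are constant along the orbits of
  \<open>circ u\<close>, so each is a shift that the average over the circle absorbs once the
  integrals are exchanged. Thus a twist moves the target \<open>avg u\<close> only by the error of
  \<open>ravg_twist\<close>.\<close>

lemma avg_wavg:
  assumes L: "continuous_on (sphere 0 1) L" and u: "norm u = 1" and x: "norm x = 1"
  shows "avg u (wavg u k Q A L) x = avg u L x"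
proof -
  define \<sigma> where "\<sigma> \<tau> = A * Re (cis (- 2 * pi * \<tau>) * wave u k x ^ Q)" for \<tau>
  have "continuous_on (cbox (0, 0) (1, 1)) (\<lambda>(r, \<tau>). L (circ u (\<sigma> \<tau> + r) x))"
    unfolding \<sigma>_def case_prod_beta
    by (intro continuous_on_circ_line[OF L u x] continuous_intros)
  note swap = integral_swap_continuous[OF this]
  have "avg u (wavg u k Q A L) x = integral {0..1} (\<lambda>r. integral {0..1} (\<lambda>\<tau>. L (circ u (\<sigma> \<tau> + r) x)))"
    by (simp add: avg_def wavg_def wave_circ[OF u] circ_add[OF u] \<sigma>_def)
  also have "\<dots> = integral {0..1} (\<lambda>\<tau>. integral {0..1} (\<lambda>r. L (circ u (\<sigma> \<tau> + r) x)))"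
    using swap by simp
  also have "(\<lambda>\<tau>. integral {0..1} (\<lambda>r. L (circ u (\<sigma> \<tau> + r) x))) = (\<lambda>_. avg u L x)"
  proof
    fix \<tau>
    show "integral {0..1} (\<lambda>r. L (circ u (\<sigma> \<tau> + r) x)) = avg u L x"
      using integral_periodic_shift[of "\<lambda>s. L (circ u s x)" "\<sigma> \<tau>"]
        continuous_on_circ_line[OF L u x continuous_on_id]
      by (simp add: avg_def add.commute)
  qed
  finally show ?thesis by simp
qed

text \<open>For fixed \<open>x\<close> the angle is a shifted cosine of amplitude
  \<open>A * cmod (wave u k x) ^ Q\<close>. \<open>A\<close> raises this amplitude to
  \<open>R\<^sub>0\<close> wherever the coordinate is at least \<open>\<delta>\<close>. Since
  \<open>A\<close> depends on \<open>Q\<close>, the approximation by \<open>wavg\<close> had to be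
  uniform in \<open>A\<close>.\<close>

lemma wavg_equidistributed:
  assumes L: "continuous_on (sphere 0 1) L" and u: "norm u = 1" and "\<delta> > 0" "\<epsilon> > 0"
  obtains A where "\<And>x. norm x = 1 \<Longrightarrow> cmod (wave u k x) \<ge> \<delta> \<Longrightarrow> \<bar>wavg u k Q A L x - avg u L x\<bar> \<le> \<epsilon>"
proof -
  obtain B where B: "B \<ge> 0" "\<And>x. norm x = 1 \<Longrightarrow> \<bar>L x\<bar> \<le> B" using sphere_bounded[OF L] by blast
  obtain R\<^sub>0 where R\<^sub>0: "R\<^sub>0 > 0" "\<And>(g :: real \<Rightarrow> real) R c. \<lbrakk>continuous_on UNIV g; \<And>x. g (x + 1) = g x;
    \<And>x. \<bar>g x\<bar> \<le> B; R \<ge> R\<^sub>0\<rbrakk> \<Longrightarrow>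
    \<bar>integral {0..1} (\<lambda>t. g (R * cos (2 * pi * (t + c)))) - integral {0..1} g\<bar> \<le> \<epsilon>"
    using integral_cos_equidistributed[OF \<open>\<epsilon> > 0\<close> B(1)] by blast
  define A where "A = R\<^sub>0 / \<delta> ^ Q"
  have A: "A > 0" using R\<^sub>0 \<open>\<delta> > 0\<close> by (simp add: A_def)
  show thesis
  proof (rule that[of A])
    fix x :: "real^('a \<times> 2)" assume x: "norm x = 1" and wx: "cmod (wave u k x) \<ge> \<delta>"
    define w where "w = wave u k x ^ Q"
    have angle: "A * Re (cis (- 2 * pi * \<tau>) * w) = A * cmod w * cos (2 * pi * (\<tau> + - Arg w / (2 * pi)))" for \<tau>
    proof -
      have "cis (- 2 * pi * \<tau>) * w = cis (- 2 * pi * \<tau>) * (of_real (cmod w) * cis (Arg w))"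
        by (simp add: rcis_cmod_Arg flip: rcis_def)
      also have "\<dots> = of_real (cmod w) * cis (- (2 * pi * (\<tau> + - Arg w / (2 * pi))))"
        by (simp add: cis_mult mult_ac ring_distribs)
      finally show ?thesis by simp
    qed
    have "A * cmod w \<ge> A * \<delta> ^ Q"
      using A wx \<open>\<delta> > 0\<close> by (simp add: w_def norm_power power_mono)
    also have "A * \<delta> ^ Q = R\<^sub>0" using \<open>\<delta> > 0\<close> by (simp add: A_def)
    finally have "\<bar>integral {0..1} (\<lambda>\<tau>. L (circ u (A * cmod w * cos (2 * pi * (\<tau> + - Arg w / (2 * pi)))) x))
        - integral {0..1} (\<lambda>s. L (circ u s x))\<bar> \<le> \<epsilon>"
      using u x by (intro R\<^sub>0(2) continuous_on_circ_line[OF L u x continuous_on_id]) (auto intro: B(2))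
    then show "\<bar>wavg u k Q A L x - avg u L x\<bar> \<le> \<epsilon>"
      unfolding wavg_def avg_def w_def[symmetric] angle .
  qed
qed

section \<open>Mixing along one circle action by successive twists\<close>

definition commutes_rot :: "nat \<Rightarrow> (complex^('n::finite \<times> 2) \<Rightarrow> complex^('n \<times> 2)) \<Rightarrow> bool" where
  "commutes_rot q G \<longleftrightarrow> (\<forall>z. G (rot (1 / real q) z) = rot (1 / real q) (G z))"

lemma commutes_rot_compose: "commutes_rot q G \<Longrightarrow> commutes_rot q L \<Longrightarrow> commutes_rot q (G \<circ> L)"
  by (simp add: commutes_rot_def)

text \<open>One twist mixes only at the points where its coordinate \<open>wave u k\<close> is not small. Later twists keep
  what earlier ones achieved since they only average over \<open>circ u\<close>; where all coordinates are small,
  \<open>circ u\<close> is close to \<open>rot\<close> and \<open>ravg K\<close> is nearly constant along its orbits (the case \<open>\<epsilon>\<^sub>0\<close>).\<close>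

lemma finite_mixing:
  fixes u :: "real^('n::finite \<times> 2)" and K :: "real^('n \<times> 2) \<Rightarrow> real"
  assumes K: "continuous_on (sphere 0 1) K" and u: "norm u = 1" and "\<delta> > 0" "q \<ge> 1"
    and "finite I" "\<epsilon> > 0"
  shows "\<exists>h h' G G'. entire_symmetry h h' G G' \<and> commutes_rot q G \<and>
    (\<forall>x. norm x = 1 \<longrightarrow> \<bar>avg u (ravg (K \<circ> h)) x - avg u (ravg K) x\<bar> \<le> \<epsilon>) \<and>
    (\<forall>x. norm x = 1 \<longrightarrow>
      (\<forall>s. \<bar>ravg K (circ u s x) - avg u (ravg K) x\<bar> \<le> \<epsilon>\<^sub>0) \<or> (\<exists>k\<in>I. cmod (wave u k x) \<ge> \<delta>) \<longrightarrow>
      \<bar>ravg (K \<circ> h) x - avg u (ravg K) x\<bar> \<le> \<bar>\<epsilon>\<^sub>0\<bar> + \<epsilon>)"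
  using \<open>finite I\<close> \<open>\<epsilon> > 0\<close>
proof (induction I arbitrary: \<epsilon> rule: finite_induct)
  case empty
  have "\<bar>ravg K x - avg u (ravg K) x\<bar> \<le> \<bar>\<epsilon>\<^sub>0\<bar> + \<epsilon>"
    if "\<forall>s. \<bar>ravg K (circ u s x) - avg u (ravg K) x\<bar> \<le> \<epsilon>\<^sub>0" for x
    using that[rule_format, of 0] empty by simp
  moreover have "commutes_rot q id" by (simp add: commutes_rot_def)
  ultimately show ?case
    using empty by (intro exI[of _ id] conjI entire_symmetry_id \<open>commutes_rot q id\<close>) auto
next
  case (insert k I)
  let ?m = "avg u (ravg K)"
  \<comment> \<open>One quarter each for the induction hypothesis, the separation of time scales and
    the equidistribution.\<close>
  have "\<epsilon> / 4 > 0" using insert.prems by simp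
  from insert.IH[OF this] obtain h h' G G' where sym: "entire_symmetry h h' G G'" "commutes_rot q G"
    and IH1: "\<And>x. norm x = 1 \<Longrightarrow> \<bar>avg u (ravg (K \<circ> h)) x - ?m x\<bar> \<le> \<epsilon> / 4"
    and IH2: "\<And>x. norm x = 1 \<Longrightarrow> (\<forall>s. \<bar>ravg K (circ u s x) - ?m x\<bar> \<le> \<epsilon>\<^sub>0) \<or>
        (\<exists>k\<in>I. cmod (wave u k x) \<ge> \<delta>) \<Longrightarrow> \<bar>ravg (K \<circ> h) x - ?m x\<bar> \<le> \<bar>\<epsilon>\<^sub>0\<bar> + \<epsilon> / 4"
    by blast
  have K1: "continuous_on (sphere 0 1) (K \<circ> h)"
    unfolding o_def using entire_symmetryD[OF sym(1)]
    by (intro continuous_on_compose2[OF K]) auto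
  note L = continuous_on_ravg[OF K1]
  obtain Q\<^sub>0 where Q\<^sub>0: "Q\<^sub>0 \<ge> 1" "\<And>Q A u k x. \<lbrakk>Q \<ge> Q\<^sub>0; norm u = 1; norm x = 1\<rbrakk> \<Longrightarrow>
    \<bar>ravg ((K \<circ> h) \<circ> twist u k Q A) x - wavg u k Q A (ravg (K \<circ> h)) x\<bar> \<le> \<epsilon> / 4"
    using ravg_twist[OF K1 \<open>\<epsilon> / 4 > 0\<close>] by blast
  \<comment> \<open>Large enough for the approximation, and divisible by \<open>q\<close> so that
    the twist commutes with the rotation by \<open>1 / real q\<close>.\<close>
  define Q where "Q = q * Q\<^sub>0"
  have Q: "Q \<ge> Q\<^sub>0" "q dvd Q" using \<open>q \<ge> 1\<close> by (auto simp: Q_def)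
  obtain A where A: "\<And>x. norm x = 1 \<Longrightarrow> cmod (wave u k x) \<ge> \<delta> \<Longrightarrow>
      \<bar>wavg u k Q A (ravg (K \<circ> h)) x - avg u (ravg (K \<circ> h)) x\<bar> \<le> \<epsilon> / 4"
    using wavg_equidistributed[OF L u \<open>\<delta> > 0\<close> \<open>\<epsilon> / 4 > 0\<close>] by blast
  let ?h = "h \<circ> twist u k Q A"
  have sym': "entire_symmetry ?h (twist u k Q (- A) \<circ> h') (G \<circ> ctwist u k Q A) (ctwist u k Q (- A) \<circ> G')"
    by (rule entire_symmetry_compose[OF sym(1) entire_symmetry_twist[OF u]])
  have comm: "commutes_rot q (G \<circ> ctwist u k Q A)"
    using sym(2) ctwist_rot[OF \<open>q \<ge> 1\<close> Q(2)] by (intro commutes_rot_compose) (auto simp: commutes_rot_def)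
  have close: "\<bar>ravg (K \<circ> ?h) x - wavg u k Q A (ravg (K \<circ> h)) x\<bar> \<le> \<epsilon> / 4" if "norm x = 1" for x
    using Q\<^sub>0(2)[OF Q(1) u that] by (simp add: o_assoc)
  have K2: "continuous_on (sphere 0 1) (K \<circ> ?h)"
    unfolding o_def using entire_symmetryD[OF sym']
    by (intro continuous_on_compose2[OF K]) (auto simp: o_def)
  have 1: "\<bar>avg u (ravg (K \<circ> ?h)) x - ?m x\<bar> \<le> \<epsilon>" if x: "norm x = 1" for x
  proof -
    have "\<bar>avg u (ravg (K \<circ> ?h)) x - avg u (wavg u k Q A (ravg (K \<circ> h))) x\<bar> \<le> \<epsilon> / 4"
      by (intro avg_diff_le continuous_on_ravg K2 continuous_on_wavg L u x close)
    then show ?thesis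
      using IH1[OF x] insert.prems unfolding avg_wavg[OF L u x] by linarith
  qed
  have 2: "\<bar>ravg (K \<circ> ?h) x - ?m x\<bar> \<le> \<bar>\<epsilon>\<^sub>0\<bar> + \<epsilon>"
    if x: "norm x = 1" and good: "(\<forall>s. \<bar>ravg K (circ u s x) - ?m x\<bar> \<le> \<epsilon>\<^sub>0) \<or>
        (\<exists>k\<in>insert k I. cmod (wave u k x) \<ge> \<delta>)" for x
  proof (cases "cmod (wave u k x) \<ge> \<delta>")
    case True
    then show ?thesis using A[OF x True] close[OF x] IH1[OF x] insert.prems by linarith
  next
    case False
    \<comment> \<open>Where this coordinate is small, the twist merely averages along the orbit of
      \<open>circ u\<close>. The coordinates and the target are constant on that orbit, so the
      induction hypothesis gives the same bound at all its points.\<close>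
    have m: "?m (circ u s x) = ?m x" for s
      by (rule avg_circ[OF continuous_on_ravg[OF K] x u])
    have "\<bar>ravg (K \<circ> h) (circ u s x) - ?m x\<bar> \<le> \<bar>\<epsilon>\<^sub>0\<bar> + \<epsilon> / 4" for s
      using IH2[of "circ u s x"] good False u x by (auto simp: m wave_circ simp flip: circ_add)
    from wavg_const_diff_le[OF L u x this, of k Q A] show ?thesis
      using close[OF x] insert.prems by linarith
  qed
  from sym' comm 1 2 show ?case by blast
qed

lemma norm_perp_le: "norm (perp u x) \<le> 2 * (\<Sum>k\<in>UNIV. cmod (wave u k x))"
proof -
  have "norm (perp u x) \<le> (\<Sum>i\<in>UNIV. \<bar>perp u x $ i\<bar>)" by (rule norm_le_l1_cart)
  also have "\<dots> = (\<Sum>j\<in>UNIV. \<Sum>k\<in>UNIV. \<bar>perp u x $ (j, k)\<bar>)"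
    by (simp add: sum.cartesian_product)
  also have "\<dots> = (\<Sum>j\<in>UNIV. \<bar>Re (wave u j x)\<bar> + \<bar>Im (wave u j x)\<bar>)"
    by (simp add: sum_2 wave_def)
  also have "\<dots> \<le> (\<Sum>j\<in>UNIV. 2 * cmod (wave u j x))"
    by (intro sum_mono) (use abs_Re_le_cmod abs_Im_le_cmod in \<open>smt (verit)\<close>)
  finally show ?thesis by (simp add: sum_distrib_left)
qed

text \<open>Away from the complex line of \<open>u\<close> some coordinate is at least
  \<open>\<delta>\<close> and a twist mixes. Near it \<open>circ u s x\<close> is close to
  \<open>rot s x\<close>, and \<open>ravg K\<close>, being invariant under \<open>rot\<close>, is
  already close to its average.\<close>

lemma avg_realized:
  fixes u :: "real^('n::finite \<times> 2)" and K :: "real^('n \<times> 2) \<Rightarrow> real"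
  assumes K: "continuous_on (sphere 0 1) K" and u: "norm u = 1" and "q \<ge> 1" "\<epsilon> > 0"
  obtains h h' G G' where "entire_symmetry h h' G G'" "commutes_rot q G"
    "\<And>x. norm x = 1 \<Longrightarrow> \<bar>ravg (K \<circ> h) x - avg u (ravg K) x\<bar> \<le> \<epsilon>"
proof -
  note L = continuous_on_ravg[OF K]
  have "\<epsilon> / 4 > 0" using \<open>\<epsilon> > 0\<close> by simp
  then obtain \<eta> where \<eta>: "\<eta> > 0" "\<And>x y. norm x = 1 \<Longrightarrow> norm y = 1 \<Longrightarrow> norm (x - y) \<le> \<eta> \<Longrightarrow>
      \<bar>ravg K x - ravg K y\<bar> \<le> \<epsilon> / 4"
    using sphere_uniform[OF L] by blast
  \<comment> \<open>If all \<open>CARD('n)\<close> coordinates are below \<open>\<delta>\<close>,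
    then \<open>perp u x\<close> has norm at most \<open>\<eta> / 2\<close>, and
    \<open>norm_circ_diff_rot_le\<close> doubles this to \<open>\<eta>\<close>.\<close>
  define \<delta> where "\<delta> = \<eta> / (4 * real CARD('n))"
  have "\<delta> > 0" using \<eta> by (simp add: \<delta>_def)
  obtain h h' G G' where h: "entire_symmetry h h' G G'" "commutes_rot q G"
    and le: "\<And>x. norm x = 1 \<Longrightarrow> (\<forall>s. \<bar>ravg K (circ u s x) - avg u (ravg K) x\<bar> \<le> \<epsilon> / 2) \<or>
        (\<exists>k\<in>UNIV. cmod (wave u k x) \<ge> \<delta>) \<Longrightarrow>
      \<bar>ravg (K \<circ> h) x - avg u (ravg K) x\<bar> \<le> \<bar>\<epsilon> / 2\<bar> + \<epsilon> / 2"
    using finite_mixing[OF K u \<open>\<delta> > 0\<close> \<open>q \<ge> 1\<close> finite[of UNIV] half_gt_zero[OF \<open>\<epsilon> > 0\<close>], of "\<epsilon> / 2"]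
    by blast
  show thesis
  proof (rule that[OF h])
    fix x :: "real^('n \<times> 2)" assume x: "norm x = 1"
    show "\<bar>ravg (K \<circ> h) x - avg u (ravg K) x\<bar> \<le> \<epsilon>"
    proof (cases "\<exists>k\<in>UNIV. cmod (wave u k x) \<ge> \<delta>")
      case True
      then show ?thesis using le[OF x] \<open>\<epsilon> > 0\<close> by simp
    next
      case False
      have "(\<Sum>k\<in>UNIV. cmod (wave u k x)) \<le> (\<Sum>k\<in>(UNIV :: 'n set). \<delta>)"
        using False by (intro sum_mono) (auto simp: not_le intro: less_imp_le)
      then have "norm (perp u x) \<le> \<eta> / 2"
        using norm_perp_le[of u x] by (simp add: \<delta>_def)
      have near: "\<bar>ravg K (circ u s x) - ravg K x\<bar> \<le> \<epsilon> / 4" for s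
      proof -
        have "norm (circ u s x - rot s x) \<le> \<eta>"
          using norm_circ_diff_rot_le[of u s x] \<open>norm (perp u x) \<le> \<eta> / 2\<close> by simp
        then have "\<bar>ravg K (circ u s x) - ravg K (rot s x)\<bar> \<le> \<epsilon> / 4"
          using u x by (intro \<eta>) auto
        then show ?thesis by (simp add: ravg_rot[OF K x])
      qed
      then have m: "\<bar>avg u (ravg K) x - ravg K x\<bar> \<le> \<epsilon> / 4"
        by (rule avg_const_diff_le[OF L u x])
      have "\<bar>ravg K (circ u s x) - avg u (ravg K) x\<bar> \<le> \<epsilon> / 2" for s
        using near[of s] m by linarith
      then show ?thesis using le[OF x] \<open>\<epsilon> > 0\<close> by simp
    qed
  qed
qed

subsection \<open>Repeated averages\<close>

lemma exists_unit_vector: "\<exists>x :: 'a::euclidean_space. norm x = 1"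
  using norm_Basis[OF SOME_Basis] by blast

lemma continuous_on_fold_avg:
  assumes "continuous_on (sphere 0 1) g" "\<forall>u\<in>set us. norm u = 1"
  shows "continuous_on (sphere 0 1) (fold avg us g)"
  using assms by (induction us arbitrary: g) (auto intro: continuous_on_avg)

lemma fold_avg_diff_le:
  assumes "continuous_on (sphere 0 1) f" "continuous_on (sphere 0 1) g" "\<forall>u\<in>set us. norm u = 1"
    and "\<And>y. norm y = 1 \<Longrightarrow> \<bar>f y - g y\<bar> \<le> \<epsilon>" "norm x = 1"
  shows "\<bar>fold avg us f x - fold avg us g x\<bar> \<le> \<epsilon>"
  using assms
proof (induction us arbitrary: f g)
  case (Cons u us)
  have "\<bar>fold avg us (avg u f) x - fold avg us (avg u g) x\<bar> \<le> \<epsilon>"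
    using Cons.prems by (intro Cons.IH continuous_on_avg avg_diff_le) auto
  then show ?case by simp
qed simp

text \<open>\<open>circ u s\<close> is an isometry, so averaging keeps any modulus of continuity.
  One modulus for all lists is the equicontinuity needed for a limit of repeated averages.\<close>

lemma fold_avg_modulus:
  assumes "continuous_on (sphere 0 1) g" "\<forall>u\<in>set us. norm u = 1"
    and "\<And>x y. norm x = 1 \<Longrightarrow> norm y = 1 \<Longrightarrow> norm (x - y) \<le> \<delta> \<Longrightarrow> \<bar>g x - g y\<bar> \<le> \<epsilon>"
    and "norm x = 1" "norm y = 1" "norm (x - y) \<le> \<delta>"
  shows "\<bar>fold avg us g x - fold avg us g y\<bar> \<le> \<epsilon>"
  using assms(1-3)
proof (induction us arbitrary: g)
  case Nil
  then show ?case using assms(4-6) by simp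
next
  case (Cons u us)
  then have u: "norm u = 1" by simp
  have "\<bar>avg u g x - avg u g y\<bar> \<le> \<epsilon>" if xy: "norm x = 1" "norm y = 1" "norm (x - y) \<le> \<delta>" for x y
    unfolding avg_def
  proof (rule integral_diff_le)
    show "continuous_on {0..1} (\<lambda>s. g (circ u s x))" "continuous_on {0..1} (\<lambda>s. g (circ u s y))"
      using xy by (auto intro!: continuous_on_circ_line[OF Cons.prems(1) u _ continuous_on_id])
    show "\<bar>g (circ u s x) - g (circ u s y)\<bar> \<le> \<epsilon>" for s
      using u xy by (intro Cons.prems(3)) (auto simp flip: circ_diff)
  qed
  then have "\<bar>fold avg us (avg u g) x - fold avg us (avg u g) y\<bar> \<le> \<epsilon>"
    using Cons.prems by (intro Cons.IH continuous_on_avg) auto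
  then show ?case by simp
qed

lemma avg_le:
  assumes "continuous_on (sphere 0 1) g" "norm u = 1" "norm x = 1"
    and "\<And>y. norm y = 1 \<Longrightarrow> g y \<le> m"
  shows "avg u g x \<le> m"
proof -
  have "integral {0..1} (\<lambda>s. g (circ u s x)) \<le> integral {0..1} (\<lambda>_::real. m)"
    using assms by (intro integral_le integrable_continuous_real continuous_on_circ_line[OF assms(1-3) continuous_on_id])
      auto
  then show ?thesis by (simp add: avg_def)
qed

text \<open>Equality would force the continuous nonnegative function \<open>m - g\<close> to vanish
  along the whole circle.\<close>

lemma avg_less:
  assumes g: "continuous_on (sphere 0 1) g" and u: "norm u = 1" and x: "norm x = 1"
    and le: "\<And>y. norm y = 1 \<Longrightarrow> g y \<le> m" and less: "g (circ u s x) < m"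
  shows "avg u g x < m"
proof (rule ccontr)
  assume "\<not> avg u g x < m"
  then have eq: "avg u g x = m" using avg_le[OF g u x le] by simp
  have cont: "continuous_on {0..1} (\<lambda>s. g (circ u s x))"
    by (rule continuous_on_circ_line[OF g u x continuous_on_id])
  then have "integral {0..1} (\<lambda>s. m - g (circ u s x)) = 0"
    using eq by (simp add: avg_def integral_diff integrable_continuous_real)
  moreover have "continuous_on {0..1} (\<lambda>s. m - g (circ u s x))"
    using cont by (intro continuous_intros)
  ultimately have "\<forall>s\<in>{0..1}. m - g (circ u s x) = 0"
    using integral_eq_0_iff[of 0 1 "\<lambda>s. m - g (circ u s x)"] u x le by simp
  moreover have "frac s \<in> {0..1}" by (simp add: frac_lt_1 less_imp_le)
  ultimately have "g (circ u (frac s) x) = m" by fastforce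
  then show False
    using less periodic_frac[of "\<lambda>s. g (circ u s x)" s] by simp
qed

text \<open>The vector that leads from \<open>x\<close> to a value below \<open>m\<close> may come
  late in the list. Averages over earlier vectors keep a strict inequality at every point where it
  holds, since they include the point itself at \<open>s = 0\<close>.\<close>

lemma fold_avg_less:
  assumes "continuous_on (sphere 0 1) g" "\<forall>u\<in>set us. norm u = 1" "norm x = 1"
    and "\<And>y. norm y = 1 \<Longrightarrow> g y \<le> m"
    and "g x < m \<or> (\<exists>u\<in>set us. \<exists>s. g (circ u s x) < m)"
  shows "fold avg us g x < m"
  using assms
proof (induction us arbitrary: g)
  case (Cons u us)
  then have u: "norm u = 1" by simp
  have pt: "avg u g y < m" if "g y < m" "norm y = 1" for y
    using avg_less[OF Cons.prems(1) u that(2) Cons.prems(4), of 0] that by simp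
  have "avg u g x < m \<or> (\<exists>v\<in>set us. \<exists>s. avg u g (circ v s x) < m)"
  proof -
    consider "g x < m" | s where "g (circ u s x) < m" | v s where "v \<in> set us" "g (circ v s x) < m"
      using Cons.prems(5) by auto
    then show ?thesis
    proof cases
      case 1
      then show ?thesis using pt Cons.prems(3) by blast
    next
      case 2
      then show ?thesis using avg_less[OF Cons.prems(1) u Cons.prems(3,4)] by blast
    next
      case (3 v s)
      then show ?thesis using pt[OF 3(2)] Cons.prems(2,3) by auto
    qed
  qed
  then have "fold avg us (avg u g) x < m"
    using Cons.prems by (intro Cons.IH continuous_on_avg avg_le[OF Cons.prems(1) u _ Cons.prems(4)]) auto
  then show ?case by simp
qed simp

text \<open>Some \<open>circ u s\<close> moves a given point to \<open>y\<close>, and it still moves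
  a neighbourhood of that point into the open set where \<open>g\<close> is below \<open>m\<close>.
  Compactness of the sphere leaves finitely many vectors.\<close>

lemma fold_avg_strict_decrease:
  fixes g :: "real^('n::finite \<times> 2) \<Rightarrow> real"
  assumes g: "continuous_on (sphere 0 1) g" and le: "\<And>y. norm y = 1 \<Longrightarrow> g y \<le> m"
    and y: "norm y = 1" "g y < m"
  obtains us where "\<forall>u\<in>set us. norm u = 1" "\<And>x. norm x = 1 \<Longrightarrow> fold avg us g x < m"
proof -
  have "\<exists>u s U. norm u = 1 \<and> open U \<and> x \<in> U \<and> (\<forall>x'\<in>U. norm x' = 1 \<longrightarrow> g (circ u s x') < m)"
    if x: "x \<in> sphere 0 1" for x
  proof -
    obtain u s where us: "norm u = 1" "circ u s x = y"
      using circ_transitive[of x y] x y by auto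
    have "continuous_on (sphere 0 1) (\<lambda>x. g (circ u s x))"
      using us(1) by (intro continuous_on_compose2[OF g] continuous_intros) auto
    from continuous_openin_preimage_gen[OF this open_lessThan[of m]]
    obtain U where U: "open U" "sphere 0 1 \<inter> (\<lambda>x. g (circ u s x)) -` {..<m} = sphere 0 1 \<inter> U"
      by (auto simp: openin_open)
    have "x \<in> sphere 0 1 \<inter> (\<lambda>x. g (circ u s x)) -` {..<m}" using x us y by simp
    then have "x \<in> U" unfolding U(2) by blast
    moreover have "g (circ u s x') < m" if "x' \<in> U" "norm x' = 1" for x'
    proof -
      have "x' \<in> sphere 0 1 \<inter> U" using that by simp
      then show ?thesis unfolding U(2)[symmetric] by simp
    qed
    ultimately show ?thesis using us(1) U(1) by blast
  qed
  then obtain u s U where U: "\<And>x. x \<in> sphere 0 1 \<Longrightarrow> norm (u x) = 1"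
      "\<And>x. x \<in> sphere 0 1 \<Longrightarrow> open (U x)" "\<And>x. x \<in> sphere 0 1 \<Longrightarrow> x \<in> U x"
      "\<And>x x'. x \<in> sphere 0 1 \<Longrightarrow> x' \<in> U x \<Longrightarrow> norm x' = 1 \<Longrightarrow> g (circ (u x) (s x) x') < m"
    by metis
  obtain C where C: "C \<subseteq> sphere 0 1" "finite C" "sphere 0 1 \<subseteq> (\<Union>c\<in>C. U c)"
    using compactE_image[OF compact_sphere, of "sphere 0 1" U 0 1] U(2,3) by blast
  obtain us where us: "set us = u ` C" using finite_list[of "u ` C"] C(2) by auto
  show thesis
  proof (rule that[of us])
    show "\<forall>u\<in>set us. norm u = 1" using us C(1) U(1) by auto
    fix x :: "real^('n \<times> 2)" assume x: "norm x = 1"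
    then obtain c where c: "c \<in> C" "x \<in> U c" using C(3) by auto
    then have "g (circ (u c) (s c) x) < m" using C(1) U(4) x by blast
    then have "\<exists>v\<in>set us. \<exists>s. g (circ v s x) < m" using us c by auto
    then show "fold avg us g x < m"
      using us C(1) U(1) x by (intro fold_avg_less[OF g _ _ le]) auto
  qed
qed

text \<open>Among all repeated averages of \<open>g\<close>, an equicontinuous family, minimise the maximum. A
  nonconstant limit function could be averaged further to a strictly smaller maximum.\<close>

lemma fold_avg_almost_constant:
  fixes g :: "real^('n::finite \<times> 2) \<Rightarrow> real"
  assumes g: "continuous_on (sphere 0 1) g" and "\<epsilon> > 0"
  obtains us c where "\<forall>u\<in>set us. norm u = 1" "\<And>x. norm x = 1 \<Longrightarrow> \<bar>fold avg us g x - c\<bar> \<le> \<epsilon>"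
proof -
  obtain x0 :: "real^('n \<times> 2)" where x0: "norm x0 = 1" using exists_unit_vector by blast
  obtain B where B: "B \<ge> 0" "\<And>x. norm x = 1 \<Longrightarrow> \<bar>g x\<bar> \<le> B" using sphere_bounded[OF g] by blast
  define unit where "unit us \<longleftrightarrow> (\<forall>u\<in>set us. norm u = 1)" for us :: "(real^('n \<times> 2)) list"
  have bounded: "\<bar>fold avg us g x\<bar> \<le> B" if "unit us" "norm x = 1" for us x
  proof -
    have z: "fold avg us (\<lambda>_. 0) x = 0" for us
      by (induction us) (simp_all add: avg_def[abs_def])
    have "\<bar>fold avg us g x - fold avg us (\<lambda>_. 0) x\<bar> \<le> B"
      using that B(2) by (intro fold_avg_diff_le[OF g]) (auto simp: unit_def)
    then show ?thesis by (simp add: z)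
  qed
  \<comment> \<open>Upper bounds have the same infimum as the maxima and call for no
    maximiser.\<close>
  define Ms where "Ms = {M. \<exists>us. unit us \<and> (\<forall>x. norm x = 1 \<longrightarrow> fold avg us g x \<le> M)}"
  define m where "m = Inf Ms"
  have "B \<in> Ms" unfolding Ms_def
    using bounded[of "[]"] by (auto simp: unit_def abs_le_iff intro!: exI[of _ "[]"])
  have bdd: "bdd_below Ms"
    unfolding bdd_below_def Ms_def using bounded x0 by (force simp: abs_le_iff intro!: exI[of _ "- B"])
  have "\<exists>us. unit us \<and> (\<forall>x. norm x = 1 \<longrightarrow> fold avg us g x \<le> m + inverse (real (Suc n)))" for n
  proof -
    have "m < m + inverse (real (Suc n))" by simp
    then obtain M where "M \<in> Ms" "M < m + inverse (real (Suc n))"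
      using cInf_lessD[of Ms] \<open>B \<in> Ms\<close> unfolding m_def by blast
    then show ?thesis unfolding Ms_def by force
  qed
  then obtain us where us: "\<And>n. unit (us n)"
      "\<And>n x. norm x = 1 \<Longrightarrow> fold avg (us n) g x \<le> m + inverse (real (Suc n))"
    by metis
  define F where "F n = fold avg (us n) g" for n
  have F_cont: "continuous_on (sphere 0 1) (F n)" for n
    unfolding F_def using us(1) by (intro continuous_on_fold_avg g) (simp add: unit_def)
  obtain f k where f: "continuous_on (sphere 0 1) f" and k: "strict_mono (k :: nat \<Rightarrow> nat)"
    and lim: "\<And>e. 0 < e \<Longrightarrow> \<exists>N. \<forall>n x. n \<ge> N \<and> x \<in> sphere 0 1 \<longrightarrow> norm (F (k n) x - f x) < e"
  proof (rule Arzela_Ascoli[of "sphere 0 1" F B])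
    show "norm (F n x) \<le> B" if "x \<in> sphere 0 1" for n x
      using bounded[OF us(1)] that by (simp add: F_def)
    fix x :: "real^('n \<times> 2)" and e :: real assume x: "x \<in> sphere 0 1" and e: "0 < e"
    then obtain \<delta> where \<delta>: "\<delta> > 0" "\<And>x y. norm x = 1 \<Longrightarrow> norm y = 1 \<Longrightarrow> norm (x - y) \<le> \<delta> \<Longrightarrow> \<bar>g x - g y\<bar> \<le> e / 2"
      using sphere_uniform[OF g, of "e / 2"] by auto
    have "norm (F n x - F n y) < e" if "y \<in> sphere 0 1" "norm (x - y) < \<delta>" for n y
    proof -
      have "\<bar>F n x - F n y\<bar> \<le> e / 2"
        unfolding F_def using that x us(1) \<delta>(2)
        by (intro fold_avg_modulus[OF g, where \<delta> = \<delta>]) (auto simp: unit_def)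
      then show ?thesis using e by simp
    qed
    with \<delta>(1) show "\<exists>d>0. \<forall>n y. y \<in> sphere 0 1 \<and> norm (x - y) < d \<longrightarrow> norm (F n x - F n y) < e"
      by blast
  qed auto
  have F_lim: "(\<lambda>n. F (k n) x) \<longlonglongrightarrow> f x" if "norm x = 1" for x
    using lim that by (intro LIMSEQ_I) fastforce
  have f_le: "f x \<le> m" if "norm x = 1" for x
  proof (rule LIMSEQ_le)
    show "(\<lambda>n. F (k n) x) \<longlonglongrightarrow> f x" by (rule F_lim[OF that])
    have "(\<lambda>n. m + inverse (real (Suc n))) \<longlonglongrightarrow> m + 0"
      by (intro tendsto_intros LIMSEQ_inverse_real_of_nat)
    then show "(\<lambda>n. m + inverse (real (Suc n))) \<longlonglongrightarrow> m" by simp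
    have "F (k n) x \<le> m + inverse (real (Suc n))" for n
    proof -
      have "inverse (real (Suc (k n))) \<le> inverse (real (Suc n))"
        using seq_suble[OF k, of n] by (intro le_imp_inverse_le) auto
      then show ?thesis using us(2)[OF that, of "k n"] unfolding F_def by linarith
    qed
    then show "\<exists>N. \<forall>n\<ge>N. F (k n) x \<le> m + inverse (real (Suc n))" by blast
  qed
  have f_eq: "f x = m" if x: "norm x = 1" for x
  proof (rule ccontr)
    assume "f x \<noteq> m"
    then have "f x < m" using f_le[OF x] by simp
    then obtain vs where vs: "unit vs" "\<And>x. norm x = 1 \<Longrightarrow> fold avg vs f x < m"
      using fold_avg_strict_decrease[OF f f_le x] unfolding unit_def by blast
    have cont: "continuous_on (sphere 0 1) (fold avg vs f)"
      using vs(1) f by (intro continuous_on_fold_avg) (auto simp: unit_def)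
    have "sphere (0 :: real^('n \<times> 2)) 1 \<noteq> {}" using x0 by auto
    then obtain z where z: "z \<in> sphere 0 1" "\<And>x. x \<in> sphere 0 1 \<Longrightarrow> fold avg vs f x \<le> fold avg vs f z"
      using continuous_attains_sup[OF compact_sphere _ cont] by blast
    \<comment> \<open>Half the gap below \<open>m\<close> pays for replacing \<open>f\<close> by
      \<open>F (k n)\<close>, the other half remains as a gain; averaging over
      \<open>us (k n) @ vs\<close> then beats the infimum.\<close>
    define d where "d = (m - fold avg vs f z) / 2"
    have d: "d > 0" using vs(2)[of z] z(1) by (simp add: d_def)
    obtain n where n: "\<And>x. x \<in> sphere 0 1 \<Longrightarrow> norm (F (k n) x - f x) < d"
      using lim[OF d] by blast
    have "fold avg (us (k n) @ vs) g x \<le> m - d" if "norm x = 1" for x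
    proof -
      have "\<bar>fold avg vs (F (k n)) x - fold avg vs f x\<bar> \<le> d"
        using n that vs(1) by (intro fold_avg_diff_le F_cont f) (auto simp: unit_def less_imp_le)
      moreover have "fold avg vs f x \<le> fold avg vs f z" using z(2) that by simp
      moreover have "fold avg vs f z + d = m - d" by (simp add: d_def field_simps)
      ultimately have "fold avg vs (F (k n)) x \<le> m - d" by linarith
      then show ?thesis by (simp add: F_def)
    qed
    then have "m - d \<in> Ms" unfolding Ms_def using us(1) vs(1)
      by (intro CollectI exI[of _ "us (k n) @ vs"]) (auto simp: unit_def)
    then have "m \<le> m - d" unfolding m_def by (rule cInf_lower[OF _ bdd])
    with d show False by simp
  qed
  obtain n where n: "\<And>x. x \<in> sphere 0 1 \<Longrightarrow> norm (F (k n) x - f x) < \<epsilon>"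
    using lim[OF \<open>\<epsilon> > 0\<close>] by blast
  show thesis
    using us(1) n f_eq by (intro that[of "us (k n)" m]) (auto simp: unit_def F_def less_imp_le)
qed

text \<open>After \<open>h\<close> has realised the first average, the remaining ones concern
  \<open>K \<circ> h\<close>, so \<open>K\<close> varies in the induction. The errors add because
  \<open>fold avg us\<close> does not increase sup distances.\<close>

lemma fold_avg_realized:
  fixes K :: "real^('n::finite \<times> 2) \<Rightarrow> real"
  assumes "continuous_on (sphere 0 1) K" "\<forall>u\<in>set us. norm u = 1" "q \<ge> 1" "\<epsilon> > 0"
  shows "\<exists>h h' G G'. entire_symmetry h h' G G' \<and> commutes_rot q G \<and>
    (\<forall>x. norm x = 1 \<longrightarrow> \<bar>ravg (K \<circ> h) x - fold avg us (ravg K) x\<bar> \<le> \<epsilon>)"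
  using assms
proof (induction us arbitrary: K \<epsilon>)
  case Nil
  have "commutes_rot q id" by (simp add: commutes_rot_def)
  then show ?case using Nil by (intro exI[of _ id] conjI entire_symmetry_id \<open>commutes_rot q id\<close>) auto
next
  case (Cons u us)
  have u: "norm u = 1" and us: "\<forall>u\<in>set us. norm u = 1" using Cons.prems by auto
  have "\<epsilon> / 2 > 0" using Cons.prems by simp
  obtain h h' G G' where h: "entire_symmetry h h' G G'" "commutes_rot q G"
    "\<And>x. norm x = 1 \<Longrightarrow> \<bar>ravg (K \<circ> h) x - avg u (ravg K) x\<bar> \<le> \<epsilon> / 2"
    using avg_realized[OF Cons.prems(1) u Cons.prems(3) \<open>\<epsilon> / 2 > 0\<close>] by blast
  have K1: "continuous_on (sphere 0 1) (K \<circ> h)"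
    unfolding o_def using entire_symmetryD[OF h(1)]
    by (intro continuous_on_compose2[OF Cons.prems(1)]) auto
  obtain l l' L L' where l: "entire_symmetry l l' L L'" "commutes_rot q L"
    "\<And>x. norm x = 1 \<Longrightarrow> \<bar>ravg ((K \<circ> h) \<circ> l) x - fold avg us (ravg (K \<circ> h)) x\<bar> \<le> \<epsilon> / 2"
    using Cons.IH[OF K1 us Cons.prems(3) \<open>\<epsilon> / 2 > 0\<close>] by blast
  have "\<bar>ravg (K \<circ> (h \<circ> l)) x - fold avg (u # us) (ravg K) x\<bar> \<le> \<epsilon>" if x: "norm x = 1" for x
  proof -
    have "\<bar>fold avg us (ravg (K \<circ> h)) x - fold avg us (avg u (ravg K)) x\<bar> \<le> \<epsilon> / 2"
      by (intro fold_avg_diff_le continuous_on_ravg continuous_on_avg K1 Cons.prems(1) u us h(3) x)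
    with l(3)[OF x] have "\<bar>ravg ((K \<circ> h) \<circ> l) x - fold avg us (avg u (ravg K)) x\<bar> \<le> \<epsilon>"
      by linarith
    then show ?thesis by (simp add: o_assoc)
  qed
  then show ?case
    using entire_symmetry_compose[OF h(1) l(1)] commutes_rot_compose[OF h(2) l(2)] by blast
qed

lemma mixing_symmetry:
  fixes K :: "real^('n::finite \<times> 2) \<Rightarrow> real"
  assumes K: "continuous_on (sphere 0 1) K" and "q \<ge> 1" "\<epsilon> > 0"
  obtains h h' G G' c where "entire_symmetry h h' G G'" "commutes_rot q G"
    "\<And>x. norm x = 1 \<Longrightarrow> \<bar>ravg (K \<circ> h) x - c\<bar> \<le> \<epsilon>"
proof -
  have half: "\<epsilon> / 2 > 0" using \<open>\<epsilon> > 0\<close> by simp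
  obtain us c where us: "\<forall>u\<in>set us. norm u = 1" "\<And>x. norm x = 1 \<Longrightarrow> \<bar>fold avg us (ravg K) x - c\<bar> \<le> \<epsilon> / 2"
    using fold_avg_almost_constant[OF continuous_on_ravg[OF K] half] by blast
  obtain h h' G G' where h: "entire_symmetry h h' G G'" "commutes_rot q G"
    "\<And>x. norm x = 1 \<Longrightarrow> \<bar>ravg (K \<circ> h) x - fold avg us (ravg K) x\<bar> \<le> \<epsilon> / 2"
    using fold_avg_realized[OF K us(1) \<open>q \<ge> 1\<close> half] by blast
  show thesis
  proof (rule that[OF h(1,2)])
    show "\<bar>ravg (K \<circ> h) x - c\<bar> \<le> \<epsilon>" if "norm x = 1" for x
      using us(2)[OF that] h(3)[OF that] by linarith
  qed
qed

subsection \<open>Conjugated rotations\<close>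

lemma continuous_on_rot_complex:
  fixes f :: "'b::t2_space \<Rightarrow> complex^('n::finite \<times> 2)"
  assumes "continuous_on A s" "continuous_on A f"
  shows "continuous_on A (\<lambda>y. rot (s y) (f y))"
proof -
  have "continuous_on A (\<lambda>y. rot (s y) (f y) $ p)" for p :: "'n \<times> 2"
  proof -
    obtain j k where p: "p = (j, k)" by (cases p)
    consider "k = 1" | "k = 2" using exhaust_2 by blast
    then show ?thesis
      by cases (use assms in \<open>auto simp: p rot_nth intro!: continuous_intros\<close>)
  qed
  then have "continuous_on A (\<lambda>y. \<chi> p. rot (s y) (f y) $ p)" by (rule continuous_on_vec_lambda)
  then show ?thesis by simp
qed

lemma entire_rot: "entire_vec (rot t)"
  unfolding entire_vec_def
proof
  fix p :: "'a \<times> 2"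
  obtain j k where p: "p = (j, k)" by (cases p)
  consider "k = 1" | "k = 2" using exhaust_2 by blast
  then show "holomorphic_cn_on (\<lambda>z. rot t z $ p) UNIV"
    by cases (simp_all only: p rot_nth scaleR_conv_of_real holomorphic_cn_add holomorphic_cn_mult
        holomorphic_cn_const holomorphic_cn_nth)
qed

lemma commutes_rot_rational:
  assumes "commutes_rot q G"
  shows "G (rot (real p / real q) z) = rot (real p / real q) (G z)"
proof -
  have "G ((rot (1 / real q) ^^ p) z) = (rot (1 / real q) ^^ p) (G z)" for p
    by (induction p) (use assms in \<open>simp_all add: commutes_rot_def\<close>)
  then show ?thesis by (simp add: rot_power)
qed

lemma commutes_rot_rational_minus:
  assumes "commutes_rot q G"
  shows "G (rot (- (real p / real q)) z) = rot (- (real p / real q)) (G z)"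
proof -
  have "rot (real p / real q) (G (rot (- (real p / real q)) z)) = G z"
    by (simp flip: commutes_rot_rational[OF assms])
  then show ?thesis by (metis rot_minus_cancel(1))
qed

text \<open>Uniform continuity on a compact set of angles and points. \<open>\<delta>\<close>
  depends on \<open>G\<close> and \<open>G'\<close>, hence the new rotation number can be chosen
  only after the new conjugacy.\<close>

lemma conjugated_rot_close:
  fixes G G' :: "complex^('n::finite \<times> 2) \<Rightarrow> complex^('n \<times> 2)"
  assumes G: "entire_vec G" "entire_vec G'" and "\<eta> > 0"
  obtains \<delta> where "\<delta> > 0" "\<And>s z. \<bar>s - t\<bar> \<le> \<delta> \<Longrightarrow> z \<in> cball 0 R \<Longrightarrow>
    norm (G (rot s (G' z)) - G (rot t (G' z))) \<le> \<eta> \<and>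
    norm (G (rot (- s) (G' z)) - G (rot (- t) (G' z))) \<le> \<eta>"
proof -
  \<comment> \<open>\<open>\<sigma>\<close> is 1 for the map and -1 for its inverse.\<close>
  have "\<exists>\<delta>>0. \<forall>s z. \<bar>s - t\<bar> \<le> \<delta> \<and> z \<in> cball 0 R \<longrightarrow> norm (G (rot (\<sigma> * s) (G' z)) - G (rot (\<sigma> * t) (G' z))) \<le> \<eta>"
    for \<sigma> :: real
  proof -
    let ?K = "cball t 1 \<times> cball (0 :: complex^('n \<times> 2)) R"
    let ?f = "\<lambda>y. G (rot (\<sigma> * fst y) (G' (snd y)))"
    have "continuous_on ?K ?f"
      by (intro continuous_on_compose2[OF entire_vec_continuous[OF G(1), of UNIV]] continuous_on_rot_complex
          continuous_on_compose2[OF entire_vec_continuous[OF G(2), of UNIV]] continuous_intros) auto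
    then have "uniformly_continuous_on ?K ?f"
      by (intro compact_uniformly_continuous compact_Times compact_cball)
    then obtain \<delta> where \<delta>: "\<delta> > 0"
        "\<And>y y'. y \<in> ?K \<Longrightarrow> y' \<in> ?K \<Longrightarrow> dist y' y < \<delta> \<Longrightarrow> dist (?f y') (?f y) < \<eta>"
      unfolding uniformly_continuous_on_def using \<open>\<eta> > 0\<close> by meson
    show ?thesis
    proof (intro exI[of _ "min (\<delta> / 2) 1"] conjI allI impI)
      fix s and z :: "complex^('n \<times> 2)" assume s: "\<bar>s - t\<bar> \<le> min (\<delta> / 2) 1 \<and> z \<in> cball 0 R"
      then have "dist (s, z) (t, z) < \<delta>"
        using \<delta>(1) by (simp add: dist_Pair_Pair dist_real_def)
      moreover have "(s, z) \<in> ?K" "(t, z) \<in> ?K" using s by (auto simp: dist_real_def)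
      ultimately have "dist (?f (s, z)) (?f (t, z)) < \<eta>" by (intro \<delta>(2))
      then show "norm (G (rot (\<sigma> * s) (G' z)) - G (rot (\<sigma> * t) (G' z))) \<le> \<eta>"
        by (simp add: dist_norm)
    qed (use \<delta>(1) in auto)
  qed
  from this[of 1] this[of "-1"] obtain \<delta> \<delta>' where d: "\<delta> > 0" "\<delta>' > 0"
      "\<forall>s z. \<bar>s - t\<bar> \<le> \<delta> \<and> z \<in> cball 0 R \<longrightarrow> norm (G (rot s (G' z)) - G (rot t (G' z))) \<le> \<eta>"
      "\<forall>s z. \<bar>s - t\<bar> \<le> \<delta>' \<and> z \<in> cball 0 R \<longrightarrow> norm (G (rot (- s) (G' z)) - G (rot (- t) (G' z))) \<le> \<eta>"
    by auto
  show thesis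
    by (rule that[of "min \<delta> \<delta>'"]) (use d in auto)
qed

lemma entire_symmetry_conj_rot:
  assumes "entire_symmetry h h' G G'"
  shows "G (rot t (G' (cvec x))) = cvec (h (rot t (h' x)))"
  using assms by (simp add: entire_symmetry_def flip: cvec_rot)

lemma conj_rot_power:
  assumes "entire_symmetry h h' G G'"
  shows "((\<lambda>x. h (rot t (h' x))) ^^ k) x = h (rot (real k * t) (h' x))"
  by (induction k) (simp_all add: entire_symmetryD[OF assms] ring_distribs rot_add)

subsection \<open>One step of the construction\<close>

lemma funpow_closed: "g \<in> S \<rightarrow> S \<Longrightarrow> x \<in> S \<Longrightarrow> (g ^^ k) x \<in> S"
  by (induction k) auto

text \<open>Only finitely many iterates are compared, so uniform continuity of
  \<open>f\<^sub>0\<close> suffices. This lets the near constancy of a Birkhoff average of fixed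
  length survive uniformly small changes of the map.\<close>

lemma iterates_close:
  fixes f\<^sub>0 :: "'a::euclidean_space \<Rightarrow> 'a"
  assumes f0: "continuous_on (sphere 0 1) f\<^sub>0" "f\<^sub>0 \<in> sphere 0 1 \<rightarrow> sphere 0 1" and "\<rho> > 0"
  shows "\<exists>\<eta>>0. \<forall>f. f \<in> sphere 0 1 \<rightarrow> sphere 0 1 \<and> (\<forall>x\<in>sphere 0 1. norm (f x - f\<^sub>0 x) \<le> \<eta>) \<longrightarrow>
    (\<forall>k\<le>N. \<forall>x\<in>sphere 0 1. norm ((f ^^ k) x - (f\<^sub>0 ^^ k) x) \<le> \<rho>)"
  using \<open>\<rho> > 0\<close>
proof (induction N arbitrary: \<rho>)
  case 0
  then show ?case by (intro exI[of _ 1]) auto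
next
  case (Suc N)
  have "uniformly_continuous_on (sphere 0 1) f\<^sub>0"
    using f0(1) by (intro compact_uniformly_continuous) auto
  then obtain \<delta> where \<delta>: "\<delta> > 0" "\<And>x x'. x \<in> sphere 0 1 \<Longrightarrow> x' \<in> sphere 0 1 \<Longrightarrow> dist x' x < \<delta> \<Longrightarrow>
      dist (f\<^sub>0 x') (f\<^sub>0 x) < \<rho> / 2"
    unfolding uniformly_continuous_on_def using half_gt_zero[OF Suc.prems] by meson
  have "min (\<delta> / 2) \<rho> > 0" using \<delta>(1) Suc.prems by simp
  from Suc.IH[OF this] obtain \<eta> where \<eta>: "\<eta> > 0" "\<And>f k x. f \<in> sphere 0 1 \<rightarrow> sphere 0 1 \<Longrightarrow>
      \<forall>x\<in>sphere 0 1. norm (f x - f\<^sub>0 x) \<le> \<eta> \<Longrightarrow> k \<le> N \<Longrightarrow> x \<in> sphere 0 1 \<Longrightarrow>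
      norm ((f ^^ k) x - (f\<^sub>0 ^^ k) x) \<le> min (\<delta> / 2) \<rho>"
    by blast
  show ?case
  \<comment> \<open>The error of the last iterate splits into \<open>f - f\<^sub>0\<close> at the
    perturbed point and the effect of \<open>f\<^sub>0\<close> on the earlier error, each at most
    \<open>\<rho> / 2\<close>.\<close>
  proof (intro exI[of _ "min \<eta> (\<rho> / 2)"] conjI allI impI ballI)
    fix f k and x :: 'a
    assume f: "f \<in> sphere 0 1 \<rightarrow> sphere 0 1 \<and> (\<forall>x\<in>sphere 0 1. norm (f x - f\<^sub>0 x) \<le> min \<eta> (\<rho> / 2))"
      and k: "k \<le> Suc N" and x: "x \<in> sphere 0 1"
    have fS: "f \<in> sphere 0 1 \<rightarrow> sphere 0 1" and fle: "\<forall>x\<in>sphere 0 1. norm (f x - f\<^sub>0 x) \<le> \<eta>"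
      using f by auto
    note IH = \<eta>(2)[OF fS fle _ x]
    have in_S: "(g ^^ k) x \<in> sphere 0 1" if "g \<in> sphere 0 1 \<rightarrow> sphere 0 1" for g :: "'a \<Rightarrow> 'a" and k
      by (rule funpow_closed[OF that x])
    show "norm ((f ^^ k) x - (f\<^sub>0 ^^ k) x) \<le> \<rho>"
    proof (cases "k \<le> N")
      case True
      then show ?thesis using IH[of k] by simp
    next
      case False
      then have k: "k = Suc N" using k by simp
      let ?y = "(f ^^ N) x" and ?z = "(f\<^sub>0 ^^ N) x"
      have "norm (?y - ?z) \<le> \<delta> / 2" using IH[of N] by simp
      then have "dist ?y ?z < \<delta>" using \<delta>(1) by (simp add: dist_norm)
      then have "norm (f\<^sub>0 ?y - f\<^sub>0 ?z) < \<rho> / 2"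
        using \<delta>(2)[OF in_S[OF f0(2)] in_S[OF fS]] by (simp add: dist_norm)
      moreover have "norm (f ?y - f\<^sub>0 ?y) \<le> \<rho> / 2" using f in_S[OF fS, of N] by auto
      ultimately have "norm ((f ?y - f\<^sub>0 ?y) + (f\<^sub>0 ?y - f\<^sub>0 ?z)) \<le> \<rho>"
        using norm_triangle_ineq[of "f ?y - f\<^sub>0 ?y" "f\<^sub>0 ?y - f\<^sub>0 ?z"] by linarith
      then show ?thesis by (simp add: k)
    qed
  qed (use \<eta>(1) Suc.prems in auto)
qed

lemma sum_lessThan_add:
  fixes f :: "nat \<Rightarrow> 'a::comm_monoid_add"
  shows "sum f {..<m + n} = sum f {..<m} + (\<Sum>i<n. f (m + i))"
  by (induction n) (simp_all add: add.assoc)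

lemma sum_lessThan_mult:
  fixes f :: "nat \<Rightarrow> 'a::comm_monoid_add"
  shows "sum f {..<q * M} = (\<Sum>a<q. \<Sum>b<M. f (q * b + a))"
proof -
  have "sum f {..<q * M} = (\<Sum>b<M. \<Sum>a<q. f (q * b + a))"
  proof (induction M)
    case (Suc M)
    have "sum f {..<q * Suc M} = sum f {..<q * M} + (\<Sum>i<q. f (q * M + i))"
      using sum_lessThan_add[of f "q * M" q] by (simp add: add.commute)
    with Suc show ?case by simp
  qed simp
  then show ?thesis by (simp add: sum.swap[of _ "{..<M}"])
qed

text \<open>\<open>N\<close> and \<open>c\<close> may depend on \<open>f\<close>; uniformity in
  \<open>x\<close> is what matters. By integration every invariant probability measure gives
  \<open>e\<close> an integral within \<open>\<epsilon>\<close> of the same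
  \<open>c\<close>.\<close>

definition nearly_constant_average :: "('a::euclidean_space \<Rightarrow> real) \<Rightarrow> real \<Rightarrow> ('a \<Rightarrow> 'a) \<Rightarrow> bool" where
  "nearly_constant_average e \<epsilon> f \<longleftrightarrow> (\<exists>N\<ge>1. \<exists>c. \<forall>x\<in>sphere 0 1. \<bar>(\<Sum>k<N. e ((f ^^ k) x)) / real N - c\<bar> \<le> \<epsilon>)"

text \<open>The rotation number is \<open>t = p / q + 1 / (q * M)\<close>: along \<open>k = q * b + a\<close> the points \<open>k * t\<close> form
  \<open>q\<close> shifted arithmetic progressions with step \<open>1 / M\<close> modulo \<open>1\<close>.\<close>

lemma rational_orbit_average:
  fixes g :: "real^('n::finite \<times> 2) \<Rightarrow> real"
  assumes g: "continuous_on (sphere 0 1) g" and "\<epsilon> > 0" and "q \<ge> 1"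
  obtains M\<^sub>0 where "M\<^sub>0 \<ge> 1" "\<And>M y. M \<ge> M\<^sub>0 \<Longrightarrow> norm y = 1 \<Longrightarrow>
    \<bar>(\<Sum>k<q * M. g (rot (real k * (real (p * M + 1) / real (q * M))) y)) / real (q * M) - ravg g y\<bar> \<le> \<epsilon>"
proof -
  obtain \<delta> where \<delta>: "\<delta> > 0" "\<And>x s t. norm x = 1 \<Longrightarrow> \<bar>s - t\<bar> \<le> \<delta> \<Longrightarrow> \<bar>g (rot s x) - g (rot t x)\<bar> \<le> \<epsilon>"
    using rot_uniform[OF g \<open>\<epsilon> > 0\<close>] by blast
  obtain M\<^sub>0 where M0: "M\<^sub>0 \<ge> 1" "\<And>M. M \<ge> M\<^sub>0 \<Longrightarrow> 1 / real M \<le> \<delta>"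
    using exists_large_nat[OF \<delta>(1)] by blast
  show thesis
  proof (rule that[OF M0(1)])
    fix M and y :: "real^('n \<times> 2)" assume M: "M \<ge> M\<^sub>0" and y: "norm y = 1"
    define t where "t = real (p * M + 1) / real (q * M)"
    have qM: "real q > 0" "real M > 0" using \<open>q \<ge> 1\<close> M M0(1) by auto
    have "rot (real (q * b + a) * t) y = rot (real a * t + real b / real M) y" for a b
    proof -
      have "real (q * b + a) * t = (real a * t + real b / real M) + real (p * b)"
        using qM by (simp add: t_def field_simps)
      then show ?thesis by (simp only: rot_add rot_of_nat)
    qed
    then have "(\<Sum>k<q * M. g (rot (real k * t) y)) / real (q * M)
        = (\<Sum>a<q. \<Sum>b<M. g (rot (real a * t + real b / real M) y)) / real (q * M)"
      by (simp only: sum_lessThan_mult)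
    also have "\<dots> = (\<Sum>a<q. \<Sum>b<M. g (rot (real a * t + real b / real M) y)) / real M / real q"
      by (simp add: mult.commute)
    also have "(\<Sum>a<q. \<Sum>b<M. g (rot (real a * t + real b / real M) y)) / real M
        = (\<Sum>a<q. (\<Sum>b<M. g (rot (real a * t + real b / real M) y)) / real M)"
      by (rule sum_divide_distrib)
    finally have eq: "(\<Sum>k<q * M. g (rot (real k * t) y)) / real (q * M) = (\<Sum>a<q. (\<Sum>b<M. g (rot (real a * t + real b / real M) y)) / real M) / real q" .
    have "\<bar>(\<Sum>a<q. (\<Sum>b<M. g (rot (real a * t + real b / real M) y)) / real M) / real q - ravg g y\<bar> \<le> \<epsilon>"
    proof -
      have le: "\<bar>(\<Sum>b<M. g (rot (real a * t + real b / real M) y)) / real M - ravg g y\<bar> \<le> \<epsilon>" for a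
        unfolding ravg_def
      proof (rule riemann_sum_periodic[where g = "\<lambda>s. g (rot s y)"])
        show "continuous_on UNIV (\<lambda>s. g (rot s y))"
          by (rule continuous_on_rot_line[OF g y continuous_on_id])
        show "\<bar>g (rot s y) - g (rot s' y)\<bar> \<le> \<epsilon>" if "\<bar>s - s'\<bar> \<le> 1 / real M" for s s'
          using that M0(2)[OF M] y by (intro \<delta>) auto
      qed (use qM in auto)
      have "\<bar>(\<Sum>a<q. (\<Sum>b<M. g (rot (real a * t + real b / real M) y)) / real M - ravg g y)\<bar> \<le> (\<Sum>a<q. \<epsilon>)"
        by (rule order_trans[OF sum_abs sum_mono[OF le]])
      then have "\<bar>(\<Sum>a<q. (\<Sum>b<M. g (rot (real a * t + real b / real M) y)) / real M) - real q * ravg g y\<bar> / real q \<le> \<epsilon>"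
        using qM by (simp add: sum_subtractf pos_divide_le_eq mult.commute)
      moreover have "X / real q - r = (X - real q * r) / real q" for X r :: real
        using qM by (simp add: diff_divide_distrib)
      ultimately show ?thesis by (simp only: abs_divide abs_of_nat)
    qed
    then show "\<bar>(\<Sum>k<q * M. g (rot (real k * (real (p * M + 1) / real (q * M))) y)) / real (q * M) - ravg g y\<bar> \<le> \<epsilon>"
      unfolding eq[symmetric] by (simp only: t_def)
  qed
qed

text \<open>The last conclusion speaks of every \<open>f\<close> near the new conjugate because it
  is to be applied to the limit, which is not yet known. Conjugacy, rotation number and tolerance
  \<open>\<eta>\<^sub>1\<close> are chosen in this order, each depending on those before it.\<close>

lemma construction_step:
  fixes e :: "real^('n::finite \<times> 2) \<Rightarrow> real"
  assumes sym: "entire_symmetry h h' G G'" and "q \<ge> 1" and e: "continuous_on UNIV e"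
    and "\<epsilon> > 0" "\<eta> > 0"
  obtains l l' L L' p\<^sub>1 q\<^sub>1 \<eta>\<^sub>1 where "entire_symmetry l l' L L'" "q\<^sub>1 \<ge> 1" "0 < \<eta>\<^sub>1" "\<eta>\<^sub>1 \<le> \<eta> / 2"
    "\<And>z. z \<in> cball 0 R \<Longrightarrow>
      norm (L (rot (real p\<^sub>1 / real q\<^sub>1) (L' z)) - G (rot (real p / real q) (G' z))) \<le> \<eta> \<and>
      norm (L (rot (- (real p\<^sub>1 / real q\<^sub>1)) (L' z)) - G (rot (- (real p / real q)) (G' z))) \<le> \<eta>"
    "\<And>f. f \<in> sphere 0 1 \<rightarrow> sphere 0 1 \<Longrightarrow>
      \<forall>x\<in>sphere 0 1. norm (f x - l (rot (real p\<^sub>1 / real q\<^sub>1) (l' x))) \<le> 2 * \<eta>\<^sub>1 \<Longrightarrow>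
      nearly_constant_average e \<epsilon> f"
proof -
  have e4: "\<epsilon> / 4 > 0" and e2: "\<epsilon> / 2 > 0" using \<open>\<epsilon> > 0\<close> by auto
  have eh: "continuous_on (sphere 0 1) (e \<circ> h)"
    unfolding o_def by (intro continuous_on_compose2[OF e] entire_symmetryD[OF sym]) auto
  obtain k k' K K' c where k: "entire_symmetry k k' K K'" "commutes_rot q K"
    "\<And>x. norm x = 1 \<Longrightarrow> \<bar>ravg ((e \<circ> h) \<circ> k) x - c\<bar> \<le> \<epsilon> / 4"
    using mixing_symmetry[OF eh \<open>q \<ge> 1\<close> e4] by blast
  define l where "l = h \<circ> k"
  define l' where "l' = k' \<circ> h'"
  define L where "L = G \<circ> K"
  define L' where "L' = K' \<circ> G'"
  have l: "entire_symmetry l l' L L'"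
    unfolding l_def l'_def L_def L'_def by (rule entire_symmetry_compose[OF sym k(1)])
  have el: "continuous_on (sphere 0 1) (e \<circ> l)"
    unfolding o_def by (intro continuous_on_compose2[OF e] entire_symmetryD[OF l]) auto
  have KK': "K (K' z) = z" for z using k(1) by (simp add: entire_symmetry_def)
  have old: "L (rot (real p / real q) (L' z)) = G (rot (real p / real q) (G' z))"
    "L (rot (- (real p / real q)) (L' z)) = G (rot (- (real p / real q)) (G' z))" for z
    by (simp_all add: L_def L'_def commutes_rot_rational[OF k(2)] commutes_rot_rational_minus[OF k(2)] KK')
  have entL: "entire_vec L" "entire_vec L'" using l by (auto simp: entire_symmetry_def)
  obtain \<delta> where \<delta>: "\<delta> > 0" "\<And>s z. \<bar>s - real p / real q\<bar> \<le> \<delta> \<Longrightarrow> z \<in> cball 0 R \<Longrightarrow>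
      norm (L (rot s (L' z)) - L (rot (real p / real q) (L' z))) \<le> \<eta> \<and>
      norm (L (rot (- s) (L' z)) - L (rot (- (real p / real q)) (L' z))) \<le> \<eta>"
    using conjugated_rot_close[OF entL \<open>\<eta> > 0\<close>] by blast
  obtain M1 where M1: "M1 \<ge> 1" "\<And>M. M \<ge> M1 \<Longrightarrow> 1 / real M \<le> \<delta>"
    using exists_large_nat[OF \<delta>(1)] by blast
  obtain M2 where M2: "M2 \<ge> 1" "\<And>M y. M \<ge> M2 \<Longrightarrow> norm y = 1 \<Longrightarrow>
      \<bar>(\<Sum>i<q * M. (e \<circ> l) (rot (real i * (real (p * M + 1) / real (q * M))) y)) / real (q * M)
        - ravg (e \<circ> l) y\<bar> \<le> \<epsilon> / 4"
    using rational_orbit_average[OF el e4 \<open>q \<ge> 1\<close>, where p = p] by blast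
  \<comment> \<open>\<open>M1\<close> keeps the new rotation number within \<open>\<delta>\<close>
    of the old one; \<open>M2\<close> makes an orbit of length \<open>N\<close> equidistributed
    enough for \<open>e \<circ> l\<close>.\<close>
  define M where "M = max M1 M2"
  define N where "N = q * M"
  define p1 where "p1 = p * M + 1"
  define t where "t = real p1 / real N"
  have M: "M \<ge> M1" "M \<ge> M2" "M \<ge> 1" using M1(1) by (auto simp: M_def)
  have N: "N \<ge> 1" using M \<open>q \<ge> 1\<close> by (simp add: N_def)
  have "t - real p / real q = 1 / (real q * real M)"
    using M \<open>q \<ge> 1\<close> by (simp add: t_def p1_def N_def field_simps)
  also have "\<dots> \<le> 1 / real M"
    using M \<open>q \<ge> 1\<close> by (intro divide_left_mono) auto
  finally have t: "\<bar>t - real p / real q\<bar> \<le> \<delta>"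
    using M1(2)[OF M(1)] \<open>t - real p / real q = 1 / (real q * real M)\<close> by simp
  define f\<^sub>0 where "f\<^sub>0 = (\<lambda>x. l (rot t (l' x)))"
  have f0: "continuous_on (sphere 0 1) f\<^sub>0" "f\<^sub>0 \<in> sphere 0 1 \<rightarrow> sphere 0 1"
    unfolding f\<^sub>0_def
    by (intro continuous_on_compose2[OF entire_symmetryD(5)[OF l, of UNIV]] continuous_intros
        entire_symmetryD[OF l] subset_UNIV) (auto simp: entire_symmetryD[OF l])
  have avg0: "\<bar>(\<Sum>i<N. e ((f\<^sub>0 ^^ i) x)) / real N - c\<bar> \<le> \<epsilon> / 2" if x: "norm x = 1" for x
  proof -
    have y: "norm (l' x) = 1" using x entire_symmetryD[OF l] by simp
    have "e ((f\<^sub>0 ^^ i) x) = (e \<circ> l) (rot (real i * t) (l' x))" for i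
      unfolding f\<^sub>0_def conj_rot_power[OF l] by simp
    then have "\<bar>(\<Sum>i<N. e ((f\<^sub>0 ^^ i) x)) / real N - ravg (e \<circ> l) (l' x)\<bar> \<le> \<epsilon> / 4"
      using M2(2)[OF M(2) y] by (simp only: N_def t_def p1_def)
    moreover have "\<bar>ravg (e \<circ> l) (l' x) - c\<bar> \<le> \<epsilon> / 4"
      using k(3)[OF y] by (simp add: l_def o_assoc)
    ultimately show ?thesis by linarith
  qed
  obtain \<rho> where \<rho>: "\<rho> > 0" "\<And>x y. norm x = 1 \<Longrightarrow> norm y = 1 \<Longrightarrow> norm (x - y) \<le> \<rho> \<Longrightarrow> \<bar>e x - e y\<bar> \<le> \<epsilon> / 2"
    using sphere_uniform[OF continuous_on_subset[OF e subset_UNIV] e2] by blast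
  obtain \<eta>' where \<eta>': "\<eta>' > 0" "\<And>f k x. f \<in> sphere 0 1 \<rightarrow> sphere 0 1 \<Longrightarrow>
      \<forall>x\<in>sphere 0 1. norm (f x - f\<^sub>0 x) \<le> \<eta>' \<Longrightarrow> k \<le> N \<Longrightarrow> x \<in> sphere 0 1 \<Longrightarrow>
      norm ((f ^^ k) x - (f\<^sub>0 ^^ k) x) \<le> \<rho>"
    using iterates_close[OF f0 \<rho>(1), of N] by blast
  show thesis
  proof (rule that[OF l N])
    \<comment> \<open>Half of \<open>\<eta>'\<close>, because the later steps move the map by at
      most twice the tolerance, the sum of a geometric series.\<close>
    show "0 < min (\<eta> / 2) (\<eta>' / 2)" "min (\<eta> / 2) (\<eta>' / 2) \<le> \<eta> / 2"
      using \<open>\<eta> > 0\<close> \<eta>'(1) by auto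
    show "norm (L (rot (real p1 / real N) (L' z)) - G (rot (real p / real q) (G' z))) \<le> \<eta> \<and>
      norm (L (rot (- (real p1 / real N)) (L' z)) - G (rot (- (real p / real q)) (G' z))) \<le> \<eta>"
      if "z \<in> cball 0 R" for z
      using \<delta>(2)[OF t that] by (simp only: old t_def)
    fix f :: "real^('n \<times> 2) \<Rightarrow> real^('n \<times> 2)"
    assume f: "f \<in> sphere 0 1 \<rightarrow> sphere 0 1"
      and "\<forall>x\<in>sphere 0 1. norm (f x - l (rot (real p1 / real N) (l' x))) \<le> 2 * min (\<eta> / 2) (\<eta>' / 2)"
    then have close: "\<forall>x\<in>sphere 0 1. norm (f x - f\<^sub>0 x) \<le> \<eta>'"
      unfolding f\<^sub>0_def t_def by (fastforce simp: min_def split: if_splits)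
    show "nearly_constant_average e \<epsilon> f"
      unfolding nearly_constant_average_def
    proof (intro exI conjI ballI)
      show "1 \<le> N" by (rule N)
      fix x :: "real^('n \<times> 2)" assume x: "x \<in> sphere 0 1"
      have in_S: "(g ^^ i) x \<in> sphere 0 1" if "g \<in> sphere 0 1 \<rightarrow> sphere 0 1" for g :: "real^('n \<times> 2) \<Rightarrow> real^('n \<times> 2)" and i
        by (rule funpow_closed[OF that x])
      have "\<bar>e ((f ^^ i) x) - e ((f\<^sub>0 ^^ i) x)\<bar> \<le> \<epsilon> / 2" if "i < N" for i
        using in_S[OF f, of i] in_S[OF f0(2), of i] \<eta>'(2)[OF f close _ x, of i] that by (intro \<rho>) auto
      then have "\<bar>\<Sum>i<N. e ((f ^^ i) x) - e ((f\<^sub>0 ^^ i) x)\<bar> \<le> (\<Sum>i<N. \<epsilon> / 2)"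
        by (intro order_trans[OF sum_abs sum_mono]) auto
      then have "\<bar>(\<Sum>i<N. e ((f ^^ i) x)) - (\<Sum>i<N. e ((f\<^sub>0 ^^ i) x))\<bar> / real N \<le> \<epsilon> / 2"
        using N by (simp add: sum_subtractf field_simps)
      then have "\<bar>(\<Sum>i<N. e ((f ^^ i) x)) / real N - (\<Sum>i<N. e ((f\<^sub>0 ^^ i) x)) / real N\<bar> \<le> \<epsilon> / 2"
        by (simp add: diff_divide_distrib[symmetric] abs_divide)
      moreover have "\<bar>(\<Sum>i<N. e ((f\<^sub>0 ^^ i) x)) / real N - c\<bar> \<le> \<epsilon> / 2"
        using x by (intro avg0) simp
      ultimately show "\<bar>(\<Sum>k<N. e ((f ^^ k) x)) / real N - c\<bar> \<le> \<epsilon>"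
        by linarith
    qed
  qed
qed

subsection \<open>Unique ergodicity\<close>

lemma integral_funpow_invariant:
  fixes g :: "'a::euclidean_space \<Rightarrow> real"
  assumes M: "sphere_measure M" "invariant_measure M f" and f: "continuous_on (sphere 0 1) f" "f \<in> sphere 0 1 \<rightarrow> sphere 0 1"
    and g: "continuous_on (sphere 0 1) g"
  shows "continuous_on (sphere 0 1) (\<lambda>x. g ((f ^^ k) x)) \<and> (\<integral>x. g ((f ^^ k) x) \<partial>M) = (\<integral>x. g x \<partial>M)"
proof (induction k)
  case (Suc k)
  have "continuous_on (sphere 0 1) (\<lambda>x. g ((f ^^ k) (f x)))"
    using f by (intro continuous_on_compose2[OF conjunct1[OF Suc]]) auto
  moreover have "(\<integral>x. g ((f ^^ k) (f x)) \<partial>M) = (\<integral>x. g ((f ^^ k) x) \<partial>M)"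
    using Suc by (intro integral_invariant_measure[OF M]) auto
  ultimately show ?case using Suc by (simp add: funpow_swap1)
qed (use g in simp)

text \<open>Integrating the Birkhoff average against an invariant measure gives the integral of
  \<open>e\<close>, and the total mass is 1.\<close>

lemma nearly_constant_average_integral:
  fixes e :: "'a::euclidean_space \<Rightarrow> real"
  assumes M: "sphere_measure M" "prob_space M" "invariant_measure M f"
    and f: "continuous_on (sphere 0 1) f" "f \<in> sphere 0 1 \<rightarrow> sphere 0 1"
    and e: "continuous_on (sphere 0 1) e" and N: "N \<ge> 1"
    and le: "\<And>x. norm x = 1 \<Longrightarrow> \<bar>(\<Sum>k<N. e ((f ^^ k) x)) / real N - c\<bar> \<le> \<epsilon>"
  shows "\<bar>(\<integral>x. e x \<partial>M) - c\<bar> \<le> \<epsilon>"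
proof -
  interpret prob_space M by (rule M(2))
  note pow = integral_funpow_invariant[OF M(1,3) f e]
  have "(\<integral>x. (\<Sum>k<N. e ((f ^^ k) x)) / real N \<partial>M) = (\<Sum>k<N. \<integral>x. e ((f ^^ k) x) \<partial>M) / real N"
    using pow sphere_measure_integrable[OF M(1)] by simp
  also have "\<dots> = (\<integral>x. e x \<partial>M)" using N pow by simp
  finally have eq: "(\<integral>x. (\<Sum>k<N. e ((f ^^ k) x)) / real N \<partial>M) = (\<integral>x. e x \<partial>M)" .
  have "\<bar>(\<integral>x. (\<Sum>k<N. e ((f ^^ k) x)) / real N \<partial>M) - (\<integral>x. c \<partial>M)\<bar> \<le> \<epsilon> * measure M (space M)"
    using pow N le by (intro sphere_measure_integral_diff_le[OF M(1)] continuous_on_divide continuous_on_sum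
        continuous_on_const) auto
  then show ?thesis unfolding eq by (simp add: prob_space)
qed

text \<open>The volume divided by its total mass remains invariant.\<close>

lemma exists_invariant_probability:
  fixes f :: "'a::euclidean_space \<Rightarrow> 'a"
  assumes "invariant_measure sphere_volume f"
  shows "\<exists>M. sets M = sets (restrict_space borel (sphere 0 1)) \<and> prob_space M \<and> invariant_measure M f"
proof -
  let ?V = "sphere_volume :: 'a measure"
  let ?v = "emeasure ?V (sphere 0 1)"
  let ?M = "scale_measure (inverse ?v) ?V"
  have v: "?v \<noteq> 0" "?v \<noteq> \<infinity>"
    using sphere_volume_pos[where 'a = 'a] finite_measure.emeasure_finite[OF finite_sphere_volume[where 'a = 'a]]
    by auto
  have f: "f \<in> measurable ?V ?V" "distr ?V ?V f = ?V"
    using assms by (auto simp: invariant_measure_def)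
  have fM: "f \<in> measurable ?M ?M"
    using f(1) by (simp add: measurable_def space_scale_measure)
  have "distr ?M ?M f = ?M"
  proof (rule measure_eqI)
    fix A assume "A \<in> sets (distr ?M ?M f)"
    then have A: "A \<in> sets ?V" by simp
    have "emeasure ?V (f -` A \<inter> space ?V) = emeasure ?V A"
      using emeasure_distr[OF f(1) A] f(2) by simp
    then show "emeasure (distr ?M ?M f) A = emeasure ?M A"
      using fM A by (simp add: emeasure_distr space_scale_measure)
  qed simp
  moreover have "prob_space ?M"
  proof (rule prob_spaceI)
    have "inverse ?v * ?v = ?v / ?v" by (simp add: divide_ennreal_def mult.commute)
    then show "emeasure ?M (space ?M) = 1"
      using v by (simp add: space_scale_measure ennreal_divide_self top.not_eq_extremum)
  qed
  moreover have "sets ?M = sets (restrict_space borel (sphere 0 1))" by (simp add: sets_sphere_volume)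
  ultimately show ?thesis using fM unfolding invariant_measure_def by blast
qed

text \<open>For two invariant probability measures the integrals of each \<open>e j\<close> lie
  within \<open>\<epsilon> / 2\<close> of a common constant, for every positive
  \<open>\<epsilon>\<close>.\<close>

lemma uniquely_ergodicI:
  fixes f f' :: "real^('n::finite \<times> 2) \<Rightarrow> real^('n \<times> 2)"
  assumes f: "continuous_on (sphere 0 1) f" "f \<in> sphere 0 1 \<rightarrow> sphere 0 1"
    and f': "continuous_on (sphere 0 1) f'" "f' \<in> sphere 0 1 \<rightarrow> sphere 0 1"
    and inv: "\<And>x. x \<in> sphere 0 1 \<Longrightarrow> f' (f x) = x" "\<And>x. x \<in> sphere 0 1 \<Longrightarrow> f (f' x) = x"
    and vol: "invariant_measure sphere_volume f"
    and e: "\<And>j. continuous_on UNIV (e j)"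
    and det: "\<And>M N. \<lbrakk>sphere_measure M; sphere_measure N; \<And>j. (\<integral>x. e j x \<partial>M) = (\<integral>x. e j x \<partial>N)\<rbrakk> \<Longrightarrow> M = N"
    and avg: "\<And>j \<epsilon>. \<epsilon> > 0 \<Longrightarrow> nearly_constant_average (e (j::nat)) \<epsilon> f"
  shows "uniquely_ergodic_on (sphere 0 1) f"
  unfolding uniquely_ergodic_on_def
proof (intro conjI)
  show "compact (sphere (0 :: real^('n \<times> 2)) 1)" by simp
  have "homeomorphism (sphere 0 1) (sphere 0 1) f f'"
    using f f' inv by (intro homeomorphismI) auto
  then show "\<exists>g. homeomorphism (sphere 0 1) (sphere 0 1) f g" by blast
  have uniq: "M = M'"
    if M: "sphere_measure M" "prob_space M" "invariant_measure M f"
      and M': "sphere_measure M'" "prob_space M'" "invariant_measure M' f" for M M'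
  proof (rule det[OF M(1) M'(1)])
    fix j
    have ej: "continuous_on (sphere 0 1) (e j)" by (rule continuous_on_subset[OF e]) auto
    have "\<bar>(\<integral>x. e j x \<partial>M) - (\<integral>x. e j x \<partial>M')\<bar> \<le> 0 + \<epsilon>" if "\<epsilon> > 0" for \<epsilon>
    proof -
      have "\<epsilon> / 2 > 0" using that by simp
      from avg[OF this, of j] obtain N c where "N \<ge> 1"
        "\<forall>x\<in>sphere 0 1. \<bar>(\<Sum>k<N. e j ((f ^^ k) x)) / real N - c\<bar> \<le> \<epsilon> / 2"
        unfolding nearly_constant_average_def by blast
      then have N: "N \<ge> 1"
        "\<And>x. norm x = 1 \<Longrightarrow> \<bar>(\<Sum>k<N. e j ((f ^^ k) x)) / real N - c\<bar> \<le> \<epsilon> / 2"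
        by auto
      show ?thesis
        using nearly_constant_average_integral[OF M f ej N] nearly_constant_average_integral[OF M' f ej N]
        by linarith
    qed
    then have "\<bar>(\<integral>x. e j x \<partial>M) - (\<integral>x. e j x \<partial>M')\<bar> \<le> 0" by (rule field_le_epsilon)
    then show "(\<integral>x. e j x \<partial>M) = (\<integral>x. e j x \<partial>M')" by simp
  qed
  have "sphere_measure M" if "sets M = sets (restrict_space borel (sphere 0 1))" "prob_space M" for M :: "(real^('n \<times> 2)) measure"
    using that by (simp add: sphere_measure_def prob_space_def)
  with uniq exists_invariant_probability[OF vol]
  show "\<exists>!M. sets M = sets (restrict_space borel (sphere 0 1)) \<and> prob_space M \<and> invariant_measure M f"
    by blast
qed

subsection \<open>Passage to the limit\<close>

lemma halving_le:
  fixes \<eta> :: "nat \<Rightarrow> real"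
  assumes "\<And>n. \<eta> (Suc n) \<le> \<eta> n / 2"
  shows "\<eta> n \<le> \<eta> 0 / 2 ^ n"
proof (induction n)
  case (Suc n)
  then show ?case using assms[of n] by simp
qed simp

lemma halving_tendsto_0:
  fixes \<eta> :: "nat \<Rightarrow> real"
  assumes "\<And>n. \<eta> n > 0" "\<And>n. \<eta> (Suc n) \<le> \<eta> n / 2"
  shows "\<eta> \<longlonglongrightarrow> 0"
proof (rule tendsto_sandwich)
  show "\<forall>\<^sub>F n in sequentially. 0 \<le> \<eta> n" using assms(1) by (simp add: less_imp_le)
  show "\<forall>\<^sub>F n in sequentially. \<eta> n \<le> \<eta> 0 / 2 ^ n" using halving_le[of \<eta>, OF assms(2)] by simp
  show "(\<lambda>n. \<eta> 0 / 2 ^ n) \<longlonglongrightarrow> 0"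
    using LIMSEQ_divide_realpow_zero[of 2 "\<eta> 0"] by simp
qed auto

lemma tendsto_norm_diff_le:
  fixes a :: "nat \<Rightarrow> 'a::real_normed_vector"
  assumes "\<And>n. norm (a n - l) \<le> b n" "b \<longlonglongrightarrow> 0"
  shows "a \<longlonglongrightarrow> l"
  by (rule LIM_zero_cancel, rule Lim_null_comparison[OF always_eventually[OF allI[OF assms(1)]] assms(2)])

lemma halving_limit:
  fixes a :: "nat \<Rightarrow> 'a::banach"
  assumes \<eta>: "\<And>n. \<eta> n > 0" "\<And>n. \<eta> (Suc n) \<le> \<eta> n / 2"
    and a: "\<And>n. norm (a (Suc n) - a n) \<le> \<eta> n"
  shows "\<exists>l. \<forall>n. norm (a n - l) \<le> 2 * \<eta> n"
proof -
  \<comment> \<open>The subtracted term makes the induction work: a step of size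
    \<open>\<eta> (n + k)\<close> is paid for by the drop from \<open>2 * \<eta> (n + k)\<close> to
    \<open>2 * \<eta> (n + Suc k)\<close>.\<close>
  have tail: "norm (a (n + k) - a n) \<le> 2 * \<eta> n - 2 * \<eta> (n + k)" for n k
  proof (induction k)
    case (Suc k)
    have "norm (a (n + Suc k) - a n) \<le> norm (a (Suc (n + k)) - a (n + k)) + norm (a (n + k) - a n)"
      using norm_triangle_ineq[of "a (Suc (n + k)) - a (n + k)" "a (n + k) - a n"] by simp
    then show ?case using Suc a[of "n + k"] \<eta>(2)[of "n + k"] by simp
  qed simp
  then have tail': "norm (a (n + k) - a n) \<le> 2 * \<eta> n" for n k
    using \<eta>(1)[of "n + k"] by (smt (verit))
  have "Cauchy a"
  proof (rule metric_CauchyI)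
    fix \<epsilon> :: real assume "\<epsilon> > 0"
    then have "\<forall>\<^sub>F n in sequentially. \<eta> n < \<epsilon> / 4"
      by (intro order_tendstoD(2)[OF halving_tendsto_0[of \<eta>, OF \<eta>]]) auto
    then obtain N where N: "\<eta> N < \<epsilon> / 4" by (auto simp: eventually_sequentially)
    have "dist (a m) (a n) < \<epsilon>" if "m \<ge> N" "n \<ge> N" for m n
      using tail'[of N "m - N"] tail'[of N "n - N"] that N
        norm_triangle_ineq4[of "a m - a N" "a n - a N"] by (simp add: dist_norm)
    then show "\<exists>M. \<forall>m\<ge>M. \<forall>n\<ge>M. dist (a m) (a n) < \<epsilon>" by blast
  qed
  then obtain l where l: "a \<longlonglongrightarrow> l" by (auto simp: Cauchy_convergent_iff convergent_def)
  have "norm (a n - l) \<le> 2 * \<eta> n" for n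
  proof (rule Lim_bounded)
    show "(\<lambda>m. norm (a n - a m)) \<longlonglongrightarrow> norm (a n - l)" by (intro tendsto_intros l)
    show "\<forall>m\<ge>n. norm (a n - a m) \<le> 2 * \<eta> n"
      using tail'[of n] by (metis le_add_diff_inverse norm_minus_commute)
  qed
  then show ?thesis by blast
qed

lemma invariant_measure_inverse:
  assumes "sphere_measure M" "entire_symmetry h h' G G'" "invariant_measure M h"
  shows "invariant_measure M h'"
proof -
  have h': "h' \<in> measurable M M"
    using assms entire_symmetryD[OF assms(2)]
    by (intro measurable_sphere_cont) (auto simp: sphere_measure_def)
  have h: "h \<in> measurable M M" "distr M M h = M" using assms(3) by (auto simp: invariant_measure_def)
  have "distr M M h' = distr (distr M M h) M h'" using h(2) by simp
  also have "\<dots> = distr M M (h' \<circ> h)" by (rule distr_distr[OF h' h(1)])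
  also have "h' \<circ> h = (\<lambda>x. x)" using entire_symmetryD[OF assms(2)] by auto
  finally have "distr M M h' = M" by (simp add: distr_id)
  then show ?thesis using h' by (simp add: invariant_measure_def)
qed

lemma invariant_measure_rot: "invariant_measure sphere_volume (rot t :: real^('n::finite \<times> 2) \<Rightarrow> _)"
proof (rule invariant_sphere_volume_orthogonal)
  have "linear (rot t :: real^('n \<times> 2) \<Rightarrow> _)"
    by (rule linearI) (simp_all add: vec2_eq_iff rot_nth algebra_simps)
  then show "orthogonal_transformation (rot t :: real^('n \<times> 2) \<Rightarrow> _)"
    by (simp add: orthogonal_transformation)
qed

lemma invariant_measure_conj_rot:
  assumes "entire_symmetry h h' G G'"
  shows "invariant_measure sphere_volume (\<lambda>x. h (rot t (h' x)))"
proof -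
  have h: "invariant_measure sphere_volume h" using assms by (simp add: entire_symmetry_def)
  have "invariant_measure sphere_volume (h \<circ> (rot t \<circ> h'))"
    by (intro invariant_measure_compose h invariant_measure_rot
        invariant_measure_inverse[OF sphere_measure_volume assms h])
  then show ?thesis by (simp add: o_def)
qed

text \<open>Invariance is tested on integrals of continuous functions, for which uniform convergence
  of the maps is enough.\<close>

lemma invariant_measure_limit:
  fixes f :: "'a::euclidean_space \<Rightarrow> 'a"
  assumes M: "sphere_measure M" and f: "continuous_on (sphere 0 1) f" "f \<in> sphere 0 1 \<rightarrow> sphere 0 1"
    and fn: "\<And>n. invariant_measure M (fn n)" "\<And>n. continuous_on (sphere 0 1) (fn n)" "\<And>n. fn n \<in> sphere 0 1 \<rightarrow> sphere 0 1"
    and lim: "\<And>n x. x \<in> sphere 0 1 \<Longrightarrow> norm (fn n x - f x) \<le> \<eta> n" and \<eta>: "\<eta> \<longlonglongrightarrow> (0::real)"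
  shows "invariant_measure M f"
proof (rule invariant_measureI[OF M f])
  fix g :: "'a \<Rightarrow> real" assume "continuous_on UNIV g"
  then have g: "continuous_on (sphere 0 1) g" by (rule continuous_on_subset) auto
  let ?v = "measure M (space M)"
  have "\<bar>(\<integral>x. g (f x) \<partial>M) - (\<integral>x. g x \<partial>M)\<bar> \<le> 0 + \<epsilon>" if "\<epsilon> > 0" for \<epsilon>
  proof -
    have v: "?v + 1 > 0" by (simp add: add_nonneg_pos)
    with that have "\<epsilon> / (?v + 1) > 0" by simp
    then obtain \<delta> where \<delta>: "\<delta> > 0" "\<And>x y. norm x = 1 \<Longrightarrow> norm y = 1 \<Longrightarrow> norm (x - y) \<le> \<delta> \<Longrightarrow>
        \<bar>g x - g y\<bar> \<le> \<epsilon> / (?v + 1)"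
      using sphere_uniform[OF g] by blast
    obtain n where n: "\<eta> n < \<delta>"
      using order_tendstoD(2)[OF \<eta> \<delta>(1)] by (auto simp: eventually_sequentially)
    have "\<bar>(\<integral>x. g (f x) \<partial>M) - (\<integral>x. g (fn n x) \<partial>M)\<bar> \<le> \<epsilon> / (?v + 1) * ?v"
    proof (rule sphere_measure_integral_diff_le[OF M])
      show "continuous_on (sphere 0 1) (\<lambda>x. g (f x))" "continuous_on (sphere 0 1) (\<lambda>x. g (fn n x))"
        using f fn by (blast intro: continuous_on_compose2[OF g])+
      show "\<bar>g (f x) - g (fn n x)\<bar> \<le> \<epsilon> / (?v + 1)" if "norm x = 1" for x
        using lim[of x n] f(2) fn(3)[of n] n that by (intro \<delta>) (auto simp: norm_minus_commute)
    qed
    also have "\<epsilon> / (?v + 1) * ?v \<le> \<epsilon> / (?v + 1) * (?v + 1)"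
      using that v by (intro mult_left_mono) auto
    also have "\<dots> = \<epsilon>" using v by simp
    finally show ?thesis using integral_invariant_measure[OF M fn(1) g, of n] by simp
  qed
  then have "\<bar>(\<integral>x. g (f x) \<partial>M) - (\<integral>x. g x \<partial>M)\<bar> \<le> 0" by (rule field_le_epsilon)
  then show "(\<integral>x. g (f x) \<partial>M) = (\<integral>x. g x \<partial>M)" by simp
qed

text \<open>The inverse of the limit does not enter, so this can be applied to \<open>t\<close> and
  to \<open>- t\<close> separately. Of the radius \<open>\<Delta> + 2\<close>, one unit is lost in
  Cauchy's inequality, and the remaining ball of radius \<open>\<Delta> + 1\<close> contains both
  the unit sphere and \<open>cball 0 \<Delta>\<close>.\<close>

lemma conj_rot_limit:
  fixes h h' :: "nat \<Rightarrow> real^('n::finite \<times> 2) \<Rightarrow> real^('n \<times> 2)"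
  assumes sym: "\<And>n. entire_symmetry (h n) (h' n) (G n) (G' n)"
    and \<eta>: "\<And>n. \<eta> n > 0" "\<And>n. \<eta> (Suc n) \<le> \<eta> n / 2" and "\<Delta> > 0"
    and step: "\<And>n z. z \<in> cball 0 (\<Delta> + 2) \<Longrightarrow>
      norm (G (Suc n) (rot (t (Suc n)) (G' (Suc n) z)) - G n (rot (t n) (G' n z))) \<le> \<eta> n"
  obtains f F where
    "\<And>n z. z \<in> cball 0 (\<Delta> + 2) \<Longrightarrow> norm (G n (rot (t n) (G' n z)) - F z) \<le> 2 * \<eta> n"
    "\<And>n x. x \<in> sphere 0 1 \<Longrightarrow> norm (h n (rot (t n) (h' n x)) - f x) \<le> 2 * \<eta> n"
    "f \<in> sphere 0 1 \<rightarrow> sphere 0 1" "continuous_on (sphere 0 1) f" "analytic_map_ext \<Delta> f F"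
    "invariant_measure sphere_volume f"
proof -
  define T where "T n z = G n (rot (t n) (G' n z))" for n z
  define g where "g n x = h n (rot (t n) (h' n x))" for n x
  have Tg: "T n (cvec x) = cvec (g n x)" for n x
    unfolding T_def g_def by (rule entire_symmetry_conj_rot[OF sym])
  have g_norm: "norm (g n x) = norm x" for n x
    by (simp add: g_def entire_symmetryD[OF sym])
  have g_cont: "continuous_on A (g n)" for n A
    unfolding g_def
    by (intro continuous_on_compose2[OF entire_symmetryD(5)[OF sym, of UNIV]] continuous_intros
        entire_symmetryD(6)[OF sym]) auto
  have sphere: "cvec x \<in> cball 0 (\<Delta> + 2)" if "x \<in> sphere 0 1" for x
    using that \<open>\<Delta> > 0\<close> by simp
  have "\<exists>l. z \<in> cball 0 (\<Delta> + 2) \<longrightarrow> (\<forall>n. norm (T n z - l) \<le> 2 * \<eta> n)" for z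
    using halving_limit[of \<eta> "\<lambda>n. T n z", OF \<eta>] step[of z] unfolding T_def by blast
  then obtain F where F: "\<And>n z. z \<in> cball 0 (\<Delta> + 2) \<Longrightarrow> norm (T n z - F z) \<le> 2 * \<eta> n"
    by metis
  have "\<exists>l. x \<in> sphere 0 1 \<longrightarrow> (\<forall>n. norm (g n x - l) \<le> 2 * \<eta> n)" for x
  proof (cases "x \<in> sphere 0 1")
    case True
    have "norm (g (Suc n) x - g n x) \<le> \<eta> n" for n
      using step[OF sphere[OF True], of n] unfolding T_def[symmetric] Tg norm_cvec_diff .
    then show ?thesis using halving_limit[of \<eta> "\<lambda>n. g n x", OF \<eta>] by blast
  qed auto
  then obtain f where f: "\<And>n x. x \<in> sphere 0 1 \<Longrightarrow> norm (g n x - f x) \<le> 2 * \<eta> n"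
    by metis
  have \<eta>0: "(\<lambda>n. 2 * \<eta> n) \<longlonglongrightarrow> 0"
    using tendsto_mult_right_zero[OF halving_tendsto_0[of \<eta>, OF \<eta>]] by simp
  have g_lim: "(\<lambda>n. g n x) \<longlonglongrightarrow> f x" if "x \<in> sphere 0 1" for x
    by (rule tendsto_norm_diff_le[OF f[OF that] \<eta>0])
  have T_lim: "(\<lambda>n. T n z) \<longlonglongrightarrow> F z" if "z \<in> cball 0 (\<Delta> + 2)" for z
    by (rule tendsto_norm_diff_le[OF F[OF that] \<eta>0])
  have fF: "F (cvec x) = cvec (f x)" if x: "x \<in> sphere 0 1" for x
  proof (rule LIMSEQ_unique)
    show "(\<lambda>n. T n (cvec x)) \<longlonglongrightarrow> F (cvec x)" by (rule T_lim[OF sphere[OF x]])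
    show "(\<lambda>n. T n (cvec x)) \<longlonglongrightarrow> cvec (f x)"
      unfolding Tg by (rule bounded_linear.tendsto[OF bounded_linear_cvec g_lim[OF x]])
  qed
  have f_S: "f \<in> sphere 0 1 \<rightarrow> sphere 0 1"
  proof
    fix x :: "real^('n \<times> 2)" assume x: "x \<in> sphere 0 1"
    have "(\<lambda>n. norm (g n x)) \<longlonglongrightarrow> norm (f x)" by (intro tendsto_norm g_lim x)
    then have "norm (f x) = norm x" by (simp add: g_norm LIMSEQ_const_iff)
    with x show "f x \<in> sphere 0 1" by simp
  qed
  have f_cont: "continuous_on (sphere 0 1) f"
  proof (rule uniform_limit_theorem[of _ g sequentially])
    show "uniform_limit (sphere 0 1) g f sequentially"
      unfolding uniform_limit_iff
    proof (intro allI impI)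
      fix \<epsilon> :: real assume "\<epsilon> > 0"
      then have "\<forall>\<^sub>F n in sequentially. 2 * \<eta> n < \<epsilon>" by (rule order_tendstoD(2)[OF \<eta>0])
      then show "\<forall>\<^sub>F n in sequentially. \<forall>x\<in>sphere 0 1. dist (g n x) (f x) < \<epsilon>"
        by eventually_elim (auto simp only: dist_norm intro: le_less_trans[OF f])
    qed
  qed (auto simp: g_cont)
  have ent: "entire_vec (T n)" for n
  proof -
    have "entire_vec (G n \<circ> (rot (t n) \<circ> G' n))"
      using sym[of n] by (intro entire_vec_compose entire_rot) (auto simp: entire_symmetry_def)
    then show ?thesis by (simp add: T_def[abs_def] o_def)
  qed
  have hol: "holomorphic_cn_on (\<lambda>z. F z $ i) (ball 0 (\<Delta> + 1))" for i
  proof (rule holomorphic_cn_uniform_limit)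
    show "holomorphic_cn_on (\<lambda>z. T n z $ i) UNIV" for n using ent unfolding entire_vec_def by blast
    fix \<epsilon> :: real assume "\<epsilon> > 0"
    then have "\<forall>\<^sub>F n in sequentially. 2 * \<eta> n < \<epsilon>" by (rule order_tendstoD(2)[OF \<eta>0])
    then obtain N where N: "\<And>n. n \<ge> N \<Longrightarrow> 2 * \<eta> n < \<epsilon>" by (auto simp: eventually_sequentially)
    have "cmod (T n z $ i - F z $ i) \<le> \<epsilon>" if "n \<ge> N" "z \<in> cball 0 (\<Delta> + 1 + 1)" for n z
    proof -
      have "cmod (T n z $ i - F z $ i) \<le> norm (T n z - F z)"
        using Finite_Cartesian_Product.norm_nth_le[of "T n z - F z" i] by simp
      also have "\<dots> \<le> 2 * \<eta> n" using that by (intro F) (simp add: add.assoc)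
      finally show ?thesis using N[OF that(1)] by simp
    qed
    then show "\<exists>N. \<forall>n\<ge>N. \<forall>z\<in>cball 0 (\<Delta> + 1 + 1). cmod (T n z $ i - F z $ i) \<le> \<epsilon>" by blast
  qed
  have "cvec ` sphere 0 1 \<union> cball 0 \<Delta> \<subseteq> ball 0 (\<Delta> + 1)" using \<open>\<Delta> > 0\<close> by auto
  then have ext: "analytic_map_ext \<Delta> f F"
    unfolding analytic_map_ext_def analytic_ext_def using f_S hol by (auto simp: fF intro!: exI[of _ "ball 0 (\<Delta> + 1)"])
  have "invariant_measure sphere_volume f"
  proof (rule invariant_measure_limit[where fn = g and \<eta> = "\<lambda>n. 2 * \<eta> n", OF sphere_measure_volume f_cont f_S])
    show "invariant_measure sphere_volume (g n)" for n
      unfolding g_def by (rule invariant_measure_conj_rot[OF sym])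
  qed (use g_cont g_norm f \<eta>0 in auto)
  with F f f_S f_cont ext show thesis
    by (intro that) (auto simp: T_def g_def)
qed

section \<open>Diffeomorphisms, distances and the sequence of conjugacies\<close>

lemma analytic_map_ext_cong:
  assumes "analytic_map_ext \<Delta> f F" "\<And>x. x \<in> sphere 0 1 \<Longrightarrow> g x = f x"
  shows "analytic_map_ext \<Delta> g F"
  using assms by (auto simp: analytic_map_ext_def analytic_ext_def Pi_iff)

lemma entire_map_ext_cong:
  assumes "entire_map_ext f F" "\<And>x. x \<in> sphere 0 1 \<Longrightarrow> g x = f x"
  shows "entire_map_ext g F"
  using assms by (auto simp: entire_map_ext_def entire_ext_def Pi_iff)

text \<open>Off the sphere \<open>f'\<close> and \<open>inv_into (sphere 0 1) f\<close> may differ,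
  hence the congruence lemmas above.\<close>

lemma inverse_on_sphere:
  fixes f f' :: "'a::real_normed_vector \<Rightarrow> 'a"
  assumes "f \<in> sphere 0 1 \<rightarrow> sphere 0 1" "f' \<in> sphere 0 1 \<rightarrow> sphere 0 1"
    and "\<And>x. x \<in> sphere 0 1 \<Longrightarrow> f' (f x) = x" "\<And>x. x \<in> sphere 0 1 \<Longrightarrow> f (f' x) = x"
  shows "bij_betw f (sphere 0 1) (sphere 0 1)"
    and "\<And>x. x \<in> sphere 0 1 \<Longrightarrow> inv_into (sphere 0 1) f x = f' x"
proof -
  show bij: "bij_betw f (sphere 0 1) (sphere 0 1)"
    by (rule bij_betw_byWitness[where f' = f']) (use assms in auto)
  show "inv_into (sphere 0 1) f x = f' x" if "x \<in> sphere 0 1" for x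
    using that assms bij by (intro inv_into_f_eq) (auto simp: bij_betw_def)
qed

lemma entire_symmetry_volume_diffeo:
  assumes "entire_symmetry h h' G G'"
  shows "h \<in> entire_volume_diffeos" "entire_map_ext h G" "entire_map_ext (inv_into (sphere 0 1) h) G'"
proof -
  note D = entire_symmetryD[OF assms]
  have inv: "bij_betw h (sphere 0 1) (sphere 0 1)"
    "\<And>x. x \<in> sphere 0 1 \<Longrightarrow> inv_into (sphere 0 1) h x = h' x"
    using inverse_on_sphere[of h h'] D by auto
  show 1: "entire_map_ext h G"
    using assms D by (auto simp: entire_map_ext_def entire_ext_def entire_symmetry_def entire_vec_def)
  have "entire_map_ext h' G'"
    using assms D by (auto simp: entire_map_ext_def entire_ext_def entire_symmetry_def entire_vec_def)
  then show 2: "entire_map_ext (inv_into (sphere 0 1) h) G'"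
    by (rule entire_map_ext_cong) (rule inv(2))
  show "h \<in> entire_volume_diffeos"
    using 1 2 inv(1) assms by (auto simp: entire_volume_diffeos_def entire_diffeos_def entire_symmetry_def)
qed

lemma analytic_dist_le:
  assumes "\<Delta> \<ge> 0" "\<And>z. z \<in> cball 0 \<Delta> \<Longrightarrow> norm (F z - G z) \<le> c"
    "\<And>z. z \<in> cball 0 \<Delta> \<Longrightarrow> norm (F' z - G' z) \<le> c"
  shows "analytic_dist \<Delta> (F, F') (G, G') \<le> c"
  unfolding analytic_dist_def using assms by (auto intro!: cSUP_least)

text \<open>The bound \<open>c\<close> makes the supremum a genuine upper bound; the value at 0 then
  shows the sign.\<close>

lemma analytic_dist_nonneg:
  assumes "\<Delta> \<ge> 0" "\<And>z. z \<in> cball 0 \<Delta> \<Longrightarrow> norm (F z - G z) \<le> c"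
  shows "0 \<le> analytic_dist \<Delta> (F, F') (G, G')"
proof -
  have "norm (F 0 - G 0) \<le> (SUP z\<in>cball 0 \<Delta>. norm (F z - G z))"
    using assms by (intro cSUP_upper) (auto simp: bdd_above_def intro!: exI[of _ c])
  then have "0 \<le> (SUP z\<in>cball 0 \<Delta>. norm (F z - G z))" using norm_ge_zero order_trans by blast
  then show ?thesis by (simp add: analytic_dist_def le_max_iff_disj)
qed

lemma exists_rational_close:
  assumes "(t::real) \<ge> 0" "\<delta> > 0"
  obtains p q :: nat where "q \<ge> 1" "\<bar>real p / real q - t\<bar> \<le> \<delta>"
proof -
  obtain q where q: "q \<ge> 1" "\<And>M. M \<ge> q \<Longrightarrow> 1 / real M \<le> \<delta>" using exists_large_nat[OF assms(2)] by blast
  define p where "p = nat \<lfloor>t * real q\<rfloor>"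
  have "real p \<le> t * real q" "t * real q \<le> real p + 1"
    using assms(1) by (auto simp: p_def)
  then have "\<bar>real p - t * real q\<bar> \<le> 1" by linarith
  then have "\<bar>real p - t * real q\<bar> / real q \<le> 1 / real q" by (intro divide_right_mono) auto
  moreover have "real p / real q - t = (real p - t * real q) / real q" using q(1) by (simp add: diff_divide_distrib)
  ultimately have "\<bar>real p / real q - t\<bar> \<le> 1 / real q" by (simp add: abs_divide)
  with q show thesis by (intro that[of q p]) (auto intro: order_trans)
qed

text \<open>Step \<open>n\<close> treats the function \<open>e (fst (prod_decode n))\<close>, so each \<open>e j\<close> is treated infinitely often.\<close>

lemma construction:
  fixes t\<^sub>0 \<epsilon> R :: real and e :: "nat \<Rightarrow> real^('n::finite \<times> 2) \<Rightarrow> real"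
  assumes "0 \<le> t\<^sub>0" "\<epsilon> > 0" and e: "\<And>j. continuous_on UNIV (e j)"
  obtains h h' :: "nat \<Rightarrow> real^('n \<times> 2) \<Rightarrow> real^('n \<times> 2)" and G G' t \<eta> where
    "\<And>n. entire_symmetry (h n) (h' n) (G n) (G' n)"
    "\<And>n. \<eta> n > 0" "\<And>n. \<eta> (Suc n) \<le> \<eta> n / 2" "\<eta> 0 \<le> \<epsilon>"
    "\<And>z. z \<in> cball 0 R \<Longrightarrow> norm (G 0 (rot (t 0) (G' 0 z)) - rot t\<^sub>0 z) \<le> \<epsilon> \<and>
      norm (G 0 (rot (- t 0) (G' 0 z)) - rot (- t\<^sub>0) z) \<le> \<epsilon>"
    "\<And>n z. z \<in> cball 0 R \<Longrightarrow>
      norm (G (Suc n) (rot (t (Suc n)) (G' (Suc n) z)) - G n (rot (t n) (G' n z))) \<le> \<eta> n \<and>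
      norm (G (Suc n) (rot (- t (Suc n)) (G' (Suc n) z)) - G n (rot (- t n) (G' n z))) \<le> \<eta> n"
    "\<And>n f. f \<in> sphere 0 1 \<rightarrow> sphere 0 1 \<Longrightarrow>
      \<forall>x\<in>sphere 0 1. norm (f x - h (Suc n) (rot (t (Suc n)) (h' (Suc n) x))) \<le> 2 * \<eta> (Suc n) \<Longrightarrow>
      nearly_constant_average (e (fst (prod_decode n))) (1 / real (Suc n)) f"
proof -
  \<comment> \<open>The state carries \<open>p\<close>, \<open>q\<close> and the tolerance besides
    the conjugacy. Closeness to \<open>rot t\<^sub>0\<close> is imposed at \<open>n = 0\<close>
    only, inside \<open>P\<close>, so that dependent choice starts from such a state.\<close>
  define P where "P n = (\<lambda>(h :: real^('n \<times> 2) \<Rightarrow> real^('n \<times> 2), h', G, G', p :: nat, q :: nat, \<eta> :: real).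
     entire_symmetry h h' G G' \<and> q \<ge> 1 \<and> \<eta> > 0 \<and> (n = (0::nat) \<longrightarrow> \<eta> \<le> \<epsilon> \<and> (\<forall>z\<in>cball 0 R.
       norm (G (rot (real p / real q) (G' z)) - rot t\<^sub>0 z) \<le> \<epsilon> \<and>
       norm (G (rot (- (real p / real q)) (G' z)) - rot (- t\<^sub>0) z) \<le> \<epsilon>)))" for n
  define Q where "Q n = (\<lambda>(h :: real^('n \<times> 2) \<Rightarrow> real^('n \<times> 2), h' :: real^('n \<times> 2) \<Rightarrow> real^('n \<times> 2),
      G :: complex^('n \<times> 2) \<Rightarrow> complex^('n \<times> 2), G' :: complex^('n \<times> 2) \<Rightarrow> complex^('n \<times> 2),
      p :: nat, q :: nat, \<eta> :: real)
     (l :: real^('n \<times> 2) \<Rightarrow> real^('n \<times> 2), l' :: real^('n \<times> 2) \<Rightarrow> real^('n \<times> 2),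
      L :: complex^('n \<times> 2) \<Rightarrow> complex^('n \<times> 2), L' :: complex^('n \<times> 2) \<Rightarrow> complex^('n \<times> 2),
      p\<^sub>1 :: nat, q\<^sub>1 :: nat, \<eta>\<^sub>1 :: real).
     \<eta>\<^sub>1 \<le> \<eta> / 2 \<and> (\<forall>z\<in>cball 0 R.
      norm (L (rot (real p\<^sub>1 / real q\<^sub>1) (L' z)) - G (rot (real p / real q) (G' z))) \<le> \<eta> \<and>
      norm (L (rot (- (real p\<^sub>1 / real q\<^sub>1)) (L' z)) - G (rot (- (real p / real q)) (G' z))) \<le> \<eta>) \<and>
     (\<forall>f. f \<in> sphere 0 1 \<rightarrow> sphere 0 1 \<and>
      (\<forall>x\<in>sphere 0 1. norm (f x - l (rot (real p\<^sub>1 / real q\<^sub>1) (l' x))) \<le> 2 * \<eta>\<^sub>1) \<longrightarrow>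
      nearly_constant_average (e (fst (prod_decode n))) (1 / real (Suc n)) f))" for n
  have base: "\<exists>s. P 0 s"
  proof -
    have ent: "entire_vec (id :: complex^('n \<times> 2) \<Rightarrow> _)"
      using entire_symmetry_id[where 'a = "'n \<times> 2"] by (simp add: entire_symmetry_def)
    \<comment> \<open>The starting conjugacy is the identity, with a rational rotation number near
      \<open>t\<^sub>0\<close>.\<close>
    obtain \<delta> where \<delta>: "\<delta> > 0" "\<And>s z. \<bar>s - t\<^sub>0\<bar> \<le> \<delta> \<Longrightarrow> z \<in> cball 0 R \<Longrightarrow>
        norm (id (rot s (id z)) - id (rot t\<^sub>0 (id z)) :: complex^('n \<times> 2)) \<le> \<epsilon> \<and>
        norm (id (rot (- s) (id z)) - id (rot (- t\<^sub>0) (id z))) \<le> \<epsilon>"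
      using conjugated_rot_close[OF ent ent \<open>\<epsilon> > 0\<close>] by blast
    obtain p q :: nat where pq: "q \<ge> 1" "\<bar>real p / real q - t\<^sub>0\<bar> \<le> \<delta>"
      using exists_rational_close[OF assms(1) \<delta>(1)] by blast
    have "P 0 (id, id, id, id, p, q, \<epsilon>)"
      unfolding P_def prod.case using \<delta>(2)[OF pq(2)] pq(1) \<open>\<epsilon> > 0\<close>
      by (intro conjI entire_symmetry_id impI ballI) (auto simp only: id_apply)
    then show ?thesis by blast
  qed
  have step: "\<exists>s'. P (Suc n) s' \<and> Q n s s'" if "P n s" for n s
  proof -
    obtain h h' G G' p q \<eta> where s: "s = (h, h', G, G', p, q, \<eta>)" by (metis prod_cases7)
    have hyp: "entire_symmetry h h' G G'" "q \<ge> 1" "\<eta> > 0" using that by (auto simp: P_def s)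
    have "1 / real (Suc n) > 0" by simp
    obtain l l' L L' p\<^sub>1 q\<^sub>1 \<eta>\<^sub>1 where l: "entire_symmetry l l' L L'" "q\<^sub>1 \<ge> 1" "0 < \<eta>\<^sub>1" "\<eta>\<^sub>1 \<le> \<eta> / 2"
      "\<And>z. z \<in> cball 0 R \<Longrightarrow>
        norm (L (rot (real p\<^sub>1 / real q\<^sub>1) (L' z)) - G (rot (real p / real q) (G' z))) \<le> \<eta> \<and>
        norm (L (rot (- (real p\<^sub>1 / real q\<^sub>1)) (L' z)) - G (rot (- (real p / real q)) (G' z))) \<le> \<eta>"
      "\<And>f. f \<in> sphere 0 1 \<rightarrow> sphere 0 1 \<Longrightarrow>
        \<forall>x\<in>sphere 0 1. norm (f x - l (rot (real p\<^sub>1 / real q\<^sub>1) (l' x))) \<le> 2 * \<eta>\<^sub>1 \<Longrightarrow>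
        nearly_constant_average (e (fst (prod_decode n))) (1 / real (Suc n)) f"
      by (rule construction_step[OF hyp(1,2) e[of "fst (prod_decode n)"] \<open>1 / real (Suc n) > 0\<close> hyp(3),
            where p = p and R = R]) (rule that)
    have "P (Suc n) (l, l', L, L', p\<^sub>1, q\<^sub>1, \<eta>\<^sub>1)" using l(1-3) by (simp add: P_def)
    moreover have "Q n s (l, l', L, L', p\<^sub>1, q\<^sub>1, \<eta>\<^sub>1)"
      unfolding s Q_def prod.case using l(4-6) by blast
    ultimately show ?thesis by (intro exI conjI)
  qed
  have "\<exists>s. \<forall>n. P n (s n) \<and> Q n (s n) (s (Suc n))"
    using base step by (rule dependent_nat_choice)
  then obtain s where s: "\<And>n. P n (s n)" "\<And>n. Q n (s n) (s (Suc n))" by blast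
  define h where "h n = fst (s n)" for n
  define h' where "h' n = fst (snd (s n))" for n
  define G where "G n = fst (snd (snd (s n)))" for n
  define G' where "G' n = fst (snd (snd (snd (s n))))" for n
  define p where "p n = fst (snd (snd (snd (snd (s n)))))" for n
  define q where "q n = fst (snd (snd (snd (snd (snd (s n))))))" for n
  define \<eta> where "\<eta> n = snd (snd (snd (snd (snd (snd (s n))))))" for n
  have sn: "s n = (h n, h' n, G n, G' n, p n, q n, \<eta> n)" for n
    by (simp add: h_def h'_def G_def G'_def p_def q_def \<eta>_def)
  note Pn = s(1)[unfolded sn P_def prod.case] and Qn = s(2)[unfolded sn Q_def prod.case]
  show thesis
  proof (rule that[of h h' G G' \<eta> "\<lambda>n. real (p n) / real (q n)"])
    show "entire_symmetry (h n) (h' n) (G n) (G' n)" for n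
      by (rule Pn[THEN conjunct1])
    show "\<eta> n > 0" for n
      by (rule Pn[THEN conjunct2, THEN conjunct2, THEN conjunct1])
    show "\<eta> 0 \<le> \<epsilon>" using Pn[of 0] by (elim conjE) simp
    show "\<eta> (Suc n) \<le> \<eta> n / 2" for n using Qn[of n] by (elim conjE)
    show "norm (G 0 (rot (real (p 0) / real (q 0)) (G' 0 z)) - rot t\<^sub>0 z) \<le> \<epsilon> \<and>
      norm (G 0 (rot (- (real (p 0) / real (q 0))) (G' 0 z)) - rot (- t\<^sub>0) z) \<le> \<epsilon>"
      if "z \<in> cball 0 R" for z
      using Pn[of 0] that by blast
    show "norm (G (Suc n) (rot (real (p (Suc n)) / real (q (Suc n))) (G' (Suc n) z)) -
        G n (rot (real (p n) / real (q n)) (G' n z))) \<le> \<eta> n \<and>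
      norm (G (Suc n) (rot (- (real (p (Suc n)) / real (q (Suc n)))) (G' (Suc n) z)) -
        G n (rot (- (real (p n) / real (q n))) (G' n z))) \<le> \<eta> n"
      if "z \<in> cball 0 R" for n z
      using Qn[of n] that by blast
    show "nearly_constant_average (e (fst (prod_decode n))) (1 / real (Suc n)) f"
      if "f \<in> sphere 0 1 \<rightarrow> sphere 0 1"
        "\<forall>x\<in>sphere 0 1. norm (f x - h (Suc n) (rot (real (p (Suc n)) / real (q (Suc n))) (h' (Suc n) x)))
          \<le> 2 * \<eta> (Suc n)" for n f
      using Qn[of n] that by blast
  qed
qed

theorem theorem1:
  fixes t\<^sub>0 \<epsilon> \<Delta> :: real
  assumes "0 \<le> t\<^sub>0" "t\<^sub>0 \<le> 1" and "\<epsilon> > 0" and "\<Delta> > 0"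
  shows "\<exists>(f :: real^('n::finite \<times> 2) \<Rightarrow> real^('n \<times> 2)) F F'.
    f \<in> analytic_diffeos \<Delta> \<and>
    analytic_map_ext \<Delta> f F \<and> analytic_map_ext \<Delta> (inv_into (sphere 0 1) f) F' \<and>
    uniquely_ergodic_on (sphere 0 1) f \<and>
    invariant_measure sphere_volume f \<and>
    analytic_dist \<Delta> (F, F') (rot t\<^sub>0, rot (- t\<^sub>0)) < \<epsilon> \<and>
    (\<exists>(H :: nat \<Rightarrow> real^('n \<times> 2) \<Rightarrow> real^('n \<times> 2)) G G' (t :: nat \<Rightarrow> real).
      (\<forall>m\<ge>1. H m \<in> entire_volume_diffeos \<and>
        entire_map_ext (H m) (G m) \<and> entire_map_ext (inv_into (sphere 0 1) (H m)) (G' m)) \<and>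
      (\<lambda>m. analytic_dist \<Delta> (G m \<circ> rot (t m) \<circ> G' m, G m \<circ> rot (- t m) \<circ> G' m) (F, F'))
        \<longlonglongrightarrow> 0)"
proof -
  obtain e :: "nat \<Rightarrow> real^('n \<times> 2) \<Rightarrow> real" where e: "\<And>j. continuous_on UNIV (e j)"
    "\<And>M N. \<lbrakk>sphere_measure M; sphere_measure N; \<And>j. (\<integral>x. e j x \<partial>M) = (\<integral>x. e j x \<partial>N)\<rbrakk> \<Longrightarrow> M = N"
    using determining_functions by blast
  \<comment> \<open>The start costs \<open>\<epsilon> / 4\<close> and the passage to the limit
    \<open>2 * \<eta> 0\<close>, at most \<open>\<epsilon> / 2\<close>, which leaves a strict
    inequality.\<close>
  have "\<epsilon> / 4 > 0" using \<open>\<epsilon> > 0\<close> by simp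
  obtain h h' :: "nat \<Rightarrow> real^('n \<times> 2) \<Rightarrow> real^('n \<times> 2)" and G G' t \<eta> where
    sym: "\<And>n. entire_symmetry (h n) (h' n) (G n) (G' n)"
    and \<eta>: "\<And>n. \<eta> n > 0" "\<And>n. \<eta> (Suc n) \<le> \<eta> n / 2" "\<eta> 0 \<le> \<epsilon> / 4"
    and init: "\<And>z. z \<in> cball 0 (\<Delta> + 2) \<Longrightarrow> norm (G 0 (rot (t 0) (G' 0 z)) - rot t\<^sub>0 z) \<le> \<epsilon> / 4 \<and>
      norm (G 0 (rot (- t 0) (G' 0 z)) - rot (- t\<^sub>0) z) \<le> \<epsilon> / 4"
    and step: "\<And>n z. z \<in> cball 0 (\<Delta> + 2) \<Longrightarrow>
      norm (G (Suc n) (rot (t (Suc n)) (G' (Suc n) z)) - G n (rot (t n) (G' n z))) \<le> \<eta> n \<and>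
      norm (G (Suc n) (rot (- t (Suc n)) (G' (Suc n) z)) - G n (rot (- t n) (G' n z))) \<le> \<eta> n"
    and avg: "\<And>n f. f \<in> sphere 0 1 \<rightarrow> sphere 0 1 \<Longrightarrow>
      \<forall>x\<in>sphere 0 1. norm (f x - h (Suc n) (rot (t (Suc n)) (h' (Suc n) x))) \<le> 2 * \<eta> (Suc n) \<Longrightarrow>
      nearly_constant_average (e (fst (prod_decode n))) (1 / real (Suc n)) f"
    by (rule construction[OF assms(1) \<open>\<epsilon> / 4 > 0\<close> e(1), where R = "\<Delta> + 2"]) (rule that)
  obtain f F where F: "\<And>n z. z \<in> cball 0 (\<Delta> + 2) \<Longrightarrow> norm (G n (rot (t n) (G' n z)) - F z) \<le> 2 * \<eta> n"
    and f: "\<And>n x. x \<in> sphere 0 1 \<Longrightarrow> norm (h n (rot (t n) (h' n x)) - f x) \<le> 2 * \<eta> n"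
    "f \<in> sphere 0 1 \<rightarrow> sphere 0 1" "continuous_on (sphere 0 1) f" "analytic_map_ext \<Delta> f F"
    "invariant_measure sphere_volume f"
    by (rule conj_rot_limit[where h = h and h' = h' and G = G and G' = G' and \<eta> = \<eta> and \<Delta> = \<Delta> and t = t,
          OF sym \<eta>(1,2) \<open>\<Delta> > 0\<close> conjunct1[OF step]]) (assumption, rule that)
  obtain f' F' where F': "\<And>n z. z \<in> cball 0 (\<Delta> + 2) \<Longrightarrow> norm (G n (rot (- t n) (G' n z)) - F' z) \<le> 2 * \<eta> n"
    and f': "\<And>n x. x \<in> sphere 0 1 \<Longrightarrow> norm (h n (rot (- t n) (h' n x)) - f' x) \<le> 2 * \<eta> n"
    "f' \<in> sphere 0 1 \<rightarrow> sphere 0 1" "continuous_on (sphere 0 1) f'" "analytic_map_ext \<Delta> f' F'"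
    by (rule conj_rot_limit[where h = h and h' = h' and G = G and G' = G' and \<eta> = \<eta> and \<Delta> = \<Delta> and t = "\<lambda>n. - t n",
          OF sym \<eta>(1,2) \<open>\<Delta> > 0\<close> conjunct2[OF step]]) (assumption, rule that)
  have \<eta>0: "(\<lambda>n. 2 * \<eta> n) \<longlonglongrightarrow> 0"
    using tendsto_mult_right_zero[OF halving_tendsto_0[of \<eta>, OF \<eta>(1,2)]] by simp
  \<comment> \<open>The approximant with \<open>- \<sigma> n\<close> inverts the one with
    \<open>\<sigma> n\<close> exactly. Uniform closeness to \<open>b\<close> at the moving points
    \<open>y n\<close>, and continuity of \<open>b\<close>, carry this to the limit; both signs of
    \<open>t\<close> are instances.\<close>
  have inverse: "b (a x) = x"
    if a: "\<And>n x. x \<in> sphere 0 1 \<Longrightarrow> norm (h n (rot (\<sigma> n) (h' n x)) - a x) \<le> 2 * \<eta> n"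
      and b: "\<And>n x. x \<in> sphere 0 1 \<Longrightarrow> norm (h n (rot (- \<sigma> n) (h' n x)) - b x) \<le> 2 * \<eta> n"
        "continuous_on (sphere 0 1) b"
      and aS: "a \<in> sphere 0 1 \<rightarrow> sphere 0 1" and x: "x \<in> sphere 0 1" for a b \<sigma> x
  proof -
    define y where "y n = h n (rot (\<sigma> n) (h' n x))" for n
    have y: "y n \<in> sphere 0 1" "h n (rot (- \<sigma> n) (h' n (y n))) = x" for n
      using x by (simp_all add: y_def entire_symmetryD[OF sym])
    have "y \<longlonglongrightarrow> a x"
      unfolding y_def by (rule tendsto_norm_diff_le[OF a[OF x] \<eta>0])
    then have "(\<lambda>n. b (y n)) \<longlonglongrightarrow> b (a x)"
      using aS x y(1) by (intro continuous_on_tendsto_compose[OF b(2)]) auto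
    moreover have "(\<lambda>n. b (y n)) \<longlonglongrightarrow> x"
    proof (rule tendsto_norm_diff_le[OF _ \<eta>0])
      show "norm (b (y n) - x) \<le> 2 * \<eta> n" for n
        using b(1)[OF y(1), of n n] y(2)[of n] by (simp add: norm_minus_commute)
    qed
    ultimately show ?thesis by (rule LIMSEQ_unique)
  qed
  have inv: "f' (f x) = x" "f (f' x) = x" if "x \<in> sphere 0 1" for x
    using inverse[of t f f' x, OF f(1) f'(1,3) f(2) that]
      inverse[of "\<lambda>n. - t n" f' f x, OF f'(1) _ f(3) f'(2) that] f(1) by simp_all
  note bij = inverse_on_sphere[OF f(2) f'(2) inv]
  have ext': "analytic_map_ext \<Delta> (inv_into (sphere 0 1) f) F'"
    by (rule analytic_map_ext_cong[OF f'(4) bij(2)])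
  have diffeo: "f \<in> analytic_diffeos \<Delta>"
    using bij(1) f(4) ext' by (auto simp: analytic_diffeos_def)
  have "nearly_constant_average (e j) \<delta> f" if "\<delta> > 0" for j \<delta>
  proof -
    obtain N where N: "N \<ge> 1" "\<And>M. M \<ge> N \<Longrightarrow> 1 / real M \<le> \<delta>" using exists_large_nat[OF \<open>\<delta> > 0\<close>] by blast
    \<comment> \<open>This step treats \<open>e j\<close>, and since \<open>N \<le> n\<close> its
      tolerance \<open>1 / real (Suc n)\<close> is at most \<open>\<delta>\<close>.\<close>
    define n where "n = prod_encode (j, N)"
    have "N \<le> n" unfolding n_def by (rule le_prod_encode_2)
    then have "1 / real (Suc n) \<le> \<delta>" by (intro N) simp
    moreover have "nearly_constant_average (e (fst (prod_decode n))) (1 / real (Suc n)) f"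
      using f(1)[of _ "Suc n"] by (intro avg[OF f(2)]) (simp add: norm_minus_commute)
    ultimately show ?thesis
      unfolding nearly_constant_average_def n_def by (auto intro: order_trans)
  qed
  then have ue: "uniquely_ergodic_on (sphere 0 1) f"
    by (intro uniquely_ergodicI[OF f(3,2) f'(3,2) inv f(5) e])
  have sub: "z \<in> cball 0 \<Delta> \<Longrightarrow> z \<in> cball 0 (\<Delta> + 2)" for z :: "complex^('n \<times> 2)" by simp
  have "analytic_dist \<Delta> (F, F') (rot t\<^sub>0, rot (- t\<^sub>0)) \<le> 3 * \<epsilon> / 4"
  proof (rule analytic_dist_le)
    fix z :: "complex^('n \<times> 2)" assume "z \<in> cball 0 \<Delta>"
    note z = sub[OF this]
    show "norm (F z - rot t\<^sub>0 z) \<le> 3 * \<epsilon> / 4"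
      using F[OF z, of 0] init[OF z] \<eta>(3)
        norm_triangle_ineq4[of "G 0 (rot (t 0) (G' 0 z)) - rot t\<^sub>0 z" "G 0 (rot (t 0) (G' 0 z)) - F z"]
      by simp
    show "norm (F' z - rot (- t\<^sub>0) z) \<le> 3 * \<epsilon> / 4"
      using F'[OF z, of 0] init[OF z] \<eta>(3)
        norm_triangle_ineq4[of "G 0 (rot (- t 0) (G' 0 z)) - rot (- t\<^sub>0) z" "G 0 (rot (- t 0) (G' 0 z)) - F' z"]
      by simp
  qed (use \<open>\<Delta> > 0\<close> in simp)
  then have dist: "analytic_dist \<Delta> (F, F') (rot t\<^sub>0, rot (- t\<^sub>0)) < \<epsilon>" using \<open>\<epsilon> > 0\<close> by simp
  have lim: "(\<lambda>m. analytic_dist \<Delta> (G m \<circ> rot (t m) \<circ> G' m, G m \<circ> rot (- t m) \<circ> G' m) (F, F')) \<longlonglongrightarrow> 0"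
  proof (rule tendsto_sandwich[OF always_eventually always_eventually tendsto_const \<eta>0])
    show "\<forall>m. 0 \<le> analytic_dist \<Delta> (G m \<circ> rot (t m) \<circ> G' m, G m \<circ> rot (- t m) \<circ> G' m) (F, F')"
    proof
      show "0 \<le> analytic_dist \<Delta> (G m \<circ> rot (t m) \<circ> G' m, G m \<circ> rot (- t m) \<circ> G' m) (F, F')" for m
        using \<open>\<Delta> > 0\<close> F[OF sub, of _ m] by (intro analytic_dist_nonneg[where c = "2 * \<eta> m"]) auto
    qed
    show "\<forall>m. analytic_dist \<Delta> (G m \<circ> rot (t m) \<circ> G' m, G m \<circ> rot (- t m) \<circ> G' m) (F, F') \<le> 2 * \<eta> m"
      using \<open>\<Delta> > 0\<close> F F' sub by (intro allI analytic_dist_le) auto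
  qed
  show ?thesis
    using diffeo f(4,5) ext' ue dist lim entire_symmetry_volume_diffeo[OF sym]
    by (intro exI[of _ f] exI[of _ F] exI[of _ F'] conjI exI[of _ h] exI[of _ G] exI[of _ G'] exI[of _ t]) auto
qed

end
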